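(* Let $-\infty\le r_1\le r_2\le\cdots\le r_n\le\infty$ be a non-decreasing sequence of integers (possibly including $\pm\infty$), let $\lambda\in P_n$ and $\beta\in Q_n^+$. Then $$ \begin{aligned} &J\left({{r_1,r_2}\atop Q_1^+}\Bigl|\cdots\Bigl|{{r_n,\infty}\atop Q_n^+}\Bigl|\lambda,\beta\right)\\ &\quad=\sum_{\substack{\gamma^{(1)}+\cdots+\gamma^{(n)}=\beta\\ \gamma^{(i)}\in R_i^+}} J\left({{r_1,\infty}\atop Q_1^+}\Bigl|\lambda^{(1)},\gamma^{(1)}\right)\times\prod_{i=2}^n J\left({{-\infty,r_i}\atop Q_{i-1}^+}\Bigl|{{r_i,\infty}\atop Q_i^+}\Bigl|\lambda^{(i)},\gamma^{(i)}\right), \end{aligned} $$ where, for each $(\gamma^{(1)},\ldots,\gamma^{(n)})$ in the sum, the weights $\lambda^{(i)}$ are determined by $\lambda^{(n)}=\lambda$ and $\lambda^{(i)}=(\lambda^{(i+1)}-\gamma^{(i+1)})|_{P_i}$ for $i=n-1,\ldots,1$.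
   Context: Let $\epsilon_0,\ldots,\epsilon_n$ be orthonormal for $(\ ,\ )$; $\alpha_i=\epsilon_{i-1}-\epsilon_i$ and $\omega_i=\epsilon_0+\cdots+\epsilon_{i-1}$ for $1\le i\le n$; $\rho=\sum_{i=1}^n\omega_i$. For $1\le i\le n$ set $P_i=\bigoplus_{j=0}^i\mathbb{Z}\epsilon_j$, $Q_i^+=\bigoplus_{j=1}^i\mathbb{Z}_{\ge0}\alpha_j$ and $$R_i^+=\mathbb{Z}_{\ge0}(\alpha_1+\cdots+\alpha_i)\oplus\mathbb{Z}_{\ge0}(\alpha_2+\cdots+\alpha_i)\oplus\cdots\oplus\mathbb{Z}_{\ge0}\alpha_i .$$ The map $|_{P_i}$ is the projection to $P_i$: $\epsilon_k|_{P_i}=\epsilon_k$ if $k\le i$ and $0$ if $k>i$. For $\gamma=\sum_j c_j\alpha_j$ with $c_j\ge 0$ set $(q)_\gamma=\prod_j(q)_{c_j}$, where $(q)_m=\prod_{i=1}^m(1-q^i)$. For a non-decreasing sequence $-\infty\le r_1\le\cdots\le r_N\le\infty$ of integers (possibly including $\pm\infty$), $I=[r_1,\infty)$, $\mu\in P_N$ and $\beta\in Q_N^+$, define $$ J\left({{r_1,r_2}\atop Q_1^+}\Bigl|\cdots\Bigl|{{r_N,\infty}\atop Q_N^+}\Bigl|\mu,\beta\right)=\sum_{\{\gamma_t\}_{t\in I}}\frac{q^{B(\{\gamma_t\}|\mu)}}{\prod_{t\in I}(q)_{\gamma_t}},\qquad B(\{\gamma_t\}|\mu)=\frac12\sum_{t,t'\in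 I}\min(t,t')(\gamma_t,\gamma_{t'})-\Bigl(\mu+\rho,\sum_{t\in I}t\gamma_t\Bigr), $$ the sum being over all families $\gamma_t\in Q_N^+$ ($t\in I$) with $\sum_{t\in I}\gamma_t=\beta$ and $\gamma_t\in Q_i^+$ for $r_i\le t<r_{i+1}$ ($1\le i\le N$, with $r_{N+1}=\infty$). In particular $J\left({{r,\infty}\atop Q_1^+}\bigl|\mu,\beta\right)$ is the case $N=1$, $r_1=r$. Likewise $J\left({{s,r}\atop Q_{i-1}^+}\bigl|{{r,\infty}\atop Q_i^+}\bigl|\mu,\beta\right)$ is the same sum over $t\ge s$, with $\gamma_t\in Q_{i-1}^+$ for $s\le t<r$ and $\gamma_t\in Q_i^+$ for $t\ge r$; here $\mu\in P_i$, $\beta\in Q_i^+$. These sums are regarded as rational functions of $q$ and the $z_j=q^{-(\mu+\rho,\alpha_j)}$, and symbols with infinite $r_i$ or $s=-\infty$ are understood as limits of those with finite values. *)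

theory Defs
  imports
    Complex_Main
    "HOL-Library.Poly_Mapping"
    "HOL-Library.Extended"
    "HOL-Library.FuncSet"
    "HOL-Computational_Algebra.Fraction_Field"
begin

subsection \<open>Weights and roots\<close>

text \<open>Weights are given by their coordinates in the orthonormal basis
  \<open>\<epsilon>\<^sub>0, \<epsilon>\<^sub>1, \<dots>\<close>.\<close>

type_synonym wt = "nat \<Rightarrow>\<^sub>0 int"

definition eps :: "nat \<Rightarrow> wt" where
  "eps i = Poly_Mapping.single i 1"

definition ip :: "wt \<Rightarrow> wt \<Rightarrow> int" where
  "ip x y = (\<Sum>k\<in>Poly_Mapping.keys x. Poly_Mapping.lookup x k * Poly_Mapping.lookup y k)"

definition alpha :: "nat \<Rightarrow> wt" where
  "alpha i = eps (i - 1) - eps i"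

definition omega :: "nat \<Rightarrow> wt" where
  "omega i = (\<Sum>k<i. eps k)"

definition rho :: "nat \<Rightarrow> wt" where
  "rho n = (\<Sum>i=1..n. omega i)"

definition P :: "nat \<Rightarrow> wt set" where
  "P i = {x. Poly_Mapping.keys x \<subseteq> {0..i}}"

definition proj_P :: "nat \<Rightarrow> wt \<Rightarrow> wt" where
  "proj_P i x = (\<Sum>k\<le>i. Poly_Mapping.single k (Poly_Mapping.lookup x k))"

definition Qplus :: "nat \<Rightarrow> wt set" where
  "Qplus i = {\<Sum>j=1..i. frag_cmul (int (c j)) (alpha j) | c :: nat \<Rightarrow> nat. True}"

definition Rplus :: "nat \<Rightarrow> wt set" where
  "Rplus i = {\<Sum>k=1..i. frag_cmul (int (m k)) (\<Sum>j=k..i. alpha j) | m :: nat \<Rightarrow> nat. True}"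

text \<open>The coefficient \<open>c\<^sub>j\<close> of \<open>\<gamma> = \<Sum>\<^sub>j c\<^sub>j \<alpha>\<^sub>j\<close>; indeed \<open>(\<omega>\<^sub>j, \<alpha>\<^sub>k) = \<delta>\<^sub>j\<^sub>k\<close> for \<open>j, k \<ge> 1\<close>.\<close>

definition root_coeff :: "wt \<Rightarrow> nat \<Rightarrow> int" where
  "root_coeff \<gamma> j = ip (omega j) \<gamma>"


subsection \<open>Rational functions in \<open>q\<close> and \<open>Z\<^sub>1, Z\<^sub>2, \<dots>\<close>\<close>

text \<open>Polynomials over the rationals in variables indexed by \<open>nat\<close>:
  variable 0 is \<open>q\<close>, variable \<open>j \<ge> 1\<close> is \<open>Z\<^sub>j\<close>.\<close>

type_synonym qzpoly = "(nat \<Rightarrow>\<^sub>0 nat) \<Rightarrow>\<^sub>0 rat"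
type_synonym ratfun = "qzpoly fract"

definition var :: "nat \<Rightarrow> ratfun" where
  "var i = Fract (Poly_Mapping.single (Poly_Mapping.single i 1) 1) 1"

abbreviation qvar :: ratfun where "qvar \<equiv> var 0"
abbreviation Zvar :: "nat \<Rightarrow> ratfun" where "Zvar j \<equiv> var j"

definition qpoch :: "nat \<Rightarrow> ratfun" where
  "qpoch m = (\<Prod>i=1..m. 1 - qvar ^ i)"

definition zdeg :: "(nat \<Rightarrow>\<^sub>0 nat) \<Rightarrow> int" where
  "zdeg a = (\<Sum>j\<in>Poly_Mapping.keys a - {0}. int (Poly_Mapping.lookup a j))"

text \<open>For \<open>s = 1\<close> this is the order of vanishing at \<open>Z = 0\<close> of a nonzero polynomial, i.e. its
  lowest total degree in the \<open>Z\<^sub>j\<close>; for \<open>s = -1\<close> it is the order of vanishing at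
  \<open>Z = \<infinity>\<close>, i.e. minus its total degree in the \<open>Z\<^sub>j\<close>.\<close>

definition pval :: "int \<Rightarrow> qzpoly \<Rightarrow> int" where
  "pval s p = Min ((\<lambda>a. s * zdeg a) ` Poly_Mapping.keys p)"

text \<open>The extension of \<open>pval\<close> to a valuation of the rational function field: \<open>val_ge s N f\<close>
  says that \<open>f\<close> has order of vanishing at least \<open>N\<close>.\<close>

definition val_ge :: "int \<Rightarrow> int \<Rightarrow> ratfun \<Rightarrow> bool" where
  "val_ge s N f \<longleftrightarrow>
     f = 0 \<or> (\<exists>a b. a \<noteq> 0 \<and> b \<noteq> 0 \<and> f = Fract a b \<and> pval s a - pval s b \<ge> N)"

definition val_tendsto :: "int \<Rightarrow> ('a \<Rightarrow> ratfun) \<Rightarrow> ratfun \<Rightarrow> 'a filter \<Rightarrow> bool" where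
  "val_tendsto s X f F \<longleftrightarrow> (\<forall>N. eventually (\<lambda>x. val_ge s N (X x - f)) F)"

definition val_lim :: "int \<Rightarrow> ('a \<Rightarrow> ratfun) \<Rightarrow> 'a filter \<Rightarrow> ratfun" where
  "val_lim s X F = (THE f. val_tendsto s X f F)"


subsection \<open>The fermionic sums\<close>

text \<open>A symbol \<open>J\<close> is given by the list \<open>rs\<close> of the left endpoints of its blocks and the list
  \<open>ds\<close> of the ranks of the blocks: \<open>\<gamma>\<^sub>t \<in> Q\<^sub>d\<^sup>+\<close> with \<open>d = ds ! k\<close> for
  \<open>rs ! k \<le> t < rs ! (k + 1)\<close>, the last block extending to infinity. Families are extended by 0
  outside \<open>I = [rs ! 0, \<infinity>)\<close>, so that all sums over \<open>I\<close> become sums over the finite support.\<close>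

definition families :: "int list \<Rightarrow> nat list \<Rightarrow> wt \<Rightarrow> (int \<Rightarrow> wt) set" where
  "families rs ds \<beta> = {\<gamma>.
     finite {t. \<gamma> t \<noteq> 0} \<and> (\<Sum>t | \<gamma> t \<noteq> 0. \<gamma> t) = \<beta> \<and>
     (\<forall>t. t < rs ! 0 \<longrightarrow> \<gamma> t = 0) \<and>
     (\<forall>k < length rs. \<forall>t. rs ! k \<le> t \<and> (Suc k < length rs \<longrightarrow> t < rs ! Suc k)
        \<longrightarrow> \<gamma> t \<in> Qplus (ds ! k))}"

text \<open>The division by 2 is exact: the form is symmetric and \<open>(\<gamma>, \<gamma>)\<close> is even on the root lattice.\<close>

definition B :: "nat \<Rightarrow> wt \<Rightarrow> (int \<Rightarrow> wt) \<Rightarrow> int" where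
  "B n \<mu> \<gamma> = (let S = {t. \<gamma> t \<noteq> 0} in
     (\<Sum>t\<in>S. \<Sum>t'\<in>S. min t t' * ip (\<gamma> t) (\<gamma> t')) div 2
       - ip (\<mu> + rho n) (\<Sum>t\<in>S. frag_cmul t (\<gamma> t)))"

text \<open>The sums are to be read as rational functions of \<open>q\<close> and \<open>z\<^sub>j = q\<^bsup>-(\<mu>+\<rho>,\<alpha>\<^sub>j)\<^esup>\<close>. For a weight
  \<open>\<mu>\<close> with integral coordinates \<open>z\<^sub>j\<close> is a power of \<open>q\<close> and may be a pole. Hence all weights are
  displaced by one fixed generic weight \<open>\<xi>\<close>, which enters through the indeterminates
  \<open>Z\<^sub>j = q\<^bsup>-(\<xi>,\<alpha>\<^sub>j)\<^esup>\<close> only: \<open>summand n \<mu> \<gamma>\<close> is the summand of \<open>J(\<dots>|\<mu>,\<beta>)\<close> with \<open>\<mu>\<close> replaced by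
  \<open>\<mu> + \<xi>\<close>, i.e. with \<open>z\<^sub>j = q\<^bsup>-(\<mu>+\<rho>,\<alpha>\<^sub>j)\<^esup> Z\<^sub>j\<close>, which are independent variables for every \<open>\<mu>\<close>.
  The factor \<open>q\<^bsup>-(\<xi>, \<Sum>\<^sub>t t \<gamma>\<^sub>t)\<^esup>\<close> is the product of the powers of the \<open>Z\<^sub>j\<close>.\<close>

definition summand :: "nat \<Rightarrow> wt \<Rightarrow> (int \<Rightarrow> wt) \<Rightarrow> ratfun" where
  "summand n \<mu> \<gamma> = (let S = {t. \<gamma> t \<noteq> 0} in
     (qvar powi B n \<mu> \<gamma>) *
     (\<Prod>j=1..n. Zvar j powi (\<Sum>t\<in>S. t * root_coeff (\<gamma> t) j)) /
     (\<Prod>t\<in>S. \<Prod>j=1..n. qpoch (nat (root_coeff (\<gamma> t) j))))"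

text \<open>Finite endpoints: the rational function whose expansion at \<open>Z = 0\<close> is the given
  infinite sum.\<close>

definition J_fin :: "nat \<Rightarrow> int list \<Rightarrow> nat list \<Rightarrow> wt \<Rightarrow> wt \<Rightarrow> ratfun" where
  "J_fin n rs ds \<mu> \<beta> =
     val_lim 1 (\<lambda>A. \<Sum>\<gamma>\<in>A. summand n \<mu> \<gamma>) (finite_subsets_at_top (families rs ds \<beta>))"

text \<open>Infinite endpoints: the limit in which all endpoints equal to \<open>\<infinity>\<close> (independently, subject
  to monotonicity) tend to \<open>\<infinity>\<close>, followed by the limit in which those equal to \<open>-\<infinity>\<close> tend to
  \<open>-\<infinity>\<close>. A sum with left endpoint \<open>r\<close> scales with \<open>r\<close> through monomials in the \<open>Z\<^sub>j\<close> with exponents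
  proportional to \<open>r\<close>, e.g. \<open>(q z)\<^sup>r / ((1 - q) (1 - q z))\<close> for one block and \<open>\<beta> = \<alpha>\<^sub>1\<close>.
  Hence the first limit is taken for small \<open>Z\<close> and the second one for large \<open>Z\<close>.\<close>

definition J_pinf :: "nat \<Rightarrow> int extended list \<Rightarrow> nat list \<Rightarrow> wt \<Rightarrow> wt \<Rightarrow> ratfun" where
  "J_pinf n rs ds \<mu> \<beta> =
     val_lim 1 (\<lambda>as. J_fin n as ds \<mu> \<beta>)
       (INF T. principal
          {as. sorted as \<and> list_all2 (\<lambda>r a. r = Fin a \<or> r = Pinf \<and> T \<le> a) rs as})"

definition J :: "nat \<Rightarrow> int extended list \<Rightarrow> nat list \<Rightarrow> wt \<Rightarrow> wt \<Rightarrow> ratfun" where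
  "J n rs ds \<mu> \<beta> =
     val_lim (-1) (\<lambda>as. J_pinf n as ds \<mu> \<beta>)
       (INF T. principal
          {as. sorted as \<and>
               list_all2 (\<lambda>r a. if r = Minf then \<exists>b\<le>T. a = Fin b else a = r) rs as})"


subsection \<open>The weights \<open>\<lambda>\<^sup>(\<^sup>i\<^sup>)\<close>\<close>

primrec lam_down :: "nat \<Rightarrow> wt \<Rightarrow> (nat \<Rightarrow> wt) \<Rightarrow> nat \<Rightarrow> wt" where
  "lam_down n \<Lambda> g 0 = \<Lambda>"
| "lam_down n \<Lambda> g (Suc k) = proj_P (n - Suc k) (lam_down n \<Lambda> g k - g (n - k))"

text \<open>Thus \<open>lam_at n \<Lambda> g n = \<Lambda>\<close> and, for \<open>i < n\<close>,
  \<open>lam_at n \<Lambda> g i = proj_P i (lam_at n \<Lambda> g (i + 1) - g (i + 1))\<close>.\<close>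

definition lam_at :: "nat \<Rightarrow> wt \<Rightarrow> (nat \<Rightarrow> wt) \<Rightarrow> nat \<Rightarrow> wt" where
  "lam_at n \<Lambda> g i = lam_down n \<Lambda> g (n - i)"

end

theory Submission
  imports Defs
begin

text \<open>
  Collect the numbers \<open>J(0,\<infinity> | Q\<^sub>m\<^sup>+ | \<mu>, \<beta>)\<close> in a unipotent matrix \<open>J\<^sub>m\<close> with entry from \<open>\<mu>\<close> to
  \<open>\<mu> - \<beta>\<close>. Let \<open>T\<close> be the diagonal matrix \<open>q\<^bsup>(\<mu>+\<rho>,\<mu>+\<rho>)/2\<^esup>\<close> and \<open>E\<^sub>m\<close> the translation invariant matrix
  with entries \<open>1/(q)\<^sub>\<beta>\<close>. Splitting off \<open>\<gamma>\<^sub>0\<close> gives \<open>E\<^sub>m T J\<^sub>m = J\<^sub>m T\<close>, and in general a fermionic sum is an ordered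
  product of conjugates of the \<open>E\<^sub>m\<close> by powers of \<open>T\<close>. Telescoping turns it into the product of the
  matrices \<open>J\<^bsub>i-1\<^esub>\<^sup>-\<^sup>1 J\<^sub>i\<close> conjugated by \<open>T\<^sup>r\<close>, \<open>r = r\<^sub>i\<close>. The endpoints enter only through these
  conjugations, so all limits are immediate, an infinite endpoint turning its factor into the identity.
  This is the asserted formula, except that \<open>\<gamma>\<^sup>(\<^sup>i\<^sup>)\<close> still ranges over \<open>Q\<^sub>i\<^sup>+\<close>.

  It remains to show that \<open>F = J\<^bsub>m\<^esub>\<^sup>-\<^sup>1 J\<^bsub>m+1\<^esub>\<close> is supported on \<open>R\<^bsub>m+1\<^esub>\<^sup>+\<close>. Let \<open>D\<^sub>i\<close> be the diagonal matrix
  \<open>q\<^bsup>(\<mu>+\<rho>,\<epsilon>\<^sub>i)\<^esup>\<close> and \<open>X\<^sub>i\<close> the translation by \<open>\<alpha>\<^bsub>i+1\<^esub>\<close>. The difference Toda Hamiltonian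
  \<open>H\<^sub>m = D\<^sub>m + \<Sum>\<^bsub>i<m\<^esub> D\<^sub>i (1 - X\<^sub>i)\<close> commutes with \<open>E\<^sub>m T\<close>, whence \<open>H\<^sub>m J\<^sub>m = J\<^sub>m (D\<^sub>0 + \<dots> + D\<^sub>m)\<close>. As
  \<open>H\<^bsub>m+1\<^esub> = H\<^sub>m + D\<^bsub>m+1\<^esub> - D\<^sub>m X\<^sub>m\<close>, this yields \<open>[D\<^sub>0 + \<dots> + D\<^bsub>m+1\<^esub>, F] = N F\<close> with
  \<open>N = J\<^sub>m\<^sup>-\<^sup>1 D\<^sub>m X\<^sub>m J\<^sub>m\<close>. Conjugation by \<open>T\<close> turns \<open>N\<close> into \<open>Y D\<^bsub>m+1\<^esub>\<close>, \<open>Y = J\<^sub>m\<^sup>-\<^sup>1 X\<^sub>m J\<^sub>m\<close>, while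
  \<open>[D\<^sub>0 + \<dots> + D\<^sub>m, Y] = (1 - q) N\<close>. Comparing the two, the entry of \<open>N\<close> at \<open>\<gamma>\<close> vanishes unless the monomial
  \<open>D\<^bsub>m+1\<^esub> \<Prod>\<^sub>i D\<^sub>i\<^sup>\<gamma>\<^sup>i\<close> is one of \<open>D\<^sub>0, \<dots>, D\<^sub>m\<close>, that is, unless \<open>\<gamma> = \<alpha>\<^bsub>i+1\<^esub> + \<dots> + \<alpha>\<^bsub>m+1\<^esub>\<close> for some \<open>i\<close>. So
  \<open>F\<close> is supported on sums of such vectors.
\<close>

section \<open>Coefficient vectors and the weights they represent\<close>

abbreviation lookup :: "('a \<Rightarrow>\<^sub>0 'b::zero) \<Rightarrow> 'a \<Rightarrow> 'b" where "lookup \<equiv> Poly_Mapping.lookup"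
abbreviation keys :: "('a \<Rightarrow>\<^sub>0 'b::zero) \<Rightarrow> 'a set" where "keys \<equiv> Poly_Mapping.keys"
abbreviation single :: "'a \<Rightarrow> 'b \<Rightarrow> 'a \<Rightarrow>\<^sub>0 'b::zero" where "single \<equiv> Poly_Mapping.single"

text \<open>A \<open>cvec\<close> \<open>c\<close> lists the coefficients of an element of \<open>Q\<^sup>+\<close> with indices shifted by one: \<open>lookup c j\<close>
  belongs to \<open>alpha (Suc j)\<close>, hence to \<open>omega (Suc j)\<close> and \<open>Zvar (Suc j)\<close>.\<close>

type_synonym cvec = "nat \<Rightarrow>\<^sub>0 nat"

definition wt :: "cvec \<Rightarrow> wt" where
  "wt c = (\<Sum>j\<in>keys c. frag_cmul (int (lookup c j)) (alpha (Suc j)))"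

lemma lookup_eps: "lookup (eps i) k = (if k = i then 1 else 0)"
  by (simp add: eps_def lookup_single when_def)

lemma lookup_alpha_Suc:
  "lookup (alpha (Suc j)) k = (if k = j then 1 else 0) - (if k = Suc j then 1 else 0)"
  by (simp add: alpha_def lookup_minus lookup_eps)

lemma wt_superset:
  assumes "finite A" "keys c \<subseteq> A"
  shows "wt c = (\<Sum>j\<in>A. frag_cmul (int (lookup c j)) (alpha (Suc j)))"
  unfolding wt_def
  by (rule sum.mono_neutral_left[OF assms]) (auto simp: in_keys_iff)

lemma lookup_wt_0: "lookup (wt c) 0 = int (lookup c 0)"
proof -
  have "lookup (wt c) 0 = (\<Sum>j\<in>insert 0 (keys c). if j = 0 then int (lookup c 0) else 0)"
    unfolding wt_superset[OF finite.insertI[OF finite_keys] subset_insertI, of c 0] lookup_sum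
    by (rule sum.cong) (auto simp: lookup_alpha_Suc)
  then show ?thesis by simp
qed

text \<open>The vector \<open>eps (Suc k)\<close> occurs in two simple roots only: positively in
  \<open>alpha (Suc (Suc k))\<close> and negatively in \<open>alpha (Suc k)\<close>.\<close>

lemma lookup_wt_Suc: "lookup (wt c) (Suc k) = int (lookup c (Suc k)) - int (lookup c k)"
proof -
  let ?A = "insert k (insert (Suc k) (keys c))"
  have "lookup (wt c) (Suc k) = (\<Sum>j\<in>?A. (if j = Suc k then int (lookup c (Suc k)) else 0)
      - (if j = k then int (lookup c k) else 0))"
    by (subst wt_superset[of ?A])
       (auto simp: lookup_sum lookup_alpha_Suc intro!: sum.cong simp del: sum.insert)
  then show ?thesis by (simp add: sum_subtractf del: sum.insert)
qed

lemma wt_add: "wt (a + b) = wt a + wt b"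
proof (rule poly_mapping_eqI)
  fix k show "lookup (wt (a + b)) k = lookup (wt a + wt b) k"
    by (cases k) (simp_all add: lookup_add lookup_wt_0 lookup_wt_Suc)
qed

lemma wt_zero [simp]: "wt 0 = 0"
  by (simp add: wt_def)

text \<open>The coordinates of a weight \<open>wt c\<close> are successive differences of
  coefficients of \<open>c\<close>, so the coefficients can be recovered one after another. This is
  the linear independence of the simple roots.\<close>

lemma wt_eq_iff: "wt a = wt b \<longleftrightarrow> a = b"
proof
  assume *: "wt a = wt b"
  have "lookup a k = lookup b k" for k
  proof (induction k)
    case 0
    show ?case using lookup_wt_0[of a] lookup_wt_0[of b] * by simp
  next
    case (Suc k)
    then show ?case using lookup_wt_Suc[of a k] lookup_wt_Suc[of b k] * by simp
  qed
  then show "a = b" by (rule poly_mapping_eqI)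
qed simp

lemma wt_eq_0_iff [simp]: "wt c = 0 \<longleftrightarrow> c = 0"
  using wt_eq_iff[of c 0] by simp

lemma wt_single: "wt (single j (Suc 0)) = alpha (Suc j)"
  by (simp add: wt_def)

lemma keys_cvec_add: "keys (a + b :: cvec) = keys a \<union> keys b"
  by (auto simp: in_keys_iff lookup_add)

text \<open>The height, which is the pairing with \<rho> by \<open>ip_rho_wt\<close>. It is the
  induction measure for the recursions on kernels and gives the order of vanishing of
  \<open>tw\<close>.\<close>

definition ht :: "cvec \<Rightarrow> nat" where "ht c = (\<Sum>j\<in>keys c. lookup c j)"

lemma ht_superset:
  assumes "finite A" "keys c \<subseteq> A"
  shows "ht c = (\<Sum>j\<in>A. lookup c j)"
  unfolding ht_def
  by (rule sum.mono_neutral_left[OF assms]) (auto simp: in_keys_iff)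

lemma ht_add: "ht (a + b) = ht a + ht b"
proof -
  let ?A = "keys a \<union> keys b"
  have "ht a = (\<Sum>j\<in>?A. lookup a j)" "ht b = (\<Sum>j\<in>?A. lookup b j)"
    "ht (a + b) = (\<Sum>j\<in>?A. lookup (a + b) j)"
    by (rule ht_superset; auto simp: keys_cvec_add)+
  then show ?thesis by (simp add: lookup_add sum.distrib)
qed

lemma ht_0 [simp]: "ht 0 = 0"
  by (simp add: ht_def)

lemma ht_eq_0_iff [simp]: "ht c = 0 \<longleftrightarrow> c = 0"
proof
  assume "ht c = 0"
  then have "\<forall>k\<in>keys c. lookup c k = 0" unfolding ht_def by (subst (asm) sum_eq_0_iff) auto
  then show "c = 0" by (intro poly_mapping_eqI) (metis in_keys_iff lookup_zero)
qed simp

lemma ht_single [simp]: "ht (single j n) = n"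
  by (cases "n = 0") (simp_all add: ht_def)

section \<open>Ordered decompositions of a coefficient vector\<close>

definition splits :: "cvec \<Rightarrow> (cvec \<times> cvec) set" where
  "splits c = {(a, b). a + b = c}"

lemma splits_iff [simp]: "(a, b) \<in> splits c \<longleftrightarrow> a + b = c"
  by (simp add: splits_def)

text \<open>Coefficients are natural numbers, so those of a summand are at most the height of
  \<open>c\<close> and vanish outside \<open>keys c\<close>.\<close>

lemma finite_summands: "finite {b. \<exists>a. a + b = (c :: cvec)}"
proof -
  let ?Fk = "{f. \<forall>k. (k \<in> keys c \<longrightarrow> f k \<in> {..ht c}) \<and> (k \<notin> keys c \<longrightarrow> f k = 0)}"
  have fin: "finite ?Fk" by (rule finite_set_of_finite_funs) auto
  have "lookup ` {b. \<exists>a. a + b = c} \<subseteq> ?Fk"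
  proof safe
    fix a b k assume "c = a + b" "k \<in> keys (a + b)"
    have "lookup b k \<le> lookup (a + b) k" by (simp add: lookup_add)
    also have "\<dots> \<le> ht (a + b)" unfolding ht_def
      by (rule member_le_sum) (use \<open>k \<in> _\<close> in auto)
    finally show "lookup b k \<le> ht (a + b)" .
  qed (auto simp: in_keys_iff lookup_add)
  then have "finite (lookup ` {b. \<exists>a. a + b = c})" using fin finite_subset by blast
  then show ?thesis by (rule finite_imageD) (auto simp: inj_on_def intro: poly_mapping_eqI)
qed

lemma finite_splits [simp]: "finite (splits c)"
proof -
  have "splits c \<subseteq> (\<lambda>b. (c - b, b)) ` {b. \<exists>a. a + b = c}"
    by (auto simp: splits_def image_iff)
  then show ?thesis using finite_summands finite_subset by blast
qed

lemma splits_0 [simp]: "splits 0 = {(0, 0)}"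
proof -
  have "a = 0 \<and> b = 0" if "a + b = 0" for a b :: cvec
    using arg_cong[OF that, of ht] by (simp add: ht_add)
  from this have "p = (0, 0)" if "p \<in> splits 0" for p
    using that by (cases p) (metis splits_iff)
  moreover have "(0, 0) \<in> splits 0" by simp
  ultimately show ?thesis by blast
qed

text \<open>Intended for matrix products with a diagonal left factor, where only the trivial
  decomposition contributes.\<close>

lemma sum_splits_left0:
  fixes f :: "cvec \<Rightarrow> cvec \<Rightarrow> 'a :: comm_monoid_add"
  assumes "\<And>a b. a + b = c \<Longrightarrow> a \<noteq> 0 \<Longrightarrow> f a b = 0"
  shows "(\<Sum>(a, b)\<in>splits c. f a b) = f 0 c"
proof -
  have "case_prod f p = 0" if "p \<in> splits c - {(0, c)}" for p
  proof (cases p)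
    case (Pair a b)
    then have "a + b = c" "a \<noteq> 0" using that by auto
    then show ?thesis using assms Pair by simp
  qed
  then have "(\<Sum>(a, b)\<in>splits c. f a b) = (\<Sum>(a, b)\<in>{(0, c)}. f a b)"
    by (intro sum.mono_neutral_right) simp_all
  then show ?thesis by simp
qed

lemma sum_splits_right0:
  fixes f :: "cvec \<Rightarrow> cvec \<Rightarrow> 'a :: comm_monoid_add"
  assumes "\<And>a b. a + b = c \<Longrightarrow> b \<noteq> 0 \<Longrightarrow> f a b = 0"
  shows "(\<Sum>(a, b)\<in>splits c. f a b) = f c 0"
proof -
  have "case_prod f p = 0" if "p \<in> splits c - {(c, 0)}" for p
  proof (cases p)
    case (Pair a b)
    then have "a + b = c" "b \<noteq> 0" using that by auto
    then show ?thesis using assms Pair by simp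
  qed
  then have "(\<Sum>(a, b)\<in>splits c. f a b) = (\<Sum>(a, b)\<in>{(c, 0)}. f a b)"
    by (intro sum.mono_neutral_right) simp_all
  then show ?thesis by simp
qed

text \<open>Both sides run over the triples with \<open>k + l + m = c\<close>; this becomes the
  associativity of the product of kernels.\<close>

lemma sum_splits_assoc:
  fixes f :: "cvec \<Rightarrow> cvec \<Rightarrow> cvec \<Rightarrow> 'a :: comm_monoid_add"
  shows "(\<Sum>(x, m)\<in>splits c. \<Sum>(k, l)\<in>splits x. f k l m) =
         (\<Sum>(k, y)\<in>splits c. \<Sum>(l, m)\<in>splits y. f k l m)"
proof -
  have "(\<Sum>(x, m)\<in>splits c. \<Sum>(k, l)\<in>splits x. f k l m) =
      (\<Sum>(p, r)\<in>(SIGMA p:splits c. splits (fst p)). f (fst r) (snd r) (snd p))"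
    by (subst sum.Sigma[symmetric]) (auto simp: case_prod_beta)
  also have "\<dots> = (\<Sum>(p, r)\<in>(SIGMA p:splits c. splits (snd p)). f (fst p) (fst r) (snd r))"
    by (rule sum.reindex_bij_witness[of _
          "\<lambda>((k, y), (l, m)). ((k + l, m), (k, l))" "\<lambda>((x, m), (k, l)). ((k, l + m), (l, m))"])
       (auto simp: add.assoc)
  also have "\<dots> = (\<Sum>(k, y)\<in>splits c. \<Sum>(l, m)\<in>splits y. f k l m)"
    by (subst sum.Sigma[symmetric]) (auto simp: case_prod_beta)
  finally show ?thesis .
qed

section \<open>The ring of kernels\<close>

text \<open>A kernel \<open>K\<close> stands for the lower triangular matrix indexed by weights whose entry from \<open>\<mu>\<close>
  to \<open>\<mu> - wt c\<close> is \<open>kapp K \<mu> c\<close>.\<close>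

typedef kern = "UNIV :: (wt \<Rightarrow> cvec \<Rightarrow> ratfun) set" morphisms kapp Kern by simp

lemma kapp_Kern [simp]: "kapp (Kern f) = f"
  by (simp add: Kern_inverse)

lemma kern_eqI: "(\<And>\<mu> c. kapp K \<mu> c = kapp L \<mu> c) \<Longrightarrow> K = L"
  by (metis ext kapp_inject)

instantiation kern :: ring_1
begin
definition zero_kern :: kern where "0 = Kern (\<lambda>\<mu> c. 0)"
definition one_kern :: kern where "1 = Kern (\<lambda>\<mu> c. if c = 0 then 1 else 0)"
definition plus_kern :: "kern \<Rightarrow> kern \<Rightarrow> kern" where "K + L = Kern (\<lambda>\<mu> c. kapp K \<mu> c + kapp L \<mu> c)"
definition minus_kern :: "kern \<Rightarrow> kern \<Rightarrow> kern" where "K - L = Kern (\<lambda>\<mu> c. kapp K \<mu> c - kapp L \<mu> c)"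
definition uminus_kern :: "kern \<Rightarrow> kern" where "- K = Kern (\<lambda>\<mu> c. - kapp K \<mu> c)"
text \<open>The matrix product, in which the right factor acts first: it leads from
  \<open>\<mu>\<close> to \<open>\<mu> - wt b\<close>, where the left factor starts.\<close>

definition times_kern :: "kern \<Rightarrow> kern \<Rightarrow> kern" where
  "K * L = Kern (\<lambda>\<mu> c. \<Sum>(a, b)\<in>splits c. kapp K (\<mu> - wt b) a * kapp L \<mu> b)"

lemma kapp_simps:
  "kapp 0 \<mu> c = 0" "kapp 1 \<mu> c = (if c = 0 then 1 else 0)"
  "kapp (K + L) \<mu> c = kapp K \<mu> c + kapp L \<mu> c" "kapp (K - L) \<mu> c = kapp K \<mu> c - kapp L \<mu> c"
  "kapp (- K) \<mu> c = - kapp K \<mu> c"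
  by (simp_all add: zero_kern_def one_kern_def plus_kern_def minus_kern_def uminus_kern_def)

lemma kapp_times: "kapp (K * L) \<mu> c = (\<Sum>(a, b)\<in>splits c. kapp K (\<mu> - wt b) a * kapp L \<mu> b)"
  by (simp add: times_kern_def)

instance
proof
  fix K L M :: kern
  show "K * L * M = K * (L * M)"
  proof (rule kern_eqI)
    fix \<mu> c
    have "kapp (K * L * M) \<mu> c = (\<Sum>(x, m)\<in>splits c. \<Sum>(k, l)\<in>splits x.
        kapp K (\<mu> - wt m - wt l) k * kapp L (\<mu> - wt m) l * kapp M \<mu> m)"
      by (simp add: kapp_times sum_distrib_right case_prod_beta)
    also have "\<dots> = (\<Sum>(k, y)\<in>splits c. \<Sum>(l, m)\<in>splits y.
        kapp K (\<mu> - wt m - wt l) k * kapp L (\<mu> - wt m) l * kapp M \<mu> m)"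
      by (rule sum_splits_assoc)
    also have "\<dots> = kapp (K * (L * M)) \<mu> c"
      unfolding kapp_times sum_distrib_left
      by (intro sum.cong refl) (auto simp: wt_add algebra_simps intro!: sum.cong)
    finally show "kapp (K * L * M) \<mu> c = kapp (K * (L * M)) \<mu> c" .
  qed
  show "1 * K = K"
  proof (rule kern_eqI)
    fix \<mu> c show "kapp (1 * K) \<mu> c = kapp K \<mu> c"
      unfolding kapp_times by (subst sum_splits_left0) (auto simp: kapp_simps)
  qed
  show "K * 1 = K"
  proof (rule kern_eqI)
    fix \<mu> c show "kapp (K * 1) \<mu> c = kapp K \<mu> c"
      unfolding kapp_times by (subst sum_splits_right0) (auto simp: kapp_simps)
  qed
  show "(K + L) * M = K * M + L * M"
    by (rule kern_eqI) (simp add: kapp_times kapp_simps case_prod_beta algebra_simps sum.distrib)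
  show "K * (L + M) = K * L + K * M"
    by (rule kern_eqI) (simp add: kapp_times kapp_simps case_prod_beta algebra_simps sum.distrib)
  show "(0::kern) \<noteq> 1"
  proof
    assume "(0::kern) = 1"
    then have "kapp 0 0 0 = kapp 1 0 0" by simp
    then show False by (simp add: kapp_simps)
  qed
qed (rule kern_eqI; simp add: kapp_simps)+
end

lemma kapp_sum: "kapp (sum K I) \<mu> c = (\<Sum>i\<in>I. kapp (K i) \<mu> c)"
  by (induction I rule: infinite_finite_induct) (simp_all add: kapp_simps)

definition diag :: "(wt \<Rightarrow> ratfun) \<Rightarrow> kern" where
  "diag f = Kern (\<lambda>\<mu> c. if c = 0 then f \<mu> else 0)"

lemma kapp_diag: "kapp (diag f) \<mu> c = (if c = 0 then f \<mu> else 0)"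
  by (simp add: diag_def)

lemma kapp_diag_times: "kapp (diag f * K) \<mu> c = f (\<mu> - wt c) * kapp K \<mu> c"
  unfolding kapp_times by (subst sum_splits_left0) (auto simp: kapp_diag)

lemma kapp_times_diag: "kapp (K * diag f) \<mu> c = kapp K \<mu> c * f \<mu>"
  unfolding kapp_times by (subst sum_splits_right0) (auto simp: kapp_diag)

definition Xk :: "nat \<Rightarrow> kern" where
  "Xk j = Kern (\<lambda>\<mu> c. if c = single j (Suc 0) then 1 else 0)"

lemma kapp_X: "kapp (Xk j) \<mu> c = (if c = single j (Suc 0) then 1 else 0)"
  by (simp add: Xk_def)

text \<open>Subtraction of coefficients is truncated at 0, hence the condition that the simple root
  really occurs in \<open>c\<close>.\<close>

lemma single_add_eq_iff:
  "single j (Suc 0) + b = c \<longleftrightarrow> lookup c j > 0 \<and> b = c - single j (Suc 0)" for b c :: cvec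
proof safe
  assume "lookup c j > 0" "b = c - single j (Suc 0)"
  then show "single j (Suc 0) + (c - single j (Suc 0)) = c"
    by (intro poly_mapping_eqI) (auto simp: lookup_add lookup_minus lookup_single when_def)
qed (auto simp: lookup_add)

lemma kapp_X_times:
  "kapp (Xk j * K) \<mu> c = (if lookup c j > 0 then kapp K \<mu> (c - single j (Suc 0)) else 0)"
proof -
  let ?b = "c - single j (Suc 0)"
  let ?S = "if lookup c j > 0 then {(single j (Suc 0), ?b)} else {}"
  have "kapp (Xk j * K) \<mu> c = (\<Sum>(a, b)\<in>?S. kapp (Xk j) (\<mu> - wt b) a * kapp K \<mu> b)"
    unfolding kapp_times
  proof (rule sum.mono_neutral_right)
    show "?S \<subseteq> splits c" using single_add_eq_iff[of j ?b c] by simp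
    show "\<forall>p\<in>splits c - ?S. (case p of (a, b) \<Rightarrow> kapp (Xk j) (\<mu> - wt b) a * kapp K \<mu> b) = 0"
      using single_add_eq_iff[of j _ c] by (force simp: kapp_X split: if_splits)
  qed simp
  then show ?thesis by (simp add: kapp_X)
qed

lemma kapp_times_X:
  "kapp (K * Xk j) \<mu> c =
    (if lookup c j > 0 then kapp K (\<mu> - alpha (Suc j)) (c - single j (Suc 0)) else 0)"
proof -
  let ?a = "c - single j (Suc 0)"
  let ?S = "if lookup c j > 0 then {(?a, single j (Suc 0))} else {}"
  have "kapp (K * Xk j) \<mu> c = (\<Sum>(a, b)\<in>?S. kapp K (\<mu> - wt b) a * kapp (Xk j) \<mu> b)"
    unfolding kapp_times
  proof (rule sum.mono_neutral_right)
    show "?S \<subseteq> splits c" using single_add_eq_iff[of j ?a c] by (simp add: add.commute)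
    show "\<forall>p\<in>splits c - ?S. (case p of (a, b) \<Rightarrow> kapp K (\<mu> - wt b) a * kapp (Xk j) \<mu> b) = 0"
      using single_add_eq_iff[of j _ c] by (force simp: kapp_X add.commute split: if_splits)
  qed simp
  then show ?thesis by (simp add: kapp_X wt_single)
qed

section \<open>The bilinear form and the exponents of the diagonal matrix \<open>T\<close>\<close>

lemma ip_superset:
  assumes "finite A" "keys x \<subseteq> A"
  shows "ip x y = (\<Sum>k\<in>A. lookup x k * lookup y k)"
  unfolding ip_def by (rule sum.mono_neutral_left[OF assms]) (auto simp: in_keys_iff)

lemma ip_commute: "ip x y = ip y x"
proof -
  let ?A = "keys x \<union> keys y"
  have "ip x y = (\<Sum>k\<in>?A. lookup x k * lookup y k)" "ip y x = (\<Sum>k\<in>?A. lookup y k * lookup x k)"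
    by (rule ip_superset; auto)+
  then show ?thesis by (simp add: mult.commute)
qed

lemma ip_add_right: "ip x (y + z) = ip x y + ip x z"
  by (simp add: ip_def lookup_add algebra_simps sum.distrib)

lemma ip_diff_right: "ip x (y - z) = ip x y - ip x z"
  by (simp add: ip_def lookup_minus algebra_simps sum_subtractf)

lemma ip_add_left: "ip (x + y) z = ip x z + ip y z"
  by (simp add: ip_commute[of _ z] ip_add_right)

lemma ip_diff_left: "ip (x - y) z = ip x z - ip y z"
  by (simp add: ip_commute[of _ z] ip_diff_right)

lemma ip_cmul_right: "ip x (frag_cmul k y) = k * ip x y"
  by (simp add: ip_def sum_distrib_left algebra_simps)

lemma ip_zero [simp]: "ip x 0 = 0" "ip 0 x = 0"
  by (simp_all add: ip_def)

lemma ip_sum_left: "ip (sum f A) y = (\<Sum>i\<in>A. ip (f i) y)"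
  by (induction A rule: infinite_finite_induct) (simp_all add: ip_add_left)

lemma ip_sum_right: "ip y (sum f A) = (\<Sum>i\<in>A. ip y (f i))"
  by (induction A rule: infinite_finite_induct) (simp_all add: ip_add_right)

lemma ip_eps: "ip (eps i) y = lookup y i"
  by (simp add: ip_def eps_def)

lemma ip_alpha_Suc: "ip y (alpha (Suc j)) = lookup y j - lookup y (Suc j)"
  by (simp add: alpha_def ip_diff_right ip_commute[of y] ip_eps)

lemma cvec_induct [case_names zero add]:
  assumes "R 0" "\<And>j c. R c \<Longrightarrow> R (single j (Suc 0) + c)"
  shows "R (c :: cvec)"
proof (induction "ht c" arbitrary: c)
  case 0
  then show ?case using assms(1) by simp
next
  case (Suc n)
  then have "c \<noteq> 0" by auto
  then obtain j where "lookup c j > 0" by (metis gr0I poly_mapping_eqI lookup_zero)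
  then have c: "single j (Suc 0) + (c - single j (Suc 0)) = c" by (subst single_add_eq_iff) simp
  have "ht (c - single j (Suc 0)) = n"
    using Suc(2) ht_add[of "single j (Suc 0)" "c - single j (Suc 0)"] unfolding c by simp
  then have "R (c - single j (Suc 0))" using Suc(1) by blast
  then show ?case using assms(2)[of "c - single j (Suc 0)" j] c by simp
qed

text \<open>A simple root has norm 2 and cross terms appear twice, so adding one changes the norm by
  an even number. This makes the halving in \<open>Wexp\<close> exact.\<close>

lemma even_ip_wt: "even (ip (wt c) (wt c))"
proof (induction c rule: cvec_induct)
  case (add j c)
  have "ip (alpha (Suc j)) (alpha (Suc j)) = 2" by (simp add: ip_alpha_Suc lookup_alpha_Suc)
  then show ?case using add by (simp add: wt_add wt_single ip_add_left ip_add_right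
      ip_commute[of "alpha (Suc j)" "wt c"])
qed simp

text \<open>The increment of half the norm of \<open>\<mu> + \<rho>\<close> on passing from
  \<open>\<mu>\<close> to \<open>\<mu> - wt c\<close>; the height stands for the pairing of \<rho>
  with \<open>wt c\<close>.\<close>

definition Wexp :: "wt \<Rightarrow> cvec \<Rightarrow> int" where
  "Wexp \<mu> c = ip (wt c) (wt c) div 2 - ip \<mu> (wt c) - int (ht c)"

text \<open>Increments add up along the path from \<open>\<mu>\<close> via
  \<open>\<mu> - wt b\<close> to \<open>\<mu> - wt (a + b)\<close>.\<close>

lemma W_add: "Wexp \<mu> (a + b) = Wexp (\<mu> - wt b) a + Wexp \<mu> b"
proof -
  obtain x y where "ip (wt a) (wt a) = 2 * x" "ip (wt b) (wt b) = 2 * y"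
    using even_ip_wt by (metis evenE)
  moreover have "(2 * x + 2 * ip (wt a) (wt b) + 2 * y) div 2 = x + ip (wt a) (wt b) + y" for x y
    by simp
  ultimately show ?thesis
    by (simp add: Wexp_def wt_add ip_add_left ip_add_right ip_diff_left ht_add
        ip_commute[of "wt b" "wt a"] algebra_simps)
qed

lemma W_0 [simp]: "Wexp \<mu> 0 = 0"
  by (simp add: Wexp_def)

lemma W_single: "Wexp \<mu> (single j (Suc 0)) = lookup \<mu> (Suc j) - lookup \<mu> j"
proof -
  have "ip (alpha (Suc j)) (alpha (Suc j)) = 2" by (simp add: ip_alpha_Suc lookup_alpha_Suc)
  moreover have "wt (single j (Suc 0)) = alpha (Suc j)" using wt_single by simp
  ultimately show ?thesis by (simp add: Wexp_def ip_alpha_Suc)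
qed

subsection \<open>Monomials\<close>

definition mon :: "(nat \<Rightarrow>\<^sub>0 nat) \<Rightarrow> ratfun" where
  "mon e = Fract (single e 1) 1"

lemma mon_0 [simp]: "mon 0 = 1"
  by (simp add: mon_def One_fract_def)

lemma mon_add: "mon (a + b) = mon a * mon b"
  by (simp add: mon_def mult_single)

lemma mon_nonzero [simp]: "mon a \<noteq> 0"
  by (simp add: mon_def Zero_fract_def eq_fract) (metis lookup_single_eq lookup_zero zero_neq_one)

lemma var_mon: "var i = mon (single i 1)"
  by (simp add: var_def mon_def)

lemma var_nonzero [simp]: "var i \<noteq> 0"
  by (simp add: var_mon)

lemma var_power: "var i ^ k = mon (single i k)"
  by (induction k) (simp_all add: var_mon mon_add[symmetric] single_add[symmetric])

lemma Fract_sum: "Fract (sum f A) 1 = (\<Sum>i\<in>A. Fract (f i) 1)"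
proof (induction A rule: infinite_finite_induct)
  case (insert x A)
  have "Fract (f x + sum f A) 1 = Fract (f x) 1 + Fract (sum f A) 1"
    by (subst add_fract) simp_all
  then show ?case using insert by simp
qed (simp_all add: Zero_fract_def)

lemma qvar_powi_add: "qvar powi (a + b) = qvar powi a * qvar powi b"
  by (simp add: power_int_add)

text \<open>The monomial in the Z belonging to \<open>i0\<close> is shared with no other term, so
  its coefficient vanishes by itself; a difference of two powers of q vanishes only if the exponents
  agree.\<close>

lemma mon_independent:
  assumes "finite I" "i0 \<in> I"
    and zero: "(\<Sum>i\<in>I. (qvar powi a i - qvar powi b i) * mon (e i)) = 0"
    and e0: "\<And>i. i \<in> I \<Longrightarrow> lookup (e i) 0 = 0"
    and distinct: "\<And>i. i \<in> I \<Longrightarrow> i \<noteq> i0 \<Longrightarrow> e i \<noteq> e i0"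
  shows "a i0 = b i0"
proof (rule ccontr)
  assume neq: "a i0 \<noteq> b i0"
  \<comment> \<open>Multiplication by \<open>qvar ^ K\<close> clears all negative powers of q, so
    that the relation becomes one between polynomials.\<close>
  define K where "K = nat (\<Sum>i\<in>I. \<bar>a i\<bar> + \<bar>b i\<bar>)"
  have K: "0 \<le> int K + a i" "0 \<le> int K + b i" if "i \<in> I" for i
  proof -
    have "\<bar>a i\<bar> + \<bar>b i\<bar> \<le> (\<Sum>i\<in>I. \<bar>a i\<bar> + \<bar>b i\<bar>)"
      by (rule member_le_sum) (use that assms(1) in auto)
    then show "0 \<le> int K + a i" "0 \<le> int K + b i" unfolding K_def by auto
  qed
  have shift: "qvar ^ K * qvar powi x = mon (single 0 (nat (int K + x)))" if "0 \<le> int K + x" for x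
  proof -
    have "qvar ^ K * qvar powi x = qvar powi (int K + x)" by (simp add: power_int_add)
    also have "\<dots> = qvar ^ nat (int K + x)" using that by (simp add: power_int_def)
    finally show ?thesis by (simp add: var_power)
  qed
  define A where "A i = single 0 (nat (int K + a i)) + e i" for i
  define B' where "B' i = single 0 (nat (int K + b i)) + e i" for i
  have "0 = qvar ^ K * (\<Sum>i\<in>I. (qvar powi a i - qvar powi b i) * mon (e i))"
    by (simp add: zero)
  also have "\<dots> = (\<Sum>i\<in>I. mon (A i) - mon (B' i))"
    unfolding sum_distrib_left
    by (rule sum.cong[OF refl]) (simp add: A_def B'_def mon_add K shift[symmetric] algebra_simps)
  also have "\<dots> = Fract (\<Sum>i\<in>I. single (A i) 1 - single (B' i) 1) 1"
    by (simp add: Fract_sum mon_def)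
  finally have "(\<Sum>i\<in>I. single (A i) 1 - single (B' i) 1) = (0 :: qzpoly)"
    by (simp add: Zero_fract_def eq_fract)
  \<comment> \<open>Read off the coefficient of the monomial \<open>A i0\<close>, to which only the
    first half of the term \<open>i0\<close> contributes.\<close>
  then have "(\<Sum>i\<in>I. lookup (single (A i) 1) (A i0) - lookup (single (B' i) 1) (A i0)) = (0 :: rat)"
    by (metis (mono_tags, lifting) lookup_minus lookup_sum lookup_zero sum.cong)
  moreover have "lookup (single (A i) 1) (A i0) - lookup (single (B' i) 1) (A i0)
      = (if i = i0 then 1 else (0 :: rat))" if "i \<in> I" for i
  proof (cases "i = i0")
    case True
    have "A i0 \<noteq> B' i0"
    proof
      assume "A i0 = B' i0"
      then have "lookup (A i0) 0 = lookup (B' i0) 0" by simp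
      then show False using K[OF assms(2)] neq by (simp add: A_def B'_def lookup_add)
    qed
    then show ?thesis using True by (simp add: lookup_single when_def)
  next
    case False
    then have "e i \<noteq> e i0" using distinct that by blast
    then obtain j where j: "lookup (e i) j \<noteq> lookup (e i0) j"
      by (metis poly_mapping_eqI)
    then have "j \<noteq> 0" using e0[OF that] e0[OF assms(2)] by (cases j) auto
    then have "lookup (A i) j \<noteq> lookup (A i0) j" "lookup (B' i) j \<noteq> lookup (A i0) j"
      using j by (simp_all add: A_def B'_def lookup_add lookup_single when_def)
    then have "A i \<noteq> A i0" "B' i \<noteq> A i0" by auto
    then show ?thesis using False by (simp add: lookup_single when_def)
  qed
  ultimately show False using assms(1,2) by simp
qed

lemma qvar_power_neq_1: "n > 0 \<Longrightarrow> qvar ^ n \<noteq> 1"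
proof
  assume n: "n > 0" "qvar ^ n = 1"
  have "int n = 0"
    by (rule mon_independent[of "{0 :: nat}" 0 "\<lambda>_. int n" "\<lambda>_. 0" "\<lambda>_. 0"]) (use n in auto)
  then show False using n by simp
qed

lemma qpoch_Suc: "qpoch (Suc m) = qpoch m * (1 - qvar ^ Suc m)"
  by (simp add: qpoch_def)

lemma qpoch_0 [simp]: "qpoch 0 = 1"
  by (simp add: qpoch_def)

lemma qpoch_nonzero [simp]: "qpoch m \<noteq> 0"
proof -
  have "1 - qvar ^ i \<noteq> 0" if "i > 0" for i using qvar_power_neq_1[OF that] by auto
  then show ?thesis by (auto simp: qpoch_def)
qed

text \<open>Variable 0 is reserved for q, whence the shifted index.\<close>

definition zexp :: "cvec \<Rightarrow> nat \<Rightarrow>\<^sub>0 nat" where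
  "zexp c = (\<Sum>j\<in>keys c. single (Suc j) (lookup c j))"

lemma zexp_superset:
  assumes "finite A" "keys c \<subseteq> A"
  shows "zexp c = (\<Sum>j\<in>A. single (Suc j) (lookup c j))"
  unfolding zexp_def by (rule sum.mono_neutral_left[OF assms]) (auto simp: in_keys_iff)

lemma lookup_zexp_0 [simp]: "lookup (zexp c) 0 = 0"
  by (simp add: zexp_def lookup_sum lookup_single)

lemma lookup_zexp_Suc [simp]: "lookup (zexp c) (Suc k) = lookup c k"
proof -
  have "lookup (zexp c) (Suc k) = (\<Sum>j\<in>keys c. if k = j then lookup c j else 0)"
    unfolding zexp_def lookup_sum by (rule sum.cong) (auto simp: lookup_single when_def)
  then show ?thesis by (simp add: in_keys_iff)
qed

lemma zexp_add: "zexp (a + b) = zexp a + zexp b"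
proof (rule poly_mapping_eqI)
  fix k show "lookup (zexp (a + b)) k = lookup (zexp a + zexp b) k"
    by (cases k) (simp_all add: lookup_add)
qed

lemma zexp_0 [simp]: "zexp 0 = 0"
  by (simp add: zexp_def)

lemma zexp_eq_iff: "zexp a = zexp b \<longleftrightarrow> a = b"
  by (metis lookup_zexp_Suc poly_mapping_eqI)

text \<open>The ratio of the entries of \<open>T\<close> at \<open>\<mu> - wt c\<close> and at
  \<open>\<mu>\<close>. The displacement of all weights by the generic \<xi> contributes the
  monomial in the Z.\<close>

definition tw :: "wt \<Rightarrow> cvec \<Rightarrow> ratfun" where
  "tw \<mu> c = qvar powi Wexp \<mu> c * mon (zexp c)"

lemma tw_nonzero [simp]: "tw \<mu> c \<noteq> 0"
  by (simp add: tw_def)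

lemma tw_0 [simp]: "tw \<mu> 0 = 1"
  by (simp add: tw_def)

lemma tw_add: "tw \<mu> (a + b) = tw (\<mu> - wt b) a * tw \<mu> b"
  by (simp add: tw_def W_add zexp_add mon_add power_int_add)

text \<open>A nontrivial monomial in the Z cannot cancel against the constant 1. The differences
  \<open>1 - tw \<mu> c\<close> are the denominators in \<open>Jk\<close>.\<close>

lemma tw_neq_1:
  assumes "c \<noteq> 0"
  shows "tw \<mu> c \<noteq> 1"
proof
  assume 1: "tw \<mu> c = 1"
  \<comment> \<open>Multiplying \<open>tw \<mu> c - 1\<close> by \<open>1 - qvar\<close> produces
    two terms, each a difference of two powers of q times a monomial, as
    \<open>mon_independent\<close> requires.\<close>
  let ?a = "\<lambda>i. if i then Wexp \<mu> c else 1" and ?b = "\<lambda>i. if i then Wexp \<mu> c + 1 else 0"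
    and ?e = "\<lambda>i. if i then zexp c else 0"
  have "zexp c \<noteq> 0" using assms zexp_eq_iff[of c 0] by simp
  moreover have "(\<Sum>i\<in>{True, False}. (qvar powi ?a i - qvar powi ?b i) * mon (?e i))
      = (1 - qvar) * (tw \<mu> c - 1)"
    by (simp add: tw_def qvar_powi_add algebra_simps)
  ultimately have "?a True = ?b True"
    by (intro mon_independent[of "{True, False}" True ?a ?b ?e]) (use 1 in auto)
  then show False by simp
qed

subsection \<open>The twist automorphism\<close>

text \<open>Conjugation by the \<open>r\<close>-th power of the diagonal matrix \<open>T\<close>; the half integral powers of \<open>q\<close> in \<open>T\<close>
  cancel in \<open>tw\<close>.\<close>

definition twist :: "int \<Rightarrow> kern \<Rightarrow> kern" where
  "twist r K = Kern (\<lambda>\<mu> c. tw \<mu> c powi r * kapp K \<mu> c)"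

lemma kapp_twist: "kapp (twist r K) \<mu> c = tw \<mu> c powi r * kapp K \<mu> c"
  by (simp add: twist_def)

lemma twist_mult: "twist r (K * L) = twist r K * twist r L"
proof (rule kern_eqI)
  fix \<mu> c
  show "kapp (twist r (K * L)) \<mu> c = kapp (twist r K * twist r L) \<mu> c"
    unfolding kapp_twist kapp_times sum_distrib_left
    by (rule sum.cong) (auto simp: tw_add power_int_mult_distrib algebra_simps)
qed

lemma twist_add: "twist r (K + L) = twist r K + twist r L"
  by (rule kern_eqI) (simp add: kapp_twist kapp_simps algebra_simps)

lemma twist_diff: "twist r (K - L) = twist r K - twist r L"
  by (rule kern_eqI) (simp add: kapp_twist kapp_simps algebra_simps)

lemma twist_sum: "twist r (sum K A) = (\<Sum>i\<in>A. twist r (K i))"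
  by (rule kern_eqI) (simp add: kapp_twist kapp_sum sum_distrib_left)

lemma twist_diag [simp]: "twist r (diag f) = diag f"
  by (rule kern_eqI) (simp add: kapp_twist kapp_diag)

lemma twist_twist: "twist r (twist s K) = twist (r + s) K"
  by (rule kern_eqI) (simp add: kapp_twist power_int_add)

section \<open>The diagonal operators of the Toda system\<close>

text \<open>For \<open>i \<le> k\<close> the corresponding weight is
  \<open>eps i - eps k\<close>.\<close>

definition seg :: "nat \<Rightarrow> nat \<Rightarrow> cvec" where
  "seg i k = (\<Sum>j\<in>{i..<k}. single j (Suc 0))"

lemma lookup_seg: "lookup (seg i k) j = (if i \<le> j \<and> j < k then 1 else 0)"
  by (simp add: seg_def lookup_sum lookup_single when_def)

lemma seg_Suc: "i \<le> k \<Longrightarrow> seg i (Suc k) = seg i k + single k (Suc 0)"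
  by (simp add: seg_def)

text \<open>This is q to the power \<open>(\<mu> + \<rho> + \<xi>, eps i)\<close>, up to a factor
  depending neither on \<open>\<mu>\<close> nor on \<open>i\<close>: the coordinate of
  \<open>rho n\<close> at \<open>i\<close> is \<open>n - i\<close>, and
  \<open>eps i = eps 0 - wt (seg 0 i)\<close> turns the contribution of \<xi> into the product of
  the first \<open>i\<close> variables Z.\<close>

definition Dw :: "nat \<Rightarrow> wt \<Rightarrow> ratfun" where
  "Dw i \<mu> = qvar powi (lookup \<mu> i - int i) * mon (zexp (seg 0 i))"

lemma D_diff: "Dw i (\<mu> - x) = Dw i \<mu> * qvar powi (- lookup x i)"
proof -
  have "lookup (\<mu> - x) i - int i = (lookup \<mu> i - int i) + (- lookup x i)"
    by (simp add: lookup_minus)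
  then show ?thesis by (simp only: Dw_def qvar_powi_add) (simp add: mult_ac)
qed

lemma D_Suc: "Dw (Suc i) \<mu> = tw \<mu> (single i (Suc 0)) * Dw i (\<mu> - alpha (Suc i))"
proof -
  have "zexp (seg 0 (Suc i)) = zexp (single i (Suc 0)) + zexp (seg 0 i)"
    by (simp add: seg_Suc zexp_add add.commute)
  moreover have "lookup \<mu> (Suc i) - int (Suc i)
      = Wexp \<mu> (single i (Suc 0)) + (lookup (\<mu> - alpha (Suc i)) i - int i)"
    by (simp add: W_single lookup_minus lookup_alpha_Suc)
  ultimately show ?thesis
    by (simp only: tw_def Dw_def qvar_powi_add mon_add) (simp add: mult_ac)
qed

definition Delta :: "nat \<Rightarrow> wt \<Rightarrow> ratfun" where
  "Delta m \<mu> = (\<Sum>i\<le>m. Dw i \<mu>)"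

text \<open>Both sides live on a single simple root, where the equality is \<open>D_Suc\<close>.
  Conjugation by \<open>T\<close> thus raises the index of the diagonal factor and moves it to the
  other side of \<open>Xk i\<close>.\<close>

lemma twist_X: "twist 1 (diag (Dw i) * Xk i) = Xk i * diag (Dw (Suc i))"
proof (rule kern_eqI)
  fix \<mu> c
  have "wt (single i (Suc 0)) = alpha (Suc i)" using wt_single by simp
  then show "kapp (twist 1 (diag (Dw i) * Xk i)) \<mu> c = kapp (Xk i * diag (Dw (Suc i))) \<mu> c"
    by (simp add: kapp_twist kapp_diag_times kapp_times_diag kapp_X D_Suc)
qed

subsection \<open>The fermionic recursion\<close>

text \<open>The denominator \<open>(q)_\<gamma>\<close> for \<open>\<gamma> = wt c\<close>.\<close>

definition epoch :: "cvec \<Rightarrow> ratfun" where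
  "epoch c = (\<Prod>j\<in>keys c. qpoch (lookup c j))"

lemma epoch_superset:
  assumes "finite A" "keys c \<subseteq> A"
  shows "epoch c = (\<Prod>j\<in>A. qpoch (lookup c j))"
  unfolding epoch_def by (rule prod.mono_neutral_left[OF assms]) (auto simp: in_keys_iff)

lemma epoch_0 [simp]: "epoch 0 = 1"
  by (simp add: epoch_def)

lemma epoch_nonzero [simp]: "epoch c \<noteq> 0"
  by (simp add: epoch_def)

lemma epoch_diff_single:
  assumes "lookup c i > 0"
  shows "epoch c = epoch (c - single i (Suc 0)) * (1 - qvar ^ lookup c i)"
proof -
  let ?c = "c - single i (Suc 0)"
  have sub: "keys ?c \<subseteq> keys c" by (auto simp: in_keys_iff lookup_minus)
  have i: "i \<in> keys c" using assms by (simp add: in_keys_iff)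
  have "epoch c = qpoch (lookup c i) * (\<Prod>j\<in>keys c - {i}. qpoch (lookup c j))"
    unfolding epoch_def using i by (simp add: prod.remove)
  also have "(\<Prod>j\<in>keys c - {i}. qpoch (lookup c j)) = (\<Prod>j\<in>keys c - {i}. qpoch (lookup ?c j))"
    by (rule prod.cong) (auto simp: lookup_minus lookup_single)
  also have "qpoch (lookup c i) = qpoch (lookup ?c i) * (1 - qvar ^ lookup c i)"
    using assms qpoch_Suc[of "lookup c i - 1"] by (simp add: lookup_minus)
  also have "\<dots> * (\<Prod>j\<in>keys c - {i}. qpoch (lookup ?c j))
      = (\<Prod>j\<in>keys c. qpoch (lookup ?c j)) * (1 - qvar ^ lookup c i)"
    using i by (simp add: prod.remove mult_ac)
  finally show ?thesis by (simp add: epoch_superset[OF _ sub])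
qed

definition Ek :: "nat \<Rightarrow> kern" where
  "Ek m = Kern (\<lambda>\<mu> c. if keys c \<subseteq> {..<m} then inverse (epoch c) else 0)"

lemma kapp_E: "kapp (Ek m) \<mu> c = (if keys c \<subseteq> {..<m} then inverse (epoch c) else 0)"
  by (simp add: Ek_def)

lemma kapp_E_diff_single:
  assumes "lookup c i > 0" "i < m"
  shows "kapp (Ek m) \<mu> (c - single i (Suc 0)) = kapp (Ek m) \<mu>' c * (1 - qvar ^ lookup c i)"
proof -
  have c: "single i (Suc 0) + (c - single i (Suc 0)) = c"
    using assms by (subst single_add_eq_iff) simp
  have "keys c = insert i (keys (c - single i (Suc 0)))"
    using keys_cvec_add[of "single i (Suc 0)" "c - single i (Suc 0)"] unfolding c by simp
  moreover have "1 - qvar ^ lookup c i \<noteq> 0" using qvar_power_neq_1[OF assms(1)] by auto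
  ultimately show ?thesis using assms epoch_diff_single[OF assms(1)] by (auto simp: kapp_E)
qed

lemma E_X: "Ek m * Xk j = Xk j * Ek m"
  by (rule kern_eqI) (simp add: kapp_X_times kapp_times_X kapp_E)

text \<open>A q-difference equation: removing one simple root from \<open>c\<close> multiplies the
  entry by \<open>1 - qvar ^ lookup c i\<close>, so the difference of the two entries carries the
  factor \<open>qvar ^ lookup c i\<close>.\<close>

lemma kapp_one_minus_X_E:
  assumes "i < m"
  shows "kapp ((1 - Xk i) * Ek m) \<mu> c = kapp (Ek m) \<mu> c * qvar ^ lookup c i"
  using kapp_E_diff_single[of c i m \<mu> \<mu>] assms
  by (cases "lookup c i > 0") (simp_all add: left_diff_distrib kapp_simps kapp_X_times algebra_simps)

subsection \<open>Triangular systems\<close>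

lemma ht_snd_less: "p \<in> splits c - {(0, c)} \<Longrightarrow> ht (snd p) < ht c"
proof (cases p)
  case (Pair a b)
  assume "p \<in> splits c - {(0, c)}"
  then have "a + b = c" "a \<noteq> 0" using Pair by auto
  then show ?thesis using Pair ht_add[of a b] by (cases "ht a") auto
qed

text \<open>Triangular linear systems, solved by recursion on the height: \<open>p \<mu> c\<close>
  times the unknown at \<open>c\<close> equals an inhomogeneous term plus contributions of the
  unknowns at smaller vectors. Both \<open>Jk\<close> and left division arise in this way.\<close>

function solve :: "(wt \<Rightarrow> cvec \<Rightarrow> ratfun) \<Rightarrow> (wt \<Rightarrow> cvec \<Rightarrow> cvec \<Rightarrow> ratfun) \<Rightarrow> (wt \<Rightarrow> cvec \<Rightarrow> ratfun)
    \<Rightarrow> wt \<Rightarrow> cvec \<Rightarrow> ratfun" where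
  "solve p A L \<mu> c =
    (L \<mu> c + (\<Sum>x\<in>splits c - {(0, c)}. A \<mu> (fst x) (snd x) * solve p A L \<mu> (snd x))) / p \<mu> c"
  by pat_completeness auto
termination by (relation "measure (\<lambda>(_, _, _, _, c). ht c)") (rule wf_measure, simp only: in_measure split_conv ht_snd_less)

declare solve.simps [simp del]

lemma sum_splits_remove:
  "(\<Sum>(a, b)\<in>splits c. f a b) = f 0 c + (\<Sum>x\<in>splits c - {(0, c)}. f (fst x) (snd x))"
  for f :: "cvec \<Rightarrow> cvec \<Rightarrow> 'a :: comm_monoid_add"
  using sum.remove[of "splits c" "(0, c)" "\<lambda>x. f (fst x) (snd x)"] by (simp add: case_prod_beta)

text \<open>\<open>J\<^sub>m\<close>, as the solution of \<open>E\<^sub>m T J\<^sub>m T\<^sup>-\<^sup>1 = J\<^sub>m\<close>; this makes its entries rational functions.\<close>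

definition Jk :: "nat \<Rightarrow> kern" where
  "Jk m = Kern (solve (\<lambda>\<mu> c. if c = 0 then 1 else 1 - tw \<mu> c) (\<lambda>\<mu> a b. kapp (Ek m) \<mu> a * tw \<mu> b)
     (\<lambda>\<mu> c. if c = 0 then 1 else 0))"

lemma kapp_Jk_0 [simp]: "kapp (Jk m) \<mu> 0 = 1"
  unfolding Jk_def kapp_Kern by (subst solve.simps) simp

lemma kapp_Jk:
  assumes "c \<noteq> 0"
  shows "kapp (Jk m) \<mu> c = (\<Sum>x\<in>splits c - {(0, c)}.
    kapp (Ek m) \<mu> (fst x) * tw \<mu> (snd x) * kapp (Jk m) \<mu> (snd x)) / (1 - tw \<mu> c)"
  using assms unfolding Jk_def kapp_Kern by (subst solve.simps) simp

text \<open>The term with trivial left part is \<open>tw \<mu> c\<close> times the unknown entry;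
  moved to the other side it yields the denominator of the recursion for \<open>Jk\<close>.\<close>

lemma E_twist_Jk: "Ek m * twist 1 (Jk m) = Jk m"
proof (rule kern_eqI)
  fix \<mu> c
  show "kapp (Ek m * twist 1 (Jk m)) \<mu> c = kapp (Jk m) \<mu> c"
  proof (cases "c = 0")
    case True
    then show ?thesis by (simp add: kapp_times kapp_twist kapp_E)
  next
    case False
    have "1 - tw \<mu> c \<noteq> 0" using tw_neq_1[OF False] by auto
    then have "kapp (Jk m) \<mu> c * (1 - tw \<mu> c) = (\<Sum>x\<in>splits c - {(0, c)}.
        kapp (Ek m) \<mu> (fst x) * tw \<mu> (snd x) * kapp (Jk m) \<mu> (snd x))"
      unfolding kapp_Jk[OF False] by simp
    \<comment> \<open>Entries of \<open>Ek m\<close> are the same at all weights, so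
      \<open>\<mu>\<close> may be replaced by the weight that the product of kernels
      demands.\<close>
    also have "\<dots> = (\<Sum>x\<in>splits c - {(0, c)}.
        kapp (Ek m) (\<mu> - wt (snd x)) (fst x) * kapp (twist 1 (Jk m)) \<mu> (snd x))"
      by (simp add: kapp_E kapp_twist mult.assoc)
    finally show ?thesis
      unfolding kapp_times sum_splits_remove by (simp add: kapp_twist kapp_E algebra_simps)
  qed
qed

text \<open>By induction on the height all but one term of the product vanish. What remains is the
  entry times \<open>1 - tw \<mu> c\<close>, which is a nonzero factor.\<close>

lemma fixpoint_eq_0:
  assumes G: "G = Ek m * twist 1 G" and 0: "\<And>\<mu>. kapp G \<mu> 0 = 0"
  shows "G = 0"
proof (rule kern_eqI)
  fix \<mu> c
  show "kapp G \<mu> c = kapp 0 \<mu> c"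
  proof (induction "ht c" arbitrary: c rule: less_induct)
    case less
    show ?case
    proof (cases "c = 0")
      case False
      have "kapp G \<mu> c = kapp (Ek m * twist 1 G) \<mu> c" using G by simp
      also have "\<dots> = tw \<mu> c * kapp G \<mu> c"
        unfolding kapp_times sum_splits_remove using less ht_snd_less
        by (simp add: kapp_twist kapp_E kapp_simps)
      finally have "(1 - tw \<mu> c) * kapp G \<mu> c = 0" by (simp add: algebra_simps)
      then show ?thesis using tw_neq_1[OF False] by (simp add: kapp_simps)
    qed (simp add: 0 kapp_simps)
  qed
qed

text \<open>For unipotent \<open>K\<close> this is the inverse of \<open>K\<close> times
  \<open>L\<close>.\<close>

definition ldiv :: "kern \<Rightarrow> kern \<Rightarrow> kern" where
  "ldiv K L = Kern (solve (\<lambda>_ _. 1) (\<lambda>\<mu> a b. - kapp K (\<mu> - wt b) a) (kapp L))"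

lemma kapp_ldiv: "kapp (ldiv K L) \<mu> c =
    kapp L \<mu> c - (\<Sum>x\<in>splits c - {(0, c)}. kapp K (\<mu> - wt (snd x)) (fst x) * kapp (ldiv K L) \<mu> (snd x))"
  unfolding ldiv_def kapp_Kern by (subst solve.simps) (simp add: sum_negf)

definition unipotent :: "kern \<Rightarrow> bool" where
  "unipotent K \<longleftrightarrow> (\<forall>\<mu>. kapp K \<mu> 0 = 1)"

lemma unipotent_Jk [simp]: "unipotent (Jk m)"
  by (simp add: unipotent_def)

lemma times_ldiv:
  assumes "unipotent K"
  shows "K * ldiv K L = L"
proof (rule kern_eqI)
  fix \<mu> c show "kapp (K * ldiv K L) \<mu> c = kapp L \<mu> c"
    using assms kapp_ldiv[of K L \<mu> c] unfolding kapp_times sum_splits_remove unipotent_def by simp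
qed

lemma kapp_ldiv_0: "kapp (ldiv K L) \<mu> 0 = kapp L \<mu> 0"
  by (subst kapp_ldiv) simp

lemma unipotent_ldiv [simp]: "unipotent L \<Longrightarrow> unipotent (ldiv K L)"
  by (simp add: unipotent_def kapp_ldiv_0)

lemma left_cancel_0:
  assumes "unipotent K" and 0: "K * G = 0"
  shows "G = 0"
proof (rule kern_eqI)
  fix \<mu> c
  show "kapp G \<mu> c = kapp 0 \<mu> c"
  proof (induction "ht c" arbitrary: c rule: less_induct)
    case less
    have "kapp 0 \<mu> c = kapp (K * G) \<mu> c" using 0 by simp
    also have "\<dots> = kapp G \<mu> c"
      unfolding kapp_times sum_splits_remove using less ht_snd_less assms(1)
      by (simp add: kapp_simps unipotent_def)
    finally show ?case by simp
  qed
qed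

lemma left_cancel: "unipotent K \<Longrightarrow> K * G = K * G' \<Longrightarrow> G = G'"
  using left_cancel_0[of K "G - G'"] by (simp add: algebra_simps)

subsection \<open>Kernels of rank \<open>m\<close>\<close>

definition supported :: "nat \<Rightarrow> kern \<Rightarrow> bool" where
  "supported m K \<longleftrightarrow> (\<forall>\<mu> c. kapp K \<mu> c \<noteq> 0 \<longrightarrow> keys c \<subseteq> {..<m})"

definition agree :: "nat \<Rightarrow> wt \<Rightarrow> wt \<Rightarrow> bool" where
  "agree m \<mu> \<nu> \<longleftrightarrow> (\<forall>k\<le>m. lookup \<mu> k = lookup \<nu> k)"

text \<open>In the theorem the weight is projected to \<open>P i\<close> before the factor of rank
  \<open>i\<close> is evaluated; a kernel with this property does not see the projection.\<close>

definition local :: "nat \<Rightarrow> kern \<Rightarrow> bool" where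
  "local m K \<longleftrightarrow> supported m K \<and> (\<forall>\<mu> \<nu> c. agree m \<mu> \<nu> \<longrightarrow> kapp K \<mu> c = kapp K \<nu> c)"

lemma localD: "local m K \<Longrightarrow> agree m \<mu> \<nu> \<Longrightarrow> kapp K \<mu> c = kapp K \<nu> c"
  by (auto simp: local_def)

lemma supportedD: "supported m K \<Longrightarrow> \<not> keys c \<subseteq> {..<m} \<Longrightarrow> kapp K \<mu> c = 0"
  by (auto simp: supported_def)

lemma agree_diff: "agree m \<mu> \<nu> \<Longrightarrow> agree m (\<mu> - x) (\<nu> - x)"
  by (simp add: agree_def lookup_minus)

lemma local_1 [simp]: "local m 1"
  by (simp add: local_def supported_def kapp_simps)

text \<open>The weight \<open>wt c\<close> involves no root beyond \<open>alpha m\<close>, hence no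
  coordinate beyond \<open>m\<close>, and pairing with it ignores the later coordinates of the other
  weight.\<close>

lemma tw_agree:
  assumes "agree m \<mu> \<nu>" "keys c \<subseteq> {..<m}"
  shows "tw \<mu> c = tw \<nu> c"
proof -
  have "lookup \<mu> k = lookup \<nu> k" if "k \<in> keys (wt c)" for k
  proof (cases "k \<le> m")
    case False
    then obtain k' where "k = Suc k'" "m \<le> k'" by (cases k) auto
    then have "lookup c k = 0" "lookup c k' = 0" using assms(2) by (auto simp: in_keys_iff subset_iff)
    then have "lookup (wt c) k = 0" using \<open>k = Suc k'\<close> by (simp add: lookup_wt_Suc)
    then show ?thesis using that by (simp add: in_keys_iff)
  qed (use assms(1) in \<open>simp add: agree_def\<close>)
  then have "ip (wt c) \<mu> = ip (wt c) \<nu>" unfolding ip_def by simp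
  then show ?thesis by (simp add: tw_def Wexp_def ip_commute[of \<mu>] ip_commute[of \<nu>])
qed

lemma local_twist:
  assumes "local m K"
  shows "local m (twist r K)"
proof -
  have "kapp (twist r K) \<mu> c = kapp (twist r K) \<nu> c" if "agree m \<mu> \<nu>" for \<mu> \<nu> c
  proof (cases "keys c \<subseteq> {..<m}")
    case True
    then show ?thesis using localD[OF assms that, of c] tw_agree[OF that True] by (simp add: kapp_twist)
  next
    case False
    then show ?thesis using assms supportedD[OF _ False] by (simp add: kapp_twist local_def)
  qed
  then show ?thesis using assms by (auto simp: local_def supported_def kapp_twist)
qed

text \<open>For kernels defined by recursion on the height: independence of higher coordinates and
  support go through a single induction.\<close>

lemma localI_recursive:
  assumes "\<And>c. (\<And>b. ht b < ht c \<Longrightarrow> (\<forall>\<mu> \<nu>. agree m \<mu> \<nu> \<longrightarrow> kapp K \<mu> b = kapp K \<nu> b) \<and>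
        (\<forall>\<mu>. kapp K \<mu> b \<noteq> 0 \<longrightarrow> keys b \<subseteq> {..<m})) \<Longrightarrow>
      (\<forall>\<mu> \<nu>. agree m \<mu> \<nu> \<longrightarrow> kapp K \<mu> c = kapp K \<nu> c) \<and>
        (\<forall>\<mu>. kapp K \<mu> c \<noteq> 0 \<longrightarrow> keys c \<subseteq> {..<m})"
  shows "local m K"
proof -
  have "(\<forall>\<mu> \<nu>. agree m \<mu> \<nu> \<longrightarrow> kapp K \<mu> c = kapp K \<nu> c) \<and>
        (\<forall>\<mu>. kapp K \<mu> c \<noteq> 0 \<longrightarrow> keys c \<subseteq> {..<m})" for c
    by (induction "ht c" arbitrary: c rule: less_induct) (rule assms, blast)
  then show ?thesis by (auto simp: local_def supported_def)
qed

lemma sum_splits_nonzeroE: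
  fixes f :: "cvec \<Rightarrow> cvec \<Rightarrow> ratfun"
  assumes "(\<Sum>x\<in>splits c - {(0, c)}. f (fst x) (snd x)) \<noteq> 0"
  obtains a b where "a + b = c" "ht b < ht c" "f a b \<noteq> 0"
proof -
  obtain x where x: "x \<in> splits c - {(0, c)}" "f (fst x) (snd x) \<noteq> 0"
    using assms by (meson sum.not_neutral_contains_not_neutral)
  then show thesis using that[of "fst x" "snd x"] ht_snd_less[OF x(1)] by (cases x) auto
qed

lemma local_Jk: "local m (Jk m)"
proof (rule localI_recursive)
  fix c
  assume IH: "\<And>b. ht b < ht c \<Longrightarrow> (\<forall>\<mu> \<nu>. agree m \<mu> \<nu> \<longrightarrow> kapp (Jk m) \<mu> b = kapp (Jk m) \<nu> b) \<and>
        (\<forall>\<mu>. kapp (Jk m) \<mu> b \<noteq> 0 \<longrightarrow> keys b \<subseteq> {..<m})"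
  have supp: "keys c \<subseteq> {..<m}" if "kapp (Jk m) \<mu> c \<noteq> 0" for \<mu>
  proof (cases "c = 0")
    case False
    let ?f = "\<lambda>a b. kapp (Ek m) \<mu> a * tw \<mu> b * kapp (Jk m) \<mu> b"
    have "(\<Sum>x\<in>splits c - {(0, c)}. ?f (fst x) (snd x)) \<noteq> 0"
      using that unfolding kapp_Jk[OF False] by auto
    then obtain a b where ab: "a + b = c" "ht b < ht c" "?f a b \<noteq> 0"
      by (rule sum_splits_nonzeroE)
    then have "keys a \<subseteq> {..<m}" by (auto simp: kapp_E split: if_splits)
    moreover have "keys b \<subseteq> {..<m}" using IH[OF ab(2)] ab(3) by auto
    ultimately show ?thesis using ab(1) keys_cvec_add[of a b] by simp
  qed simp
  moreover have "kapp (Jk m) \<mu> c = kapp (Jk m) \<nu> c" if *: "agree m \<mu> \<nu>" for \<mu> \<nu>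
  proof (cases "c \<noteq> 0 \<and> keys c \<subseteq> {..<m}")
    case True
    then have c: "c \<noteq> 0" by simp
    have "kapp (Ek m) \<mu> (fst x) * tw \<mu> (snd x) * kapp (Jk m) \<mu> (snd x)
        = kapp (Ek m) \<nu> (fst x) * tw \<nu> (snd x) * kapp (Jk m) \<nu> (snd x)"
      if x: "x \<in> splits c - {(0, c)}" for x
    proof -
      have "fst x + snd x = c" using x by (cases x) auto
      then have "keys (snd x) \<subseteq> {..<m}" using True keys_cvec_add by blast
      then show ?thesis using IH[OF ht_snd_less[OF x]] * tw_agree[OF *] by (simp add: kapp_E)
    qed
    then show ?thesis unfolding kapp_Jk[OF c] using True tw_agree[OF *, of c] by simp
  next
    case False
    then have "c = 0 \<or> kapp (Jk m) \<mu> c = 0 \<and> kapp (Jk m) \<nu> c = 0" using supp by blast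
    then show ?thesis by auto
  qed
  ultimately show "(\<forall>\<mu> \<nu>. agree m \<mu> \<nu> \<longrightarrow> kapp (Jk m) \<mu> c = kapp (Jk m) \<nu> c) \<and>
        (\<forall>\<mu>. kapp (Jk m) \<mu> c \<noteq> 0 \<longrightarrow> keys c \<subseteq> {..<m})" by blast
qed

lemma local_ldiv:
  assumes K: "local m K" and L: "local m L"
  shows "local m (ldiv K L)"
proof (rule localI_recursive)
  fix c
  assume IH: "\<And>b. ht b < ht c \<Longrightarrow> (\<forall>\<mu> \<nu>. agree m \<mu> \<nu> \<longrightarrow> kapp (ldiv K L) \<mu> b = kapp (ldiv K L) \<nu> b) \<and>
        (\<forall>\<mu>. kapp (ldiv K L) \<mu> b \<noteq> 0 \<longrightarrow> keys b \<subseteq> {..<m})"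
  have "keys c \<subseteq> {..<m}" if "kapp (ldiv K L) \<mu> c \<noteq> 0" for \<mu>
  proof (cases "kapp L \<mu> c = 0")
    case True
    let ?f = "\<lambda>a b. kapp K (\<mu> - wt b) a * kapp (ldiv K L) \<mu> b"
    have "(\<Sum>x\<in>splits c - {(0, c)}. ?f (fst x) (snd x)) \<noteq> 0"
      using that True kapp_ldiv[of K L \<mu> c] by auto
    then obtain a b where ab: "a + b = c" "ht b < ht c" "?f a b \<noteq> 0"
      by (rule sum_splits_nonzeroE)
    then have "keys a \<subseteq> {..<m}" using K by (auto simp: local_def supported_def)
    moreover have "keys b \<subseteq> {..<m}" using IH[OF ab(2)] ab(3) by auto
    ultimately show ?thesis using ab(1) keys_cvec_add[of a b] by simp
  qed (use L in \<open>auto simp: local_def supported_def\<close>)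
  moreover have "kapp (ldiv K L) \<mu> c = kapp (ldiv K L) \<nu> c" if *: "agree m \<mu> \<nu>" for \<mu> \<nu>
  proof -
    have "(\<Sum>x\<in>splits c - {(0, c)}. kapp K (\<mu> - wt (snd x)) (fst x) * kapp (ldiv K L) \<mu> (snd x))
        = (\<Sum>x\<in>splits c - {(0, c)}. kapp K (\<nu> - wt (snd x)) (fst x) * kapp (ldiv K L) \<nu> (snd x))"
      using IH[OF ht_snd_less] * localD[OF K agree_diff[OF *]] by (intro sum.cong refl) metis
    then show ?thesis using kapp_ldiv[of K L _ c] localD[OF L *, of c] by simp
  qed
  ultimately show "(\<forall>\<mu> \<nu>. agree m \<mu> \<nu> \<longrightarrow> kapp (ldiv K L) \<mu> c = kapp (ldiv K L) \<nu> c) \<and>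
        (\<forall>\<mu>. kapp (ldiv K L) \<mu> c \<noteq> 0 \<longrightarrow> keys c \<subseteq> {..<m})" by blast
qed

lemma local_mono:
  assumes "local m K" "m \<le> m'"
  shows "local m' K"
  using assms by (fastforce simp: local_def supported_def agree_def)

subsection \<open>The difference Toda Hamiltonian\<close>

definition Hk :: "nat \<Rightarrow> kern" where
  "Hk m = diag (Dw m) + (\<Sum>i<m. diag (Dw i) * (1 - Xk i))"

lemma H_Suc: "Hk (Suc m) = Hk m + diag (Dw (Suc m)) - diag (Dw m) * Xk m"
  by (simp add: Hk_def algebra_simps)

lemma diag_Delta: "diag (Delta m) = (\<Sum>i\<le>m. diag (Dw i))"
  by (rule kern_eqI) (simp add: kapp_sum kapp_diag Delta_def)

lemma diag_Delta_Suc: "diag (Delta (Suc m)) = diag (Delta m) + diag (Dw (Suc m))"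
  by (simp add: diag_Delta)

lemma twist_H: "twist 1 (Hk m) = diag (Dw m) + (\<Sum>i<m. diag (Dw i) - Xk i * diag (Dw (Suc i)))"
  by (simp add: Hk_def twist_add twist_sum algebra_simps twist_diff twist_X)

text \<open>At the entry \<open>c\<close>, moving \<open>Dw i\<close> past the translation gives q
  to the power \<open>- lookup (wt c) i\<close>, and \<open>1 - Xk i\<close> gives q to the power
  \<open>lookup c i\<close>. Together this is q to the coefficient of \<open>c\<close> with index
  \<open>i - 1\<close>, or 1 if \<open>i = 0\<close>. On the right the same power accompanies
  \<open>Dw i\<close>.\<close>

lemma H_E: "Hk m * Ek m = Ek m * twist 1 (Hk m)"
proof (rule kern_eqI)
  fix \<mu> c
  define e where "e = kapp (Ek m) \<mu> c"
  have left: "kapp (diag (Dw i) * (1 - Xk i) * Ek m) \<mu> c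
      = Dw i \<mu> * qvar powi (int (lookup c i) - lookup (wt c) i) * e" if "i < m" for i
  proof -
    have "qvar powi (int (lookup c i) - lookup (wt c) i) 
        = qvar powi (- lookup (wt c) i) * qvar ^ lookup c i"
      using qvar_powi_add[of "- lookup (wt c) i" "int (lookup c i)"] by simp
    moreover have "kapp (diag (Dw i) * (1 - Xk i) * Ek m) \<mu> c = Dw i (\<mu> - wt c) * (e * qvar ^ lookup c i)"
      unfolding mult.assoc kapp_diag_times kapp_one_minus_X_E[OF that] e_def ..
    ultimately show ?thesis unfolding D_diff by (simp only: mult_ac)
  qed
  have right: "kapp (Ek m * (Xk i * diag (Dw (Suc i)))) \<mu> c = (1 - qvar ^ lookup c i) * Dw (Suc i) \<mu> * e"
    if "i < m" for i
  proof -
    have "Ek m * Xk i = Ek m - (1 - Xk i) * Ek m"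
      by (simp add: E_X left_diff_distrib)
    note E_X' = this
    show ?thesis
      unfolding mult.assoc[symmetric] kapp_times_diag E_X' kapp_simps kapp_one_minus_X_E[OF that] e_def
      by (simp add: algebra_simps)
  qed
  \<comment> \<open>The top term has no factor \<open>1 - Xk m\<close>, yet obeys the same formula
    because \<open>lookup c m = 0\<close> wherever \<open>Ek m\<close> has a nonzero entry.\<close>
  have top: "kapp (diag (Dw m) * Ek m) \<mu> c = Dw m \<mu> * qvar powi (int (lookup c m) - lookup (wt c) m) * e"
  proof (cases "keys c \<subseteq> {..<m}")
    case True
    then have "lookup c m = 0" by (auto simp: in_keys_iff)
    then show ?thesis by (simp add: kapp_diag_times D_diff e_def)
  qed (simp add: kapp_diag_times e_def kapp_E)
  have "kapp (Hk m * Ek m) \<mu> c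
      = (\<Sum>i<Suc m. Dw i \<mu> * qvar powi (int (lookup c i) - lookup (wt c) i) * e)"
    by (simp add: Hk_def distrib_right sum_distrib_right kapp_simps kapp_sum left top add.commute)
  \<comment> \<open>Coordinates of \<open>wt c\<close> are differences of neighbouring coefficients,
    so each exponent collapses to the coefficient with the preceding index.\<close>
  also have "\<dots> = Dw 0 \<mu> * e + (\<Sum>i<m. Dw (Suc i) \<mu> * qvar ^ lookup c i * e)"
    by (subst sum.lessThan_Suc_shift) (simp add: lookup_wt_0 lookup_wt_Suc)
  also have "\<dots> = (\<Sum>i<Suc m. Dw i \<mu> * e) - (\<Sum>i<m. (1 - qvar ^ lookup c i) * Dw (Suc i) \<mu> * e)"
    by (subst sum.lessThan_Suc_shift) (simp add: algebra_simps sum_subtractf)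
  also have "\<dots> = kapp (Ek m * twist 1 (Hk m)) \<mu> c"
    by (simp add: twist_H distrib_left right_diff_distrib sum_distrib_left kapp_simps kapp_sum
        kapp_times_diag right sum_subtractf e_def[symmetric] mult.commute[of e])
  finally show "kapp (Hk m * Ek m) \<mu> c = kapp (Ek m * twist 1 (Hk m)) \<mu> c" .
qed

lemma kapp_H_0: "kapp (Hk m) \<mu> 0 = Delta m \<mu>"
  by (simp add: Hk_def kapp_simps kapp_sum kapp_diag kapp_diag_times kapp_X Delta_def
      lessThan_Suc_atMost[symmetric] add.commute lookup_single)
     (auto simp: poly_mapping_eq_iff fun_eq_iff lookup_single when_def intro!: sum.cong)

text \<open>The defect \<open>G\<close> of this eigenvalue equation inherits the fixed point
  equation of \<open>Jk m\<close>: \<open>H_E\<close> moves the Hamiltonian through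
  \<open>Ek m\<close>, and the twist fixes diagonal kernels. Its diagonal vanishes, hence so does
  \<open>G\<close>.\<close>

lemma H_Jk: "Hk m * Jk m = Jk m * diag (Delta m)"
proof -
  define G where "G = Hk m * Jk m - Jk m * diag (Delta m)"
  have "Ek m * twist 1 G = (Ek m * twist 1 (Hk m)) * twist 1 (Jk m) - (Ek m * twist 1 (Jk m)) * diag (Delta m)"
    by (simp add: G_def twist_diff twist_mult right_diff_distrib mult.assoc)
  also have "\<dots> = Hk m * (Ek m * twist 1 (Jk m)) - Jk m * diag (Delta m)"
    by (simp only: H_E[symmetric] E_twist_Jk mult.assoc)
  also have "\<dots> = G" by (simp only: E_twist_Jk G_def)
  finally have "G = 0"
    by (intro fixpoint_eq_0[of G m]) (simp_all add: G_def kapp_simps kapp_times kapp_H_0 kapp_diag)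
  then show ?thesis by (simp add: G_def)
qed

lemma diag_X_commute:
  assumes "i \<noteq> j" "i \<noteq> Suc j"
  shows "diag (Dw i) * Xk j = Xk j * diag (Dw i)"
proof (rule kern_eqI)
  fix \<mu> c
  have "lookup (wt (single j (Suc 0))) i = 0"
    using assms wt_single[of j] by (simp add: lookup_alpha_Suc)
  then show "kapp (diag (Dw i) * Xk j) \<mu> c = kapp (Xk j * diag (Dw i)) \<mu> c"
    by (simp add: kapp_diag_times kapp_times_diag kapp_X D_diff)
qed

lemma X_diag: "Xk j * diag (Dw j) = diag (\<lambda>_. qvar) * (diag (Dw j) * Xk j)"
proof (rule kern_eqI)
  fix \<mu> c
  have "lookup (wt (single j (Suc 0))) j = 1"
    using wt_single[of j] by (simp add: lookup_alpha_Suc)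
  then show "kapp (Xk j * diag (Dw j)) \<mu> c = kapp (diag (\<lambda>_. qvar) * (diag (Dw j) * Xk j)) \<mu> c"
    by (simp add: kapp_diag_times kapp_times_diag kapp_X D_diff)
qed

lemma diag_const_commute: "diag (\<lambda>_. a) * K = K * diag (\<lambda>_. a)"
  by (rule kern_eqI) (simp add: kapp_diag_times kapp_times_diag)

lemma X_commute: "Xk i * Xk j = Xk j * Xk i"
proof -
  have "kapp (Xk i * Xk j) \<mu> c = (if c = single i (Suc 0) + single j (Suc 0) then 1 else 0)" for i j \<mu> c
    using single_add_eq_iff[of i "single j (Suc 0)" c] by (auto simp: kapp_X_times kapp_X)
  then show ?thesis by (intro kern_eqI) (simp add: add.commute)
qed

text \<open>All terms of index below \<open>m\<close> commute with \<open>Xk m\<close>, so only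
  \<open>diag (Dw m)\<close> contributes.\<close>

lemma H_X: "Hk m * Xk m - Xk m * Hk m = diag (\<lambda>_. 1 - qvar) * (diag (Dw m) * Xk m)"
proof -
  have "diag (Dw i) * (1 - Xk i) * Xk m = Xk m * (diag (Dw i) * (1 - Xk i))" if "i < m" for i
  proof -
    have "diag (Dw i) * (1 - Xk i) * Xk m = diag (Dw i) * Xk m - diag (Dw i) * (Xk i * Xk m)"
      by (simp add: algebra_simps)
    also have "\<dots> = diag (Dw i) * Xk m - diag (Dw i) * Xk m * Xk i"
      by (simp only: X_commute[of i m] mult.assoc)
    also have "\<dots> = Xk m * (diag (Dw i) * (1 - Xk i))"
      using that by (simp add: diag_X_commute algebra_simps)
    finally show ?thesis .
  qed
  then have "Hk m * Xk m - Xk m * Hk m = diag (Dw m) * Xk m - Xk m * diag (Dw m)"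
    by (simp add: Hk_def distrib_left distrib_right sum_distrib_left sum_distrib_right)
  also have "\<dots> = (1 - diag (\<lambda>_. qvar)) * (diag (Dw m) * Xk m)"
    by (simp add: X_diag left_diff_distrib)
  also have "1 - diag (\<lambda>_. qvar) = diag (\<lambda>_. 1 - qvar)"
    by (rule kern_eqI) (simp add: kapp_simps kapp_diag)
  finally show ?thesis .
qed

text \<open>Subtracting roots up to \<open>alpha m\<close> does not change the coordinate with index
  \<open>Suc m\<close>.\<close>

lemma diag_D_commute:
  assumes "supported m K"
  shows "diag (Dw (Suc m)) * K = K * diag (Dw (Suc m))"
proof (rule kern_eqI)
  fix \<mu> c
  show "kapp (diag (Dw (Suc m)) * K) \<mu> c = kapp (K * diag (Dw (Suc m))) \<mu> c"
  proof (cases "keys c \<subseteq> {..<m}")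
    case True
    then have "lookup c m = 0" "lookup c (Suc m) = 0" by (auto simp: in_keys_iff subset_iff)
    then show ?thesis by (simp add: kapp_diag_times kapp_times_diag D_diff lookup_wt_Suc)
  qed (use assms in \<open>simp add: kapp_diag_times kapp_times_diag supportedD\<close>)
qed

lemma supported_Jk: "supported m (Jk m)"
  using local_Jk by (simp add: local_def)

section \<open>Operators conjugated by \<open>Jk m\<close>\<close>

definition Nk :: "nat \<Rightarrow> kern" where
  "Nk m = ldiv (Jk m) (diag (Dw m) * Xk m * Jk m)"

definition Yk :: "nat \<Rightarrow> kern" where
  "Yk m = ldiv (Jk m) (Xk m * Jk m)"

lemma Jk_N: "Jk m * Nk m = diag (Dw m) * Xk m * Jk m"
  by (simp add: Nk_def times_ldiv)

lemma Jk_Y: "Jk m * Yk m = Xk m * Jk m"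
  by (simp add: Yk_def times_ldiv)

text \<open>This is \<open>H_X\<close> conjugated by \<open>Jk m\<close>: the Hamiltonian becomes
  \<open>diag (Delta m)\<close>, the translation becomes \<open>Yk m\<close> and the right side a
  multiple of \<open>Nk m\<close>.\<close>

lemma Delta_Y: "diag (Delta m) * Yk m - Yk m * diag (Delta m) = diag (\<lambda>_. 1 - qvar) * Nk m"
proof (rule left_cancel[of "Jk m"])
  have "Jk m * (diag (Delta m) * Yk m - Yk m * diag (Delta m))
      = Hk m * (Jk m * Yk m) - (Jk m * Yk m) * diag (Delta m)"
    by (simp only: right_diff_distrib mult.assoc[symmetric] H_Jk)
  also have "\<dots> = (Hk m * Xk m - Xk m * Hk m) * Jk m"
    by (simp only: Jk_Y mult.assoc H_Jk left_diff_distrib)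
  also have "\<dots> = diag (\<lambda>_. 1 - qvar) * (Jk m * Nk m)"
    by (simp only: H_X Jk_N mult.assoc)
  also have "\<dots> = Jk m * (diag (\<lambda>_. 1 - qvar) * Nk m)"
    by (simp only: diag_const_commute[of _ "Jk m"] mult.assoc[symmetric])
  finally show "Jk m * (diag (Delta m) * Yk m - Yk m * diag (Delta m))
      = Jk m * (diag (\<lambda>_. 1 - qvar) * Nk m)" .
qed simp

text \<open>Write the left factor \<open>Jk m\<close> as \<open>Ek m * twist 1 (Jk m)\<close>. The
  twist turns \<open>diag (Dw m) * Xk m\<close> into \<open>Xk m * diag (Dw (Suc m))\<close>; then
  \<open>Xk m\<close> passes to the left of \<open>Ek m\<close> and the diagonal factor to the right
  of \<open>twist 1 (Jk m)\<close>.\<close>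

lemma twist_N: "twist 1 (Nk m) = Yk m * diag (Dw (Suc m))"
proof (rule left_cancel[of "Jk m"])
  have "Jk m * twist 1 (Nk m) = Ek m * twist 1 (Jk m * Nk m)"
    by (subst (1) E_twist_Jk[symmetric]) (simp only: twist_mult mult.assoc)
  also have "\<dots> = Ek m * Xk m * (diag (Dw (Suc m)) * twist 1 (Jk m))"
    unfolding Jk_N twist_mult[of 1 "diag (Dw m) * Xk m"] twist_X by (simp only: mult.assoc)
  also have "\<dots> = Xk m * (Ek m * twist 1 (Jk m)) * diag (Dw (Suc m))"
    using diag_D_commute[of m "twist 1 (Jk m)"] local_twist[OF local_Jk[of m], of 1]
    by (simp only: local_def E_X mult.assoc)
  also have "\<dots> = Jk m * (Yk m * diag (Dw (Suc m)))"
    by (simp only: E_twist_Jk Jk_Y[symmetric] mult.assoc)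
  finally show "Jk m * twist 1 (Nk m) = Jk m * (Yk m * diag (Dw (Suc m)))" .
qed simp

text \<open>By \<open>twist_N\<close> and \<open>Delta_Y\<close> the entries of \<open>Nk m\<close>
  and \<open>Yk m\<close> at \<open>c\<close> satisfy two proportionalities. Cancelling a nonzero
  entry leaves an identity between explicit Laurent polynomials, and the monomial of
  \<open>Dw (Suc m)\<close> must occur among the other terms.\<close>

lemma N_nonzero:
  assumes "kapp (Nk m) \<mu> c \<noteq> 0"
  obtains i where "i \<le> m" "c = seg i (Suc m)"
proof -
  \<comment> \<open>Indices up to \<open>m\<close> describe the terms of
    \<open>Delta m (\<mu> - wt c) - Delta m \<mu>\<close> times \<open>tw \<mu> c\<close>; the index
    \<open>Suc m\<close> describes \<open>(qvar - 1) * Dw (Suc m) \<mu>\<close>, brought to the same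
    side.\<close>
  define a where "a i = (if i \<le> m then lookup \<mu> i - int i - lookup (wt c) i + Wexp \<mu> c
      else lookup \<mu> (Suc m) - int (Suc m) + 1)" for i
  define b where "b i = (if i \<le> m then lookup \<mu> i - int i + Wexp \<mu> c
      else lookup \<mu> (Suc m) - int (Suc m))" for i
  define e where "e i = (if i \<le> m then zexp (seg 0 i + c) else zexp (seg 0 (Suc m)))" for i
  have tN: "tw \<mu> c * kapp (Nk m) \<mu> c = kapp (Yk m) \<mu> c * Dw (Suc m) \<mu>"
    using arg_cong[OF twist_N[of m], of "\<lambda>K. kapp K \<mu> c"] by (simp add: kapp_twist kapp_times_diag)
  have "(Delta m (\<mu> - wt c) - Delta m \<mu>) * kapp (Yk m) \<mu> c = (1 - qvar) * kapp (Nk m) \<mu> c"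
    using arg_cong[OF Delta_Y[of m], of "\<lambda>K. kapp K \<mu> c"]
    by (simp add: kapp_simps kapp_times_diag kapp_diag_times algebra_simps)
  then have "(Delta m (\<mu> - wt c) - Delta m \<mu>) * (kapp (Yk m) \<mu> c * Dw (Suc m) \<mu>)
      = (1 - qvar) * kapp (Nk m) \<mu> c * Dw (Suc m) \<mu>"
    by (simp add: mult.assoc[symmetric])
  then have "(Delta m (\<mu> - wt c) - Delta m \<mu>) * tw \<mu> c * kapp (Nk m) \<mu> c
      = (1 - qvar) * Dw (Suc m) \<mu> * kapp (Nk m) \<mu> c"
    unfolding tN[symmetric] by (simp add: mult_ac)
  then have "(Delta m (\<mu> - wt c) - Delta m \<mu>) * tw \<mu> c = (1 - qvar) * Dw (Suc m) \<mu>"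
    using assms by simp
  then have "(Delta m (\<mu> - wt c) - Delta m \<mu>) * tw \<mu> c + (qvar - 1) * Dw (Suc m) \<mu> = 0"
    by (simp only:) (simp add: algebra_simps)
  also have "(Delta m (\<mu> - wt c) - Delta m \<mu>) * tw \<mu> c
      = (\<Sum>i\<le>m. (qvar powi a i - qvar powi b i) * mon (e i))"
    unfolding Delta_def sum_subtractf[symmetric] sum_distrib_right
  proof (rule sum.cong[OF refl])
    fix i assume "i \<in> {..m}"
    then have "qvar powi a i = qvar powi (lookup \<mu> i - int i) * qvar powi (- lookup (wt c) i) * qvar powi Wexp \<mu> c"
      "qvar powi b i = qvar powi (lookup \<mu> i - int i) * qvar powi Wexp \<mu> c"
      "mon (e i) = mon (zexp (seg 0 i)) * mon (zexp c)"
      by (simp_all add: a_def b_def e_def zexp_add mon_add qvar_powi_add[symmetric])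
    then show "(Dw i (\<mu> - wt c) - Dw i \<mu>) * tw \<mu> c = (qvar powi a i - qvar powi b i) * mon (e i)"
      unfolding D_diff by (simp add: Dw_def tw_def algebra_simps)
  qed
  also have "(qvar - 1) * Dw (Suc m) \<mu> = (qvar powi a (Suc m) - qvar powi b (Suc m)) * mon (e (Suc m))"
    using qvar_powi_add[of "lookup \<mu> (Suc m) - int (Suc m)" 1]
    by (simp add: a_def b_def e_def Dw_def algebra_simps del: of_nat_Suc)
  finally have sum0: "(\<Sum>i\<le>Suc m. (qvar powi a i - qvar powi b i) * mon (e i)) = 0" by simp
  \<comment> \<open>Otherwise the last monomial would occur only once and its two powers of q would
    coincide, although their exponents differ by 1.\<close>
  have "\<exists>i\<le>m. e i = e (Suc m)"
  proof (rule ccontr)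
    assume *: "\<not> (\<exists>i\<le>m. e i = e (Suc m))"
    have "a (Suc m) = b (Suc m)"
      by (rule mon_independent[OF _ _ sum0]) (use * in \<open>auto simp: le_Suc_eq e_def\<close>)
    then show False by (simp add: a_def b_def)
  qed
  then obtain i where i: "i \<le> m" "seg 0 i + c = seg 0 (Suc m)"
    by (auto simp: e_def zexp_eq_iff)
  have "lookup c j = lookup (seg i (Suc m)) j" for j
    using arg_cong[OF i(2), of "\<lambda>x. lookup x j"] i(1)
    by (auto simp: lookup_add lookup_seg split: if_splits)
  then have "c = seg i (Suc m)" by (rule poly_mapping_eqI)
  then show thesis using i(1) that by blast
qed

section \<open>Quotients of the kernels \<open>Jk\<close> and their support\<close>

definition Fk :: "nat \<Rightarrow> nat \<Rightarrow> kern" where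
  "Fk k m = ldiv (Jk k) (Jk m)"

lemma Jk_F: "Jk k * Fk k m = Jk m"
  by (simp add: Fk_def times_ldiv)

lemma unipotent_F [simp]: "unipotent (Fk k m)"
  by (simp add: Fk_def)

lemma local_F: "k \<le> m \<Longrightarrow> local m (Fk k m)"
  unfolding Fk_def by (intro local_ldiv local_Jk local_mono[OF local_Jk])

text \<open>Compare the eigenvalue equations of ranks \<open>m\<close> and \<open>Suc m\<close>.
  Multiplied by \<open>Jk m\<close> from the left, the difference of the two Hamiltonians becomes
  \<open>Jk m * Nk m\<close>, besides the term \<open>diag (Dw (Suc m))\<close>, which completes
  \<open>Delta m\<close> to \<open>Delta (Suc m)\<close>.\<close>

lemma Delta_F: "diag (Delta (Suc m)) * Fk m (Suc m) - Fk m (Suc m) * diag (Delta (Suc m)) = Nk m * Fk m (Suc m)"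
proof (rule left_cancel[of "Jk m"])
  let ?Fk = "Fk m (Suc m)"
  have "Jk m * diag (Delta (Suc m)) = Hk m * Jk m + diag (Dw (Suc m)) * Jk m"
    by (simp only: diag_Delta_Suc distrib_left H_Jk diag_D_commute[OF supported_Jk])
  also have "\<dots> = Hk (Suc m) * Jk m + diag (Dw m) * Xk m * Jk m"
    by (simp add: H_Suc algebra_simps)
  finally have "Jk m * (diag (Delta (Suc m)) * ?Fk)
      = Hk (Suc m) * (Jk m * ?Fk) + diag (Dw m) * Xk m * (Jk m * ?Fk)"
    by (simp add: mult.assoc[symmetric] distrib_right)
  also have "\<dots> = (Jk m * ?Fk) * diag (Delta (Suc m)) + (Jk m * Nk m) * ?Fk"
    by (simp only: Jk_F H_Jk) (simp only: Jk_N Jk_F mult.assoc)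
  finally show "Jk m * (diag (Delta (Suc m)) * ?Fk - ?Fk * diag (Delta (Suc m))) = Jk m * (Nk m * ?Fk)"
    by (simp add: right_diff_distrib mult.assoc)
qed simp

text \<open>Different \<open>Dw i\<close> carry different monomials in the Z, so a vanishing
  difference would kill every coordinate of \<open>wt c\<close> up to \<open>m\<close>, and with
  them all coefficients of \<open>c\<close>.\<close>

lemma Delta_diff_nonzero:
  assumes "keys c \<subseteq> {..<m}" "c \<noteq> 0"
  shows "Delta m (\<mu> - wt c) - Delta m \<mu> \<noteq> 0"
proof
  assume "Delta m (\<mu> - wt c) - Delta m \<mu> = 0"
  moreover have "Delta m (\<mu> - wt c) - Delta m \<mu> = (\<Sum>i\<le>m.
      (qvar powi (lookup \<mu> i - int i - lookup (wt c) i) - qvar powi (lookup \<mu> i - int i)) * mon (zexp (seg 0 i)))"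
    unfolding Delta_def sum_subtractf[symmetric]
    by (rule sum.cong) (simp_all add: Dw_def lookup_minus algebra_simps)
  ultimately have 0: "(\<Sum>i\<le>m. (qvar powi (lookup \<mu> i - int i - lookup (wt c) i)
      - qvar powi (lookup \<mu> i - int i)) * mon (zexp (seg 0 i))) = 0" by simp
  have "seg 0 i \<noteq> seg 0 j" if "i \<noteq> j" for i j
  proof
    assume eq: "seg 0 i = seg 0 j"
    show False using arg_cong[OF eq, of "\<lambda>x. lookup x (min i j)"] that
      by (auto simp: lookup_seg min_def split: if_splits)
  qed
  then have "lookup \<mu> i - int i - lookup (wt c) i = lookup \<mu> i - int i" if "i \<le> m" for i
    by (intro mon_independent[OF _ _ 0]) (use that in \<open>auto simp: zexp_eq_iff\<close>)
  then have wt0: "lookup (wt c) i = 0" if "i \<le> m" for i using that by simp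
  have "lookup c i = 0" if "i \<le> m" for i using that
  proof (induction i)
    case 0
    then show ?case using wt0[of 0] by (simp add: lookup_wt_0)
  next
    case (Suc i)
    then show ?case using wt0[of "Suc i"] by (simp add: lookup_wt_Suc)
  qed
  then have "lookup c i = 0" for i
    using assms(1) by (cases "i \<le> m") (auto simp: in_keys_iff subset_iff)
  then show False using assms(2) by (metis poly_mapping_eqI lookup_zero)
qed

lemma Rplus_0: "0 \<in> Rplus i"
  unfolding Rplus_def by (auto intro!: exI[of _ "\<lambda>_. 0"])

lemma Rplus_add:
  assumes "x \<in> Rplus i" "y \<in> Rplus i"
  shows "x + y \<in> Rplus i"
proof -
  obtain a b :: "nat \<Rightarrow> nat" where "x = (\<Sum>k=1..i. frag_cmul (int (a k)) (\<Sum>j=k..i. alpha j))"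
    "y = (\<Sum>k=1..i. frag_cmul (int (b k)) (\<Sum>j=k..i. alpha j))"
    using assms unfolding Rplus_def by blast
  then have "x + y = (\<Sum>k=1..i. frag_cmul (int (a k + b k)) (\<Sum>j=k..i. alpha j))"
    by (simp add: frag_cmul_distrib sum.distrib)
  then show ?thesis unfolding Rplus_def by (auto intro!: exI[of _ "\<lambda>k. a k + b k"])
qed

lemma wt_sum: "wt (sum f A) = (\<Sum>i\<in>A. wt (f i))"
  by (induction A rule: infinite_finite_induct) (simp_all add: wt_add)

lemma wt_seg_in_Rplus:
  assumes "i \<le> m"
  shows "wt (seg i (Suc m)) \<in> Rplus (Suc m)"
proof -
  have "wt (seg i (Suc m)) = (\<Sum>j\<in>{i..<Suc m}. alpha (Suc j))"
    using wt_single by (simp add: seg_def wt_sum del: sum.op_ivl_Suc)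
  also have "\<dots> = (\<Sum>j=Suc i..Suc m. alpha j)"
    by (simp only: sum.shift_bounds_cl_Suc_ivl atLeastLessThanSuc_atLeastAtMost)
  also have "\<dots> = (\<Sum>k=1..Suc m. if k = Suc i then frag_cmul (int 1) (\<Sum>j=k..Suc m. alpha j) else 0)"
    using assms by (simp del: sum.cl_ivl_Suc)
  also have "\<dots> = (\<Sum>k=1..Suc m. frag_cmul (int (if k = Suc i then 1 else 0)) (\<Sum>j=k..Suc m. alpha j))"
    by (rule sum.cong) (auto simp del: sum.cl_ivl_Suc)
  finally show ?thesis unfolding Rplus_def by (auto simp del: sum.cl_ivl_Suc)
qed

text \<open>By \<open>Delta_F\<close> a nonzero entry at \<open>c \<noteq> 0\<close> requires a
  decomposition of \<open>c\<close> into a segment from the support of \<open>Nk m\<close> and a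
  shorter vector from the support of the quotient. Induction on the height removes one generator of
  \<open>Rplus (Suc m)\<close> at a time.\<close>

lemma F_support:
  assumes "kapp (Fk m (Suc m)) \<mu> c \<noteq> 0"
  shows "wt c \<in> Rplus (Suc m)"
  using assms
proof (induction "ht c" arbitrary: c rule: less_induct)
  case less
  show ?case
  proof (cases "c = 0")
    case False
    have "keys c \<subseteq> {..<Suc m}"
      using less(2) local_F[of m "Suc m"] by (auto simp: local_def supported_def)
    then have "Delta (Suc m) (\<mu> - wt c) - Delta (Suc m) \<mu> \<noteq> 0"
      using Delta_diff_nonzero False by blast
    then have "(Delta (Suc m) (\<mu> - wt c) - Delta (Suc m) \<mu>) * kapp (Fk m (Suc m)) \<mu> c \<noteq> 0"
      using less(2) by simp
    also have "(Delta (Suc m) (\<mu> - wt c) - Delta (Suc m) \<mu>) * kapp (Fk m (Suc m)) \<mu> c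
        = kapp (Nk m * Fk m (Suc m)) \<mu> c"
      unfolding Delta_F[symmetric] by (simp add: kapp_simps kapp_times_diag kapp_diag_times algebra_simps)
    finally obtain p where "p \<in> splits c" "(case p of (a, b) \<Rightarrow> kapp (Nk m) (\<mu> - wt b) a * kapp (Fk m (Suc m)) \<mu> b) \<noteq> 0"
      unfolding kapp_times by (meson sum.not_neutral_contains_not_neutral)
    then obtain a b where ab: "a + b = c" "kapp (Nk m) (\<mu> - wt b) a \<noteq> 0" "kapp (Fk m (Suc m)) \<mu> b \<noteq> 0"
      by (cases p) auto
    obtain i where i: "i \<le> m" "a = seg i (Suc m)" using ab(2) by (rule N_nonzero)
    then have "lookup a m > 0" by (simp add: lookup_seg)
    then have "ht a > 0" using ht_eq_0_iff[of a] by (metis gr0I lookup_zero)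
    then have "ht b < ht c" using ht_add[of a b] by (simp add: ab(1))
    then have "wt b \<in> Rplus (Suc m)" using less(1) ab(3) by blast
    then show ?thesis using Rplus_add[OF wt_seg_in_Rplus[OF i(1)]] by (simp add: i(2) wt_add flip: ab(1))
  qed (simp add: Rplus_0)
qed

subsection \<open>Valuations\<close>

lemma zdeg_superset:
  assumes "finite A" "keys a \<subseteq> A"
  shows "zdeg a = (\<Sum>j\<in>A - {0}. int (lookup a j))"
  unfolding zdeg_def using assms by (intro sum.mono_neutral_left) (auto simp: in_keys_iff)

lemma zdeg_add: "zdeg (a + b) = zdeg a + zdeg b"
proof -
  let ?A = "keys a \<union> keys b"
  have "zdeg a = (\<Sum>j\<in>?A - {0}. int (lookup a j))" "zdeg b = (\<Sum>j\<in>?A - {0}. int (lookup b j))"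
    "zdeg (a + b) = (\<Sum>j\<in>?A - {0}. int (lookup (a + b) j))"
    by (rule zdeg_superset; use keys_add[of a b] in auto)+
  then show ?thesis by (simp add: lookup_add sum.distrib)
qed

lemma zdeg_0 [simp]: "zdeg 0 = 0"
  by (simp add: zdeg_def)

lemma zdeg_single_0 [simp]: "zdeg (single 0 k) = 0"
  by (simp add: zdeg_def)

lemma zdeg_zexp [simp]: "zdeg (zexp c) = int (ht c)"
proof -
  have "keys (zexp c) \<subseteq> insert 0 (Suc ` keys c)"
  proof
    fix k assume "k \<in> keys (zexp c)"
    then show "k \<in> insert 0 (Suc ` keys c)" by (cases k) (auto simp: in_keys_iff)
  qed
  then have "zdeg (zexp c) = (\<Sum>j\<in>insert 0 (Suc ` keys c) - {0}. int (lookup (zexp c) j))"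
    by (intro zdeg_superset) auto
  also have "insert 0 (Suc ` keys c) - {0} = Suc ` keys c" by auto
  finally show ?thesis by (simp add: sum.reindex ht_def)
qed

lemma keys_nonempty: "p \<noteq> 0 \<Longrightarrow> keys p \<noteq> {}"
  by (metis in_keys_iff empty_iff lookup_zero poly_mapping_eqI)

lemma pval_le: "k \<in> keys p \<Longrightarrow> pval s p \<le> s * zdeg k"
  unfolding pval_def by (intro Min_le) auto

lemma pval_attained:
  assumes "p \<noteq> 0"
  obtains k where "k \<in> keys p" "pval s p = s * zdeg k"
proof -
  have "pval s p \<in> (\<lambda>a. s * zdeg a) ` keys p"
    unfolding pval_def by (rule Min_in) (use keys_nonempty[OF assms] in auto)
  then show thesis using that by auto
qed

lemma pval_geI:
  assumes "p \<noteq> 0" "\<And>k. k \<in> keys p \<Longrightarrow> x \<le> s * zdeg k"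
  shows "x \<le> pval s p"
  using pval_attained[OF assms(1)] assms(2) by metis

text \<open>Among the exponents of minimal weight the least one for the monomial order has a nonzero
  coefficient in the product, being obtained in exactly one way.\<close>

lemma pval_mult:
  assumes "p \<noteq> 0" "p' \<noteq> 0"
  shows "pval s (p * p') = pval s p + pval s p'"
proof -
  have least: "\<exists>k\<in>keys p. s * zdeg k = pval s p \<and> (\<forall>l\<in>keys p. s * zdeg l = pval s p \<longrightarrow> k \<le> l)"
    if "p \<noteq> 0" for p
  proof -
    let ?S = "{k \<in> keys p. s * zdeg k = pval s p}"
    have "?S \<noteq> {}" using pval_attained[OF that] by (metis (mono_tags, lifting) empty_iff mem_Collect_eq)
    then have "Min ?S \<in> ?S" "\<forall>l\<in>?S. Min ?S \<le> l" using Min_in[of ?S] Min_le[of ?S] by auto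
    then show ?thesis by auto
  qed
  obtain k where k: "k \<in> keys p" "s * zdeg k = pval s p"
    "\<And>l. l \<in> keys p \<Longrightarrow> s * zdeg l = pval s p \<Longrightarrow> k \<le> l" using least[OF assms(1)] by blast
  obtain k' where k': "k' \<in> keys p'" "s * zdeg k' = pval s p'"
    "\<And>l. l \<in> keys p' \<Longrightarrow> s * zdeg l = pval s p' \<Longrightarrow> k' \<le> l" using least[OF assms(2)] by blast
  have unique: "l = k \<and> l' = k'" if "l \<in> keys p" "l' \<in> keys p'" "l + l' = k + k'" for l l'
  proof -
    have "zdeg l + zdeg l' = zdeg k + zdeg k'" using that(3) by (metis zdeg_add)
    then have "s * zdeg l + s * zdeg l' = s * zdeg k + s * zdeg k'" by (metis distrib_left)
    then have "s * zdeg l = pval s p" "s * zdeg l' = pval s p'"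
      using pval_le[OF that(1), of s] pval_le[OF that(2), of s] k(2) k'(2) by auto
    then have "k \<le> l" "k' \<le> l'" using k(3) k'(3) that by auto
    then show ?thesis using that(3)
      by (metis add_le_cancel_left add_le_cancel_right add_left_cancel add_right_cancel antisym)
  qed
  have "lookup (p * p') (k + k') = (\<Sum>l\<in>keys p. lookup p l * (\<Sum>l'\<in>keys p'. lookup p' l' when k + k' = l + l'))"
  proof -
    have *: "(\<Sum>l'. lookup p' l' when k + k' = l + l') = (\<Sum>l'\<in>keys p'. lookup p' l' when k + k' = l + l')" for l
      by (rule Sum_any.expand_superset) (auto simp: in_keys_iff)
    show ?thesis unfolding lookup_mult *
      by (rule Sum_any.expand_superset) (auto simp: in_keys_iff)
  qed
  also have "\<dots> = (\<Sum>l\<in>keys p. if l = k then lookup p k * lookup p' k' else 0)"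
  proof (rule sum.cong[OF refl])
    fix l assume l: "l \<in> keys p"
    have "(\<Sum>l'\<in>keys p'. lookup p' l' when k + k' = l + l')
        = (\<Sum>l'\<in>keys p'. if l' = k' then (if l = k then lookup p' k' else 0) else 0)"
    proof (rule sum.cong[OF refl])
      fix l' assume "l' \<in> keys p'"
      then show "(lookup p' l' when k + k' = l + l') = (if l' = k' then (if l = k then lookup p' k' else 0) else 0)"
        using unique[OF l, of l'] by (auto simp: when_def)
    qed
    then show "lookup p l * (\<Sum>l'\<in>keys p'. lookup p' l' when k + k' = l + l')
        = (if l = k then lookup p k * lookup p' k' else 0)" using k' by simp
  qed
  also have "\<dots> = lookup p k * lookup p' k'" using k by simp
  finally have "k + k' \<in> keys (p * p')" using k k' by (simp add: in_keys_iff)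
  then have "pval s (p * p') \<le> pval s p + pval s p'"
    using pval_le[of "k + k'" "p * p'" s] k k' by (simp add: zdeg_add algebra_simps)
  moreover have "pval s p + pval s p' \<le> pval s (p * p')"
  proof (rule pval_geI)
    fix l assume "l \<in> keys (p * p')"
    then obtain a b where "l = a + b" "a \<in> keys p" "b \<in> keys p'" using keys_mult by blast
    then show "pval s p + pval s p' \<le> s * zdeg l"
      using pval_le[of a p s] pval_le[of b p' s] by (simp add: zdeg_add algebra_simps)
  qed (use assms in simp)
  ultimately show ?thesis by simp
qed

lemma pval_single [simp]: "x \<noteq> 0 \<Longrightarrow> pval s (single e x) = s * zdeg e"
  by (simp add: pval_def)

lemma pval_1 [simp]: "pval s 1 = 0"
  by (simp add: pval_def)

text \<open>The exact order of vanishing; unlike the lower bound \<open>val_ge\<close> it passes to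
  inverses.\<close>

definition val_eq :: "int \<Rightarrow> int \<Rightarrow> ratfun \<Rightarrow> bool" where
  "val_eq s N f \<longleftrightarrow> (\<exists>a b. a \<noteq> 0 \<and> b \<noteq> 0 \<and> f = Fract a b \<and> pval s a - pval s b = N)"

lemma val_eq_exists:
  assumes "f \<noteq> 0"
  obtains N where "val_eq s N f"
proof (cases f)
  case (Fract a b)
  then have "a \<noteq> 0" using assms by (auto simp: Zero_fract_def eq_fract)
  then show ?thesis using Fract that unfolding val_eq_def by blast
qed

lemma val_eq_unique:
  assumes "val_eq s N f" "val_eq s M f"
  shows "N = M"
proof -
  obtain a b where 1: "a \<noteq> 0" "b \<noteq> 0" "f = Fract a b" "pval s a - pval s b = N"
    using assms(1) unfolding val_eq_def by blast
  obtain c d where 2: "c \<noteq> 0" "d \<noteq> 0" "f = Fract c d" "pval s c - pval s d = M"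
    using assms(2) unfolding val_eq_def by blast
  have "a * d = c * b" using 1 2 by (simp add: eq_fract)
  then have "pval s a + pval s d = pval s c + pval s b" using 1 2 by (metis pval_mult)
  then show ?thesis using 1 2 by simp
qed

lemma val_ge_iff: "val_ge s N f \<longleftrightarrow> f = 0 \<or> (\<exists>M\<ge>N. val_eq s M f)"
  unfolding val_ge_def val_eq_def by auto

lemma val_eq_imp_val_ge: "val_eq s M f \<Longrightarrow> N \<le> M \<Longrightarrow> val_ge s N f"
  by (auto simp: val_ge_iff)

lemma val_eq_mult:
  assumes "val_eq s N f" "val_eq s M g"
  shows "val_eq s (N + M) (f * g)"
proof -
  obtain a b where 1: "a \<noteq> 0" "b \<noteq> 0" "f = Fract a b" "pval s a - pval s b = N"
    using assms(1) unfolding val_eq_def by blast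
  obtain c d where 2: "c \<noteq> 0" "d \<noteq> 0" "g = Fract c d" "pval s c - pval s d = M"
    using assms(2) unfolding val_eq_def by blast
  show ?thesis unfolding val_eq_def
    by (rule exI[of _ "a * c"], rule exI[of _ "b * d"]) (use 1 2 in \<open>simp add: pval_mult\<close>)
qed

lemma val_eq_inverse:
  assumes "val_eq s N f"
  shows "val_eq s (- N) (inverse f)"
proof -
  obtain a b where 1: "a \<noteq> 0" "b \<noteq> 0" "f = Fract a b" "pval s a - pval s b = N"
    using assms(1) unfolding val_eq_def by blast
  show ?thesis unfolding val_eq_def
    by (rule exI[of _ b], rule exI[of _ a]) (use 1 in simp)
qed

lemma val_eq_1 [simp]: "val_eq s 0 1"
  unfolding val_eq_def by (rule exI[of _ 1], rule exI[of _ 1]) (simp add: One_fract_def)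

lemma val_eq_mon: "val_eq s (s * zdeg e) (mon e)"
proof -
  have "single e (1 :: rat) \<noteq> 0" by (metis lookup_single_eq lookup_zero zero_neq_one)
  then show ?thesis unfolding val_eq_def mon_def
    by (intro exI[of _ "single e 1"] exI[of _ 1]) simp
qed

lemma val_eq_power: "val_eq s N f \<Longrightarrow> val_eq s (int k * N) (f ^ k)"
proof (induction k)
  case (Suc k)
  then show ?case using val_eq_mult[of s N f "int k * N" "f ^ k"] by (simp add: algebra_simps)
qed simp

lemma val_eq_powi: "val_eq s N f \<Longrightarrow> val_eq s (k * N) (f powi k)"
  using val_eq_power[of s N f "nat k"] val_eq_inverse[OF val_eq_power[of s N f "nat (- k)"]]
  by (cases "k \<ge> 0") (simp_all add: power_int_def power_inverse)

lemma val_eq_prod: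
  "(\<And>i. i \<in> A \<Longrightarrow> val_eq s 0 (f i)) \<Longrightarrow> val_eq s 0 (prod f A)"
  by (induction A rule: infinite_finite_induct) (use val_eq_mult[of s 0 _ 0] in auto)

lemma val_eq_qvar: "val_eq s 0 qvar"
  using val_eq_mon[of s "single 0 1"] by (simp add: var_mon)

text \<open>Powers of q have order 0 and every Z has order \<open>s\<close>. A twist by large
  \<open>s * r\<close> therefore pushes all entries off the diagonal towards 0, which is the source
  of the convergence statements below.\<close>

lemma val_eq_tw: "val_eq s (s * int (ht c)) (tw \<mu> c)"
  using val_eq_mult[OF val_eq_powi[OF val_eq_qvar] val_eq_mon[of s "zexp c"]] by (simp add: tw_def)

lemma val_eq_qpoch: "val_eq s 0 (qpoch m)"
  unfolding qpoch_def
proof (rule val_eq_prod)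
  fix i assume i: "i \<in> {1..m}"
  let ?p = "1 - single (single 0 i) 1 :: qzpoly"
  have q: "1 - qvar ^ i = Fract ?p 1"
    by (simp add: var_power mon_def One_fract_def)
  then have p: "?p \<noteq> 0" using qvar_power_neq_1[of i] i by (auto simp: Zero_fract_def[symmetric])
  have "k = 0 \<or> k = single 0 i" if "k \<in> keys ?p" for k
    using that by (auto simp: in_keys_iff lookup_minus lookup_one lookup_single when_def split: if_splits)
  then have "pval s ?p = 0" using pval_attained[OF p, of s] by (metis mult_zero_right zdeg_0 zdeg_single_0)
  then show "val_eq s 0 (1 - qvar ^ i)"
    unfolding q val_eq_def using p by (intro exI[of _ ?p] exI[of _ 1]) simp
qed

lemma val_eq_inverse_epoch: "val_eq s 0 (inverse (epoch c))"
  using val_eq_inverse[OF val_eq_prod[of "keys c" s "\<lambda>j. qpoch (lookup c j)"]] val_eq_qpoch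
  by (simp add: epoch_def)

lemma val_ge_0 [simp]: "val_ge s N 0"
  by (simp add: val_ge_def)

lemma val_ge_mono: "val_ge s N f \<Longrightarrow> M \<le> N \<Longrightarrow> val_ge s M f"
  unfolding val_ge_iff by (meson order_trans)

lemma val_ge_mult:
  assumes "val_ge s N f" "val_ge s M g"
  shows "val_ge s (N + M) (f * g)"
proof (cases "f = 0 \<or> g = 0")
  case False
  then obtain n m where "N \<le> n" "M \<le> m" "val_eq s n f" "val_eq s m g"
    using assms by (auto simp: val_ge_iff)
  then show ?thesis using val_eq_imp_val_ge[OF val_eq_mult] by force
qed auto

text \<open>Over the common denominator \<open>b * d\<close>, each exponent of the numerator stems
  from one of the two products, whose orders are known by \<open>pval_mult\<close>.\<close>

lemma val_ge_add:
  assumes "val_ge s N f" "val_ge s N g"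
  shows "val_ge s N (f + g)"
proof (cases "f = 0 \<or> g = 0 \<or> f + g = 0")
  case False
  then obtain a b c d where 1: "a \<noteq> 0" "b \<noteq> 0" "f = Fract a b" "N \<le> pval s a - pval s b"
    and 2: "c \<noteq> 0" "d \<noteq> 0" "g = Fract c d" "N \<le> pval s c - pval s d"
    using assms unfolding val_ge_def by blast
  have fg: "f + g = Fract (a * d + c * b) (b * d)" using 1 2 by simp
  then have nz: "a * d + c * b \<noteq> 0" using False 1 2 by (auto simp: Zero_fract_def eq_fract)
  have "N + pval s b + pval s d \<le> pval s (a * d + c * b)"
  proof (rule pval_geI[OF nz])
    fix k assume "k \<in> keys (a * d + c * b)"
    then consider "k \<in> keys (a * d)" | "k \<in> keys (c * b)"
      using keys_add[of "a * d" "c * b"] by blast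
    then show "N + pval s b + pval s d \<le> s * zdeg k"
    proof cases
      case 1
      then show ?thesis using pval_le[OF 1, of s] pval_mult[of a d s] \<open>a \<noteq> 0\<close> \<open>d \<noteq> 0\<close> \<open>N \<le> pval s a - _\<close> by simp
    next
      case 2
      then show ?thesis using pval_le[OF 2, of s] pval_mult[of c b s] \<open>c \<noteq> 0\<close> \<open>b \<noteq> 0\<close> \<open>N \<le> pval s c - _\<close> by simp
    qed
  qed
  then show ?thesis unfolding val_ge_def
    by (intro disjI2 exI[of _ "a * d + c * b"] exI[of _ "b * d"]) (use 1 2 nz fg in \<open>simp add: pval_mult\<close>)
qed (use assms in auto)

lemma val_ge_uminus: "val_ge s N f \<Longrightarrow> val_ge s N (- f)"
proof -
  assume f: "val_ge s N f"
  have "single 0 (- 1 :: rat) \<noteq> (0 :: qzpoly)" by (metis lookup_single_eq lookup_zero neg_equal_0_iff_equal zero_neq_one)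
  then have "val_eq s 0 (Fract (single 0 (- 1)) 1)"
    unfolding val_eq_def by (intro exI[of _ "single 0 (- 1)"] exI[of _ 1]) simp
  moreover have "Fract (single 0 (- 1)) 1 = (- 1 :: ratfun)"
    by (simp add: One_fract_def single_uminus)
  ultimately have "val_ge s 0 (- 1)" using val_eq_imp_val_ge by auto
  from val_ge_mult[OF this f] show ?thesis by simp
qed

lemma val_ge_diff: "val_ge s N f \<Longrightarrow> val_ge s N g \<Longrightarrow> val_ge s N (f - g)"
  using val_ge_add[of s N f "- g"] val_ge_uminus by simp

lemma val_ge_sum: "(\<And>i. i \<in> A \<Longrightarrow> val_ge s N (f i)) \<Longrightarrow> val_ge s N (sum f A)"
  by (induction A rule: infinite_finite_induct) (auto intro: val_ge_add)

lemma val_ge_exists: "\<exists>N. val_ge s N f"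
  using val_eq_exists[of f s] val_eq_imp_val_ge by (metis order_refl val_ge_0)

text \<open>A nonzero rational function has a finite order; this gives the uniqueness of
  limits.\<close>

lemma val_ge_all_imp_0:
  assumes "\<And>N. val_ge s N f"
  shows "f = 0"
proof (rule ccontr)
  assume "f \<noteq> 0"
  then obtain M where M: "val_eq s M f" by (rule val_eq_exists)
  obtain M' where "M' \<ge> M + 1" "val_eq s M' f" using assms[of "M + 1"] \<open>f \<noteq> 0\<close> by (auto simp: val_ge_iff)
  then show False using val_eq_unique[OF M] by auto
qed

section \<open>Limits with respect to the valuation\<close>

lemma val_tendsto_const [simp]: "val_tendsto s (\<lambda>_. f) f F"
  by (simp add: val_tendsto_def)

lemma val_tendsto_add:
  assumes "val_tendsto s U u F" "val_tendsto s V v F"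
  shows "val_tendsto s (\<lambda>x. U x + V x) (u + v) F"
  unfolding val_tendsto_def
proof
  fix N
  have "eventually (\<lambda>x. val_ge s N (U x - u)) F" "eventually (\<lambda>x. val_ge s N (V x - v)) F"
    using assms by (auto simp: val_tendsto_def)
  then show "eventually (\<lambda>x. val_ge s N (U x + V x - (u + v))) F"
  proof eventually_elim
    case (elim x)
    then show ?case using val_ge_add[of s N "U x - u" "V x - v"] by (simp add: algebra_simps)
  qed
qed

lemma val_tendsto_sum:
  "(\<And>i. i \<in> A \<Longrightarrow> val_tendsto s (\<lambda>x. U x i) (u i) F) \<Longrightarrow>
    val_tendsto s (\<lambda>x. \<Sum>i\<in>A. U x i) (\<Sum>i\<in>A. u i) F"
  by (induction A rule: infinite_finite_induct) (auto intro: val_tendsto_add)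

lemma val_tendsto_mult:
  assumes "val_tendsto s U u F" "val_tendsto s V v F"
  shows "val_tendsto s (\<lambda>x. U x * V x) (u * v) F"
  unfolding val_tendsto_def
proof
  fix N
  obtain a b where a: "val_ge s a u" and b: "val_ge s b v" using val_ge_exists by meson
  \<comment> \<open>The two bounds are strong enough for all three terms in the expansion of
    \<open>U x * V x - u * v\<close>: the product of both deviations and the two mixed
    terms.\<close>
  have "eventually (\<lambda>x. val_ge s (max 0 (N - b)) (U x - u)) F"
    "eventually (\<lambda>x. val_ge s (max N (N - a)) (V x - v)) F"
    using assms by (auto simp: val_tendsto_def)
  then show "eventually (\<lambda>x. val_ge s N (U x * V x - u * v)) F"
  proof eventually_elim
    case (elim x)
    have "val_ge s N ((U x - u) * (V x - v))"
      by (rule val_ge_mono[OF val_ge_mult[OF elim]]) simp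
    moreover have "val_ge s N ((U x - u) * v)"
      by (rule val_ge_mono[OF val_ge_mult[OF elim(1) b]]) simp
    moreover have "val_ge s N (u * (V x - v))"
      by (rule val_ge_mono[OF val_ge_mult[OF a elim(2)]]) simp
    ultimately have "val_ge s N ((U x - u) * (V x - v) + (U x - u) * v + u * (V x - v))"
      by (intro val_ge_add)
    then show ?case by (simp add: algebra_simps)
  qed
qed

lemma val_tendsto_unique:
  assumes "F \<noteq> bot" "val_tendsto s U u F" "val_tendsto s U v F"
  shows "u = v"
proof -
  have "val_ge s N (u - v)" for N
  proof -
    have "eventually (\<lambda>x. val_ge s N (U x - v)) F" "eventually (\<lambda>x. val_ge s N (U x - u)) F"
      using assms by (auto simp: val_tendsto_def)
    then have "eventually (\<lambda>x. val_ge s N (u - v)) F"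
    proof eventually_elim
      case (elim x)
      then show ?case using val_ge_diff[of s N "U x - v" "U x - u"] by simp
    qed
    then show ?thesis using assms(1) by simp
  qed
  then show ?thesis using val_ge_all_imp_0[of s "u - v"] by simp
qed

lemma val_lim_eqI: "F \<noteq> bot \<Longrightarrow> val_tendsto s U u F \<Longrightarrow> val_lim s U F = u"
  unfolding val_lim_def by (rule the_equality) (auto intro: val_tendsto_unique)

lemma val_tendsto_cong:
  "eventually (\<lambda>x. U x = V x) F \<Longrightarrow> val_tendsto s U u F \<Longrightarrow> val_tendsto s V u F"
  unfolding val_tendsto_def by (auto elim: eventually_elim2)

subsection \<open>Fermionic summands\<close>

lemma val_eq_prod_sum:
  "(\<And>i. i \<in> A \<Longrightarrow> val_eq s (N i) (f i)) \<Longrightarrow> val_eq s (\<Sum>i\<in>A. N i) (\<Prod>i\<in>A. f i)"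
  by (induction A rule: infinite_finite_induct) (auto intro: val_eq_mult)

lemma root_coeff_wt: "root_coeff (wt c) (Suc j) = int (lookup c j)"
proof -
  have "root_coeff (wt c) (Suc j) = (\<Sum>k<Suc j. lookup (wt c) k)"
    by (simp add: root_coeff_def omega_def ip_sum_left ip_add_left ip_eps)
  also have "\<dots> = int (lookup c j)"
    by (induction j) (simp_all add: lookup_wt_0 lookup_wt_Suc)
  finally show ?thesis .
qed

lemma ip_rho_wt:
  assumes "keys c \<subseteq> {..<n}"
  shows "ip (rho n) (wt c) = int (ht c)"
proof -
  have "ip (rho n) (wt c) = (\<Sum>i\<in>Suc ` {..<n}. root_coeff (wt c) i)"
    by (simp add: rho_def ip_sum_left root_coeff_def image_Suc_lessThan)
  also have "\<dots> = int (ht c)"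
    by (simp add: sum.reindex root_coeff_wt ht_superset[OF _ assms])
  finally show ?thesis .
qed

lemma mon_sum: "mon (sum f A) = (\<Prod>i\<in>A. mon (f i))"
  by (induction A rule: infinite_finite_induct) (simp_all add: mon_add)

lemma mon_zexp:
  assumes "keys c \<subseteq> {..<n}"
  shows "mon (zexp c) = (\<Prod>j<n. var (Suc j) ^ lookup c j)"
  by (simp add: zexp_superset[OF _ assms] mon_sum var_power)

text \<open>The exponent \<open>B\<close> over any finite index set, to be used with sets containing
  the support. The pairing with \<rho> is replaced by the height, so that \<open>n\<close>
  disappears.\<close>

definition Bsum :: "wt \<Rightarrow> int set \<Rightarrow> (int \<Rightarrow> cvec) \<Rightarrow> int" where
  "Bsum \<mu> A f = (\<Sum>t\<in>A. \<Sum>t'\<in>A. min t t' * ip (wt (f t)) (wt (f t'))) div 2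
     - (\<Sum>t\<in>A. t * (ip \<mu> (wt (f t)) + int (ht (f t))))"

lemma B_eq_Bsum:
  assumes A: "finite A" "{t. f t \<noteq> 0} \<subseteq> A" and f: "\<And>t. keys (f t) \<subseteq> {..<n}"
  shows "B n \<mu> (\<lambda>t. wt (f t)) = Bsum \<mu> A f"
proof -
  let ?S = "{t. f t \<noteq> 0}"
  have "(\<Sum>t\<in>?S. \<Sum>t'\<in>?S. min t t' * ip (wt (f t)) (wt (f t')))
      = (\<Sum>t\<in>?S. \<Sum>t'\<in>A. min t t' * ip (wt (f t)) (wt (f t')))"
    using A by (intro sum.cong refl sum.mono_neutral_left) auto
  also have "\<dots> = (\<Sum>t\<in>A. \<Sum>t'\<in>A. min t t' * ip (wt (f t)) (wt (f t')))"
    using A by (intro sum.mono_neutral_left) auto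
  finally have quad: "(\<Sum>t\<in>?S. \<Sum>t'\<in>?S. min t t' * ip (wt (f t)) (wt (f t')))
      = (\<Sum>t\<in>A. \<Sum>t'\<in>A. min t t' * ip (wt (f t)) (wt (f t')))" .
  have "ip (\<mu> + rho n) (\<Sum>t\<in>?S. frag_cmul t (wt (f t)))
      = (\<Sum>t\<in>?S. t * (ip \<mu> (wt (f t)) + int (ht (f t))))"
    by (simp add: ip_sum_right ip_cmul_right ip_add_left ip_rho_wt[OF f])
  also have "\<dots> = (\<Sum>t\<in>A. t * (ip \<mu> (wt (f t)) + int (ht (f t))))"
    using A by (intro sum.mono_neutral_left) auto
  finally show ?thesis by (simp add: B_def Bsum_def quad)
qed

lemma summand_eq:
  assumes A: "finite A" "{t. f t \<noteq> 0} \<subseteq> A" and f: "\<And>t. keys (f t) \<subseteq> {..<n}"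
  shows "summand n \<mu> (\<lambda>t. wt (f t)) = (qvar powi Bsum \<mu> A f) *
    (\<Prod>j<n. var (Suc j) powi (\<Sum>t\<in>A. t * int (lookup (f t) j))) * (\<Prod>t\<in>A. inverse (epoch (f t)))"
proof -
  let ?S = "{t. f t \<noteq> 0}"
  have "(\<Prod>j=1..n. var j powi (\<Sum>t\<in>?S. t * root_coeff (wt (f t)) j))
      = (\<Prod>j\<in>Suc ` {..<n}. var j powi (\<Sum>t\<in>?S. t * root_coeff (wt (f t)) j))"
    by (simp add: image_Suc_lessThan)
  also have "\<dots> = (\<Prod>j<n. var (Suc j) powi (\<Sum>t\<in>?S. t * int (lookup (f t) j)))"
    by (simp add: prod.reindex root_coeff_wt)
  also have "\<dots> = (\<Prod>j<n. var (Suc j) powi (\<Sum>t\<in>A. t * int (lookup (f t) j)))"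
    using A by (intro prod.cong refl arg_cong[where f = "\<lambda>x. _ powi x"] sum.mono_neutral_left) auto
  finally have Z: "(\<Prod>j=1..n. var j powi (\<Sum>t\<in>?S. t * root_coeff (wt (f t)) j))
      = (\<Prod>j<n. var (Suc j) powi (\<Sum>t\<in>A. t * int (lookup (f t) j)))" .
  have "(\<Prod>j=1..n. qpoch (nat (root_coeff (wt (f t)) j))) = epoch (f t)" for t
  proof -
    have "(\<Prod>j=1..n. qpoch (nat (root_coeff (wt (f t)) j)))
        = (\<Prod>j\<in>Suc ` {..<n}. qpoch (nat (root_coeff (wt (f t)) j)))"
      by (simp add: image_Suc_lessThan)
    then show ?thesis by (simp add: prod.reindex root_coeff_wt epoch_superset[OF _ f])
  qed
  then have "(\<Prod>t\<in>?S. \<Prod>j=1..n. qpoch (nat (root_coeff (wt (f t)) j))) = (\<Prod>t\<in>A. epoch (f t))"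
    using A by (simp, intro prod.mono_neutral_left) auto
  note epochs = this
  have inv: "(\<Prod>t\<in>A. inverse (epoch (f t))) = inverse (\<Prod>t\<in>A. epoch (f t))"
    using prod_inversef[of "\<lambda>t. epoch (f t)" A] by (simp add: comp_def)
  show ?thesis
    unfolding summand_def Let_def wt_eq_0_iff B_eq_Bsum[OF A f] Z epochs inv divide_inverse ..
qed

text \<open>Powers of q and the denominators have order 0, so only the powers of the Z count: each
  simple root at position \<open>t\<close> contributes \<open>t\<close>.\<close>

lemma val_eq_summand:
  assumes A: "finite A" "{t. f t \<noteq> 0} \<subseteq> A" and f: "\<And>t. keys (f t) \<subseteq> {..<n}"
  shows "val_eq 1 (\<Sum>t\<in>A. t * int (ht (f t))) (summand n \<mu> (\<lambda>t. wt (f t)))"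
proof -
  have var: "val_eq 1 1 (var (Suc j))" for j
  proof -
    have "zdeg (single (Suc j) 1) = 1" by (simp add: zdeg_def)
    then show ?thesis using val_eq_mon[of 1 "single (Suc j) 1"] by (simp add: var_mon)
  qed
  have ht: "int (ht (f t)) = (\<Sum>j<n. int (lookup (f t) j))" for t
    using ht_superset[OF _ f, of t] by simp
  have "val_eq 1 (0 + (\<Sum>j<n. (\<Sum>t\<in>A. t * int (lookup (f t) j)) * 1) + 0) (summand n \<mu> (\<lambda>t. wt (f t)))"
    unfolding summand_eq[OF A f]
    by (intro val_eq_mult val_eq_prod_sum val_eq_prod val_eq_powi var val_eq_inverse_epoch)
       (use val_eq_powi[OF val_eq_qvar] in simp)
  also have "0 + (\<Sum>j<n. (\<Sum>t\<in>A. t * int (lookup (f t) j)) * 1) + 0 = (\<Sum>t\<in>A. t * int (ht (f t)))"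
    unfolding ht sum_distrib_left by (simp add: sum.swap[of _ A])
  finally show ?thesis .
qed

text \<open>As \<open>N\<close> exceeds all elements of \<open>A\<close>, the minimum in a cross
  term is the smaller position \<open>t\<close>. Cross terms are therefore linear in the old family
  and are absorbed by replacing \<open>\<mu>\<close> with \<open>\<mu> - wt b\<close>.\<close>

lemma Bsum_insert:
  assumes A: "finite A" "N \<notin> A" "\<And>t. t \<in> A \<Longrightarrow> t < N"
  shows "Bsum \<mu> (insert N A) (f(N := b)) = Bsum (\<mu> - wt b) A f + N * Wexp \<mu> b"
proof -
  let ?f = "f(N := b)"
  define x where "x = (\<Sum>t\<in>A. \<Sum>t'\<in>A. min t t' * ip (wt (f t)) (wt (f t')))"
  define y where "y = (\<Sum>t\<in>A. t * ip (wt b) (wt (f t)))"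
  obtain z where z: "ip (wt b) (wt b) = 2 * z" using even_ip_wt by (metis evenE)
  have f: "?f t = f t" if "t \<in> A" for t using that A by auto
  have row: "(\<Sum>t'\<in>insert N A. min t t' * ip (wt (?f t)) (wt (?f t')))
      = t * ip (wt b) (wt (f t)) + (\<Sum>t'\<in>A. min t t' * ip (wt (f t)) (wt (f t')))" if "t \<in> A" for t
    using A f that A(3)[OF that] by (simp add: ip_commute[of "wt (f t)" "wt b"] cong: sum.cong)
  have top: "(\<Sum>t'\<in>insert N A. min N t' * ip (wt (?f N)) (wt (?f t'))) = N * ip (wt b) (wt b) + y"
  proof -
    have "min N t' * ip (wt (?f N)) (wt (?f t')) = t' * ip (wt b) (wt (f t'))" if "t' \<in> A" for t'
      using f[OF that] A(3)[OF that] by simp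
    then have "(\<Sum>t'\<in>A. min N t' * ip (wt (?f N)) (wt (?f t'))) = y"
      unfolding y_def by (rule sum.cong[OF refl])
    then show ?thesis using sum.insert[OF A(1,2), of "\<lambda>t'. min N t' * ip (wt (?f N)) (wt (?f t'))"] by simp
  qed
  have quad: "(\<Sum>t\<in>insert N A. \<Sum>t'\<in>insert N A. min t t' * ip (wt (?f t)) (wt (?f t')))
      = x + 2 * y + 2 * (N * z)"
  proof -
    have "(\<Sum>t\<in>insert N A. \<Sum>t'\<in>insert N A. min t t' * ip (wt (?f t)) (wt (?f t')))
        = (\<Sum>t'\<in>insert N A. min N t' * ip (wt (?f N)) (wt (?f t')))
          + (\<Sum>t\<in>A. \<Sum>t'\<in>insert N A. min t t' * ip (wt (?f t)) (wt (?f t')))"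
      by (rule sum.insert) (use A in auto)
    also have "(\<Sum>t\<in>A. \<Sum>t'\<in>insert N A. min t t' * ip (wt (?f t)) (wt (?f t'))) = y + x"
      unfolding x_def y_def sum.distrib[symmetric] by (rule sum.cong[OF refl row])
    finally show ?thesis unfolding top z by simp
  qed
  have lin: "(\<Sum>t\<in>insert N A. t * (ip \<mu> (wt (?f t)) + int (ht (?f t))))
      = (\<Sum>t\<in>A. t * (ip (\<mu> - wt b) (wt (f t)) + int (ht (f t)))) + y + N * (ip \<mu> (wt b) + int (ht b))"
  proof -
    have "t * (ip \<mu> (wt (?f t)) + int (ht (?f t)))
        = t * (ip (\<mu> - wt b) (wt (f t)) + int (ht (f t))) + t * ip (wt b) (wt (f t))" if "t \<in> A" for t
      using f[OF that] by (simp add: ip_diff_left algebra_simps)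
    then have "(\<Sum>t\<in>A. t * (ip \<mu> (wt (?f t)) + int (ht (?f t))))
        = (\<Sum>t\<in>A. t * (ip (\<mu> - wt b) (wt (f t)) + int (ht (f t)))) + y"
      unfolding y_def sum.distrib[symmetric] by (rule sum.cong[OF refl])
    then show ?thesis using A by simp
  qed
  \<comment> \<open>The new contributions are even and come out of the integer division.\<close>
  have "(x + 2 * y + 2 * (N * z)) div 2 = x div 2 + y + N * z" by simp
  then show ?thesis
    unfolding Bsum_def[of \<mu> "insert N A"] quad lin Bsum_def[of _ A] x_def[symmetric] Wexp_def z
    by (simp add: algebra_simps)
qed

text \<open>A last component at position \<open>N\<close> contributes an entry of
  \<open>twist N\<close> applied to a kernel \<open>Ek\<close>, and the remaining family starts from
  the lowered weight. This is one step of a product of kernels.\<close>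

lemma summand_append:
  assumes A: "finite A" "\<And>t. f t \<noteq> 0 \<Longrightarrow> t \<in> A" "\<And>t. t \<in> A \<Longrightarrow> t < N"
    and f: "\<And>t. keys (f t) \<subseteq> {..<n}" and b: "keys b \<subseteq> {..<n}"
  shows "summand n \<mu> (\<lambda>t. wt ((f(N := b)) t)) =
    summand n (\<mu> - wt b) (\<lambda>t. wt (f t)) * (tw \<mu> b powi N * inverse (epoch b))"
proof -
  have N: "N \<notin> A" using A(3) by blast
  have "summand n \<mu> (\<lambda>t. wt ((f(N := b)) t)) = qvar powi Bsum \<mu> (insert N A) (f(N := b)) *
    (\<Prod>j<n. var (Suc j) powi (\<Sum>t\<in>insert N A. t * int (lookup ((f(N := b)) t) j))) *
    (\<Prod>t\<in>insert N A. inverse (epoch ((f(N := b)) t)))"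
    by (rule summand_eq) (use A f b in \<open>auto split: if_splits\<close>)
  moreover have "(\<Prod>t\<in>insert N A. inverse (epoch ((f(N := b)) t)))
      = inverse (epoch b) * (\<Prod>t\<in>A. inverse (epoch (f t)))"
    using A(1) N by (simp, intro prod.cong) auto
  moreover have "(\<Prod>j<n. var (Suc j) powi (\<Sum>t\<in>insert N A. t * int (lookup ((f(N := b)) t) j)))
      = mon (zexp b) powi N * (\<Prod>j<n. var (Suc j) powi (\<Sum>t\<in>A. t * int (lookup (f t) j)))"
  proof -
    have pw: "x powi (N * int k) = (x ^ k) powi N" for x :: ratfun and k
      by (simp add: power_int_mult[of x "int k" N, simplified] mult.commute[of N])
    have "var (Suc j) powi (\<Sum>t\<in>insert N A. t * int (lookup ((f(N := b)) t) j))
        = (var (Suc j) ^ lookup b j) powi N * var (Suc j) powi (\<Sum>t\<in>A. t * int (lookup (f t) j))" for j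
    proof -
      have "(\<Sum>t\<in>A. t * int (lookup ((f(N := b)) t) j)) = (\<Sum>t\<in>A. t * int (lookup (f t) j))"
        using N by (intro sum.cong) auto
      then have "(\<Sum>t\<in>insert N A. t * int (lookup ((f(N := b)) t) j))
          = N * int (lookup b j) + (\<Sum>t\<in>A. t * int (lookup (f t) j))" using A(1) N by simp
      then show ?thesis by (simp only: power_int_add[OF disjI1[OF var_nonzero]] pw)
    qed
    moreover have "(\<Prod>j<n. (var (Suc j) ^ lookup b j) powi N) = (\<Prod>j<n. var (Suc j) ^ lookup b j) powi N"
      by (induction n) (simp_all add: power_int_mult_distrib)
    ultimately show ?thesis by (simp add: mon_zexp[OF b] prod.distrib)
  qed
  moreover have "tw \<mu> b powi N = qvar powi (N * Wexp \<mu> b) * mon (zexp b) powi N"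
    by (simp add: tw_def power_int_mult_distrib power_int_mult mult.commute[of N])
  ultimately show ?thesis
    using A f N by (subst summand_eq[of A f]) (auto simp: Bsum_insert qvar_powi_add mult_ac)
qed

subsection \<open>Families as products of kernels\<close>

text \<open>The product over \<open>s \<le> t < s + int k\<close> with \<open>t\<close> increasing
  to the right. The rightmost factor acts first, in accordance with
  \<open>summand_append\<close>.\<close>

primrec window :: "(int \<Rightarrow> nat) \<Rightarrow> int \<Rightarrow> nat \<Rightarrow> kern" where
  "window d s 0 = 1"
| "window d s (Suc k) = window d s k * twist (s + int k) (Ek (d (s + int k)))"

definition cfam :: "(int \<Rightarrow> nat) \<Rightarrow> int \<Rightarrow> nat \<Rightarrow> cvec \<Rightarrow> (int \<Rightarrow> cvec) set" where
  "cfam d s k c = {f. (\<forall>t. f t \<noteq> 0 \<longrightarrow> t \<in> {s..<s + int k}) \<and> (\<forall>t. keys (f t) \<subseteq> {..<d t}) \<and>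
     (\<Sum>t\<in>{s..<s + int k}. f t) = c}"

lemma cfam_0: "cfam d s 0 c = (if c = 0 then {\<lambda>_. 0} else {})"
  by (auto simp: cfam_def)

lemma ivl_Suc: "{s..<s + int (Suc k)} = insert (s + int k) {s..<s + int k}"
  by auto

text \<open>Families on the longer window correspond to a splitting of \<open>c\<close> into a last
  component \<open>b\<close> and the rest \<open>a\<close>, together with a family summing to
  \<open>a\<close> on the shorter window.\<close>

lemma kapp_window:
  assumes d: "\<And>t. d t \<le> n"
  shows "finite (cfam d s k c) \<and>
    kapp (window d s k) \<mu> c = (\<Sum>f\<in>cfam d s k c. summand n \<mu> (\<lambda>t. wt (f t)))"
proof (induction k arbitrary: c \<mu>)
  case 0
  show ?case by (simp add: cfam_0 kapp_simps summand_def B_def)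
next
  case (Suc k)
  let ?N = "s + int k"
  let ?P = "{p \<in> splits c. keys (snd p) \<subseteq> {..<d ?N}}"
  let ?T = "SIGMA p:?P. cfam d s k (fst p)"
  \<comment> \<open>\<open>?i\<close> installs the last component at \<open>?N\<close>, and
    \<open>?j\<close> removes it again.\<close>
  let ?i = "\<lambda>(p, f). f(?N := snd p)" and ?j = "\<lambda>g. ((c - g ?N, g ?N), g(?N := 0))"
  have fin: "finite ?T" using Suc by (intro finite_SigmaI) auto
  have fN: "f ?N = 0" if "f \<in> cfam d s k a" for f a using that by (fastforce simp: cfam_def)
  have i: "?i x \<in> cfam d s (Suc k) c" "?j (?i x) = x" if "x \<in> ?T" for x
  proof -
    obtain a b f where x: "x = ((a, b), f)" by (metis prod.exhaust)
    then have ab: "a + b = c" "keys b \<subseteq> {..<d ?N}" and f: "f \<in> cfam d s k a" using that by auto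
    have "(\<Sum>t\<in>{s..<?N}. (f(?N := b)) t) = (\<Sum>t\<in>{s..<?N}. f t)" by (rule sum.cong) auto
    then have "(\<Sum>t\<in>{s..<s + int (Suc k)}. (f(?N := b)) t) = b + a"
      using f unfolding ivl_Suc by (simp add: cfam_def)
    then have sum: "(\<Sum>t\<in>{s..<s + int (Suc k)}. (f(?N := b)) t) = c"
      using ab(1) by (simp only: add.commute)
    have "f(?N := b) \<in> cfam d s (Suc k) c"
      unfolding cfam_def mem_Collect_eq sum using f ab unfolding ivl_Suc by (auto simp: cfam_def)
    then show "?i x \<in> cfam d s (Suc k) c" using x by simp
    have "f(?N := 0) = f" using fN[OF f] by auto
    then show "?j (?i x) = x" using x ab(1) by auto
  qed
  have j: "?j g \<in> ?T" "?i (?j g) = g" if "g \<in> cfam d s (Suc k) c" for g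
  proof -
    have sum: "g ?N + (\<Sum>t\<in>{s..<?N}. g t) = c" and supp: "\<And>t. g t \<noteq> 0 \<Longrightarrow> t = ?N \<or> t \<in> {s..<?N}"
      and keys: "\<And>t. keys (g t) \<subseteq> {..<d t}"
      using that unfolding cfam_def ivl_Suc by auto
    have "(\<Sum>t\<in>{s..<?N}. (g(?N := 0)) t) = (\<Sum>t\<in>{s..<?N}. g t)" by (rule sum.cong) auto
    moreover have "(\<Sum>t\<in>{s..<?N}. g t) = c - g ?N" using sum by (metis add_diff_cancel_left')
    ultimately have "g(?N := 0) \<in> cfam d s k (c - g ?N)"
      using supp keys by (auto simp: cfam_def)
    moreover have "c - g ?N + g ?N = c" using sum by (metis add.commute add_diff_cancel_left')
    ultimately show "?j g \<in> ?T" using keys by auto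
    show "?i (?j g) = g" by simp
  qed
  have "cfam d s (Suc k) c \<subseteq> ?i ` ?T"
  proof
    fix g assume "g \<in> cfam d s (Suc k) c"
    then have "?i (?j g) = g" "?j g \<in> ?T" using j by blast+
    then show "g \<in> ?i ` ?T" by (metis (no_types, lifting) imageI)
  qed
  then have fin': "finite (cfam d s (Suc k) c)" using fin finite_surj by blast
  have "kapp (window d s (Suc k)) \<mu> c
      = (\<Sum>p\<in>splits c. kapp (window d s k) (\<mu> - wt (snd p)) (fst p) *
          (tw \<mu> (snd p) powi ?N * kapp (Ek (d ?N)) \<mu> (snd p)))"
    by (simp add: kapp_times kapp_twist case_prod_beta)
  also have "\<dots> = (\<Sum>p\<in>?P. kapp (window d s k) (\<mu> - wt (snd p)) (fst p) *
          (tw \<mu> (snd p) powi ?N * inverse (epoch (snd p))))"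
    by (rule sum.mono_neutral_cong_right) (auto simp: kapp_E)
  also have "\<dots> = (\<Sum>p\<in>?P. \<Sum>f\<in>cfam d s k (fst p). summand n (\<mu> - wt (snd p)) (\<lambda>t. wt (f t)) *
          (tw \<mu> (snd p) powi ?N * inverse (epoch (snd p))))"
    using Suc by (simp add: sum_distrib_right)
  also have "\<dots> = (\<Sum>(p, f)\<in>?T. summand n (\<mu> - wt (snd p)) (\<lambda>t. wt (f t)) *
          (tw \<mu> (snd p) powi ?N * inverse (epoch (snd p))))"
    using Suc by (subst sum.Sigma) auto
  also have "\<dots> = (\<Sum>g\<in>cfam d s (Suc k) c. summand n \<mu> (\<lambda>t. wt (g t)))"
  proof (rule sum.reindex_bij_witness[of _ ?j ?i])
    fix x assume x: "x \<in> ?T"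
    obtain a b f where x': "x = ((a, b), f)" by (metis prod.exhaust)
    then have f: "f \<in> cfam d s k a" and b: "keys b \<subseteq> {..<d ?N}" using x by auto
    have "summand n \<mu> (\<lambda>t. wt ((f(?N := b)) t)) =
        summand n (\<mu> - wt b) (\<lambda>t. wt (f t)) * (tw \<mu> b powi ?N * inverse (epoch b))"
    proof (rule summand_append[of "{s..<?N}"])
      show "keys (f t) \<subseteq> {..<n}" for t using f d[of t] by (fastforce simp: cfam_def)
      show "keys b \<subseteq> {..<n}" using b d[of ?N] by auto
    qed (use f in \<open>auto simp: cfam_def\<close>)
    then show "summand n \<mu> (\<lambda>t. wt (?i x t)) = (case x of (p, f) \<Rightarrow>
        summand n (\<mu> - wt (snd p)) (\<lambda>t. wt (f t)) * (tw \<mu> (snd p) powi ?N * inverse (epoch (snd p))))"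
      using x' by simp
  qed (use i j in blast)+
  finally show ?case using fin' by blast
qed

subsection \<open>Convergence for finite endpoints\<close>

lemma Qplus_eq: "Qplus m = wt ` {c. keys c \<subseteq> {..<m}}"
proof (intro equalityI subsetI)
  have shift: "(\<Sum>j=1..m. frag_cmul (int (c j)) (alpha j)) = (\<Sum>j<m. frag_cmul (int (c (Suc j))) (alpha (Suc j)))"
    for c :: "nat \<Rightarrow> nat"
  proof -
    have "(\<Sum>j=1..m. frag_cmul (int (c j)) (alpha j)) = (\<Sum>j\<in>Suc ` {..<m}. frag_cmul (int (c j)) (alpha j))"
      by (simp add: image_Suc_lessThan)
    then show ?thesis by (simp add: sum.reindex)
  qed
  {
    fix x assume "x \<in> Qplus m"
    then obtain c :: "nat \<Rightarrow> nat" where x: "x = (\<Sum>j=1..m. frag_cmul (int (c j)) (alpha j))"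
      unfolding Qplus_def by blast
    define c' where "c' = (\<Sum>j<m. single j (c (Suc j)))"
    have l: "lookup c' j = (if j < m then c (Suc j) else 0)" for j
    proof -
      have "lookup c' j = (\<Sum>i<m. if j = i then c (Suc i) else 0)"
        unfolding c'_def lookup_sum by (rule sum.cong) (auto simp: lookup_single when_def)
      then show ?thesis by simp
    qed
    then have "keys c' \<subseteq> {..<m}" by (auto simp: in_keys_iff split: if_splits)
    moreover from this have "wt c' = x" unfolding x shift by (subst wt_superset[of "{..<m}"]) (auto simp: l)
    ultimately show "x \<in> wt ` {c. keys c \<subseteq> {..<m}}" by blast
  next
    fix x assume "x \<in> wt ` {c. keys c \<subseteq> {..<m}}"
    then obtain c where c: "keys c \<subseteq> {..<m}" "x = wt c" by blast
    have "x = (\<Sum>j=1..m. frag_cmul (int (lookup c (j - 1))) (alpha j))"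
      unfolding c(2) shift by (simp add: wt_superset[OF _ c(1)])
    then show "x \<in> Qplus m" unfolding Qplus_def by (auto intro!: exI[of _ "\<lambda>j. lookup c (j - 1)"])
  }
qed

lemma Qplus_0: "Qplus 0 = {0}"
  by (auto simp: Qplus_def)

text \<open>Rank 0 below the first endpoint forces the family to vanish there, as
  \<open>Qplus 0\<close> is trivial. The maximum selects the nonempty block among several with equal
  endpoints.\<close>

definition rank :: "int list \<Rightarrow> nat list \<Rightarrow> int \<Rightarrow> nat" where
  "rank rs ds t = (if t < rs ! 0 then 0 else ds ! Max {k. k < length rs \<and> rs ! k \<le> t})"

lemma rank_block:
  assumes "sorted rs" "k < length rs" "rs ! k \<le> t" "Suc k < length rs \<longrightarrow> t < rs ! Suc k"
  shows "rank rs ds t = ds ! k"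
proof -
  let ?S = "{k. k < length rs \<and> rs ! k \<le> t}"
  have "rs ! 0 \<le> t" using sorted_nth_mono[OF assms(1), of 0 k] assms(2,3) by simp
  moreover have "Max ?S = k"
  proof (rule Max_eqI)
    fix l assume "l \<in> ?S"
    then have l: "l < length rs" "rs ! l \<le> t" by auto
    show "l \<le> k"
    proof (rule ccontr)
      assume "\<not> l \<le> k"
      then have "rs ! Suc k \<le> rs ! l" "Suc k < length rs"
        using sorted_nth_mono[OF assms(1), of "Suc k" l] l by auto
      then show False using assms(4) l by simp
    qed
  qed (use assms in auto)
  ultimately show ?thesis by (simp add: rank_def)
qed

lemma rank_exists:
  assumes "sorted rs" "rs \<noteq> []" "rs ! 0 \<le> t"
  obtains k where "k < length rs" "rs ! k \<le> t" "Suc k < length rs \<longrightarrow> t < rs ! Suc k"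
proof -
  let ?S = "{k. k < length rs \<and> rs ! k \<le> t}"
  have S: "finite ?S" "?S \<noteq> {}" using assms by (auto intro!: exI[of _ 0])
  have "Max ?S \<in> ?S" using Max_in[OF S] .
  moreover have "t < rs ! Suc (Max ?S)" if "Suc (Max ?S) < length rs"
  proof (rule ccontr)
    assume "\<not> t < rs ! Suc (Max ?S)"
    then have "Suc (Max ?S) \<in> ?S" using that by simp
    then show False using Max_ge[OF S(1)] by fastforce
  qed
  ultimately show thesis using that by blast
qed

lemma families_eq:
  assumes rs: "sorted rs" "rs \<noteq> []"
  shows "families rs ds (wt c) = (\<lambda>f t. wt (f t)) `
    {f. finite {t. f t \<noteq> 0} \<and> (\<Sum>t | f t \<noteq> 0. f t) = c \<and> (\<forall>t. keys (f t) \<subseteq> {..<rank rs ds t})}"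
    (is "_ = ?w ` ?C")
proof -
  have blocks: "((\<forall>t. t < rs ! 0 \<longrightarrow> \<gamma> t = 0) \<and>
     (\<forall>k < length rs. \<forall>t. rs ! k \<le> t \<and> (Suc k < length rs \<longrightarrow> t < rs ! Suc k)
        \<longrightarrow> \<gamma> t \<in> Qplus (ds ! k))) \<longleftrightarrow> (\<forall>t. \<gamma> t \<in> Qplus (rank rs ds t))" (is "?L = ?R") for \<gamma>
  proof
    assume L: ?L
    show ?R
    proof
      fix t
      show "\<gamma> t \<in> Qplus (rank rs ds t)"
      proof (cases "t < rs ! 0")
        case True
        then show ?thesis using L by (simp add: rank_def Qplus_0)
      next
        case False
        then have "rs ! 0 \<le> t" by simp
        then obtain k where k: "k < length rs" "rs ! k \<le> t" "Suc k < length rs \<longrightarrow> t < rs ! Suc k"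
          by (rule rank_exists[OF rs])
        then show ?thesis using L rank_block[OF rs(1) k] by simp
      qed
    qed
  next
    assume R: ?R
    show ?L
    proof (intro conjI allI impI)
      fix t assume "t < rs ! 0"
      then show "\<gamma> t = 0" using R[rule_format, of t] by (simp add: rank_def Qplus_0)
    next
      fix k t assume "k < length rs" "rs ! k \<le> t \<and> (Suc k < length rs \<longrightarrow> t < rs ! Suc k)"
      then show "\<gamma> t \<in> Qplus (ds ! k)" using R[rule_format, of t] rank_block[OF rs(1), of k t ds] by simp
    qed
  qed
  have "families rs ds (wt c) = {\<gamma>. finite {t. \<gamma> t \<noteq> 0} \<and> (\<Sum>t | \<gamma> t \<noteq> 0. \<gamma> t) = wt c \<and>
      (\<forall>t. \<gamma> t \<in> Qplus (rank rs ds t))}"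
    unfolding families_def using blocks by blast
  also have "\<dots> = ?w ` ?C"
  proof (intro equalityI subsetI)
    fix \<gamma> assume "\<gamma> \<in> {\<gamma>. finite {t. \<gamma> t \<noteq> 0} \<and> (\<Sum>t | \<gamma> t \<noteq> 0. \<gamma> t) = wt c \<and>
      (\<forall>t. \<gamma> t \<in> Qplus (rank rs ds t))}"
    then have \<gamma>: "finite {t. \<gamma> t \<noteq> 0}" "(\<Sum>t | \<gamma> t \<noteq> 0. \<gamma> t) = wt c"
      "\<forall>t. \<exists>c. \<gamma> t = wt c \<and> keys c \<subseteq> {..<rank rs ds t}" by (auto simp: Qplus_eq)
    then obtain f where f: "\<And>t. \<gamma> t = wt (f t)" "\<And>t. keys (f t) \<subseteq> {..<rank rs ds t}" by metis
    have "wt (\<Sum>t | f t \<noteq> 0. f t) = wt c" using \<gamma>(2) by (simp add: f wt_sum)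
    then have "f \<in> ?C" using f \<gamma> by (simp add: wt_eq_iff)
    then show "\<gamma> \<in> ?w ` ?C" using f(1) by (intro image_eqI[of _ _ f]) auto
  qed (auto simp: Qplus_eq wt_sum)
  finally show ?thesis .
qed

lemma val_ge_uniform:
  assumes "finite A"
  shows "\<exists>M. \<forall>x\<in>A. val_ge s M (f x)"
  using assms
proof induction
  case (insert x A)
  then obtain M where "\<forall>x\<in>A. val_ge s M (f x)" by blast
  moreover obtain M' where "val_ge s M' (f x)" using val_ge_exists by blast
  ultimately have "\<forall>y\<in>insert x A. val_ge s (min M M') (f y)" using val_ge_mono by fastforce
  then show ?case by blast
qed simp

text \<open>Adding \<open>\<bar>s\<bar>\<close> to all positions makes every term nonnegative and
  changes the sum by a multiple of the fixed height of \<open>c\<close>.\<close>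

lemma weighted_height_ge:
  assumes A: "finite A" "\<And>t. t \<in> A \<Longrightarrow> s \<le> t" and c: "(\<Sum>t\<in>A. f t) = c"
  shows "- \<bar>s\<bar> * int (ht c) \<le> (\<Sum>t\<in>A. t * int (ht (f t)))"
    and "t0 \<in> A \<Longrightarrow> f t0 \<noteq> 0 \<Longrightarrow> t0 - \<bar>s\<bar> * int (ht c) \<le> (\<Sum>t\<in>A. t * int (ht (f t)))"
proof -
  have "ht (\<Sum>t\<in>A. f t) = (\<Sum>t\<in>A. ht (f t))"
    by (induction A rule: infinite_finite_induct) (simp_all add: ht_add)
  then have eq: "(\<Sum>t\<in>A. t * int (ht (f t))) + \<bar>s\<bar> * int (ht c) = (\<Sum>t\<in>A. (t + \<bar>s\<bar>) * int (ht (f t)))"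
    using c by (simp add: sum.distrib sum_distrib_left algebra_simps)
  have pos: "0 \<le> (t + \<bar>s\<bar>) * int (ht (f t))" if "t \<in> A" for t using A(2)[OF that] by simp
  have "0 \<le> (\<Sum>t\<in>A. (t + \<bar>s\<bar>) * int (ht (f t)))" by (rule sum_nonneg) (rule pos)
  then show "- \<bar>s\<bar> * int (ht c) \<le> (\<Sum>t\<in>A. t * int (ht (f t)))" using eq by simp
  assume t0: "t0 \<in> A" "f t0 \<noteq> 0"
  then have "1 \<le> int (ht (f t0))" using ht_eq_0_iff[of "f t0"] by linarith
  then have "t0 + \<bar>s\<bar> \<le> (t0 + \<bar>s\<bar>) * int (ht (f t0))"
    using mult_left_mono[of 1 "int (ht (f t0))" "t0 + \<bar>s\<bar>"] A(2)[OF t0(1)] by simp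
  also have "\<dots> \<le> (\<Sum>t\<in>A. (t + \<bar>s\<bar>) * int (ht (f t)))"
    by (rule member_le_sum) (use pos t0 A in auto)
  finally show "t0 - \<bar>s\<bar> * int (ht c) \<le> (\<Sum>t\<in>A. t * int (ht (f t)))" using eq by simp
qed

lemma val_ge_window:
  assumes d: "\<And>t. d t \<le> n"
  shows "val_ge 1 (- \<bar>s\<bar> * int (ht c)) (kapp (window d s k) \<mu> c)"
  unfolding kapp_window[OF d, THEN conjunct2]
proof (rule val_ge_sum)
  fix f assume f: "f \<in> cfam d s k c"
  have "val_eq 1 (\<Sum>t\<in>{s..<s + int k}. t * int (ht (f t))) (summand n \<mu> (\<lambda>t. wt (f t)))"
  proof (rule val_eq_summand)
    show "keys (f t) \<subseteq> {..<n}" for t using f d[of t] by (fastforce simp: cfam_def)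
  qed (use f in \<open>auto simp: cfam_def\<close>)
  moreover have "- \<bar>s\<bar> * int (ht c) \<le> (\<Sum>t\<in>{s..<s + int k}. t * int (ht (f t)))"
    by (rule weighted_height_ge(1)) (use f in \<open>auto simp: cfam_def\<close>)
  ultimately show "val_ge 1 (- \<bar>s\<bar> * int (ht c)) (summand n \<mu> (\<lambda>t. wt (f t)))"
    by (rule val_eq_imp_val_ge)
qed

lemma val_ge_twist:
  assumes "val_ge s M (kapp K \<mu> c)"
  shows "val_ge s (s * r * int (ht c) + M) (kapp (twist r K) \<mu> c)"
proof -
  have "val_ge s (r * (s * int (ht c))) (tw \<mu> c powi r)"
    using val_eq_powi[OF val_eq_tw] by (rule val_eq_imp_val_ge) simp
  from val_ge_mult[OF this assms] show ?thesis by (simp add: kapp_twist mult_ac)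
qed

text \<open>In the product giving \<open>G\<close>, the term with trivial right part is the entry of
  the window. All others involve a nontrivial entry of \<open>twist (s + int k) K\<close>, whose
  order grows with \<open>k\<close>.\<close>

lemma val_ge_window_limit:
  assumes d: "\<And>t. d t \<le> n" and K: "unipotent K"
    and G: "\<And>k. k \<ge> k0 \<Longrightarrow> window d s k * twist (s + int k) K = G"
  shows "\<exists>k1. \<forall>k\<ge>k1. val_ge 1 V (kapp (window d s k) \<mu> c - kapp G \<mu> c)"
proof -
  obtain M where M: "\<And>p. p \<in> splits c \<Longrightarrow> val_ge 1 M (kapp K \<mu> (snd p))"
    using val_ge_uniform[OF finite_splits] by meson
  \<comment> \<open>This bound ensures \<open>k \<ge> k0\<close>, \<open>0 \<le> s + int k\<close>
    and that the growth in \<open>s + int k\<close> outweighs the lower bounds of both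
    factors.\<close>
  define k1 where "k1 = max k0 (nat (V - M + \<bar>s\<bar> * int (ht c) - s) + nat (- s))"
  have "val_ge 1 V (kapp (window d s k) \<mu> c - kapp G \<mu> c)" if k: "k \<ge> k1" for k
  proof -
    have "kapp G \<mu> c = (\<Sum>(a, b)\<in>splits c. kapp (window d s k) (\<mu> - wt b) a * kapp (twist (s + int k) K) \<mu> b)"
      using G[of k] k by (simp add: k1_def flip: kapp_times)
    also have "\<dots> = kapp (window d s k) \<mu> c + (\<Sum>p\<in>splits c - {(c, 0)}.
        kapp (window d s k) (\<mu> - wt (snd p)) (fst p) * kapp (twist (s + int k) K) \<mu> (snd p))"
      using sum.remove[of "splits c" "(c, 0)" "\<lambda>p. kapp (window d s k) (\<mu> - wt (snd p)) (fst p)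
          * kapp (twist (s + int k) K) \<mu> (snd p)"] K
      by (simp add: case_prod_beta kapp_twist unipotent_def)
    finally have "kapp (window d s k) \<mu> c - kapp G \<mu> c = - (\<Sum>p\<in>splits c - {(c, 0)}.
        kapp (window d s k) (\<mu> - wt (snd p)) (fst p) * kapp (twist (s + int k) K) \<mu> (snd p))" by simp
    moreover have "val_ge 1 V (kapp (window d s k) (\<mu> - wt (snd p)) (fst p) * kapp (twist (s + int k) K) \<mu> (snd p))"
      if p: "p \<in> splits c - {(c, 0)}" for p
    proof -
      obtain a b where ab: "p = (a, b)" "a + b = c" using p by (cases p) auto
      then have "b \<noteq> 0" using p by auto
      then have "ht b > 0" using ht_eq_0_iff[of b] by linarith
      moreover have "0 \<le> s + int k" using k unfolding k1_def by linarith
      ultimately have hb: "s + int k \<le> (s + int k) * int (ht b)"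
        using mult_left_mono[of 1 "int (ht b)" "s + int k"] by simp
      have ha: "\<bar>s\<bar> * int (ht a) \<le> \<bar>s\<bar> * int (ht c)"
        using ab(2) by (intro mult_left_mono) (auto simp: ht_add)
      have "val_ge 1 (- \<bar>s\<bar> * int (ht a) + (1 * (s + int k) * int (ht b) + M))
        (kapp (window d s k) (\<mu> - wt b) a * kapp (twist (s + int k) K) \<mu> b)"
        using M[of p] p ab by (intro val_ge_mult val_ge_window[OF d] val_ge_twist) auto
      moreover have "V \<le> - \<bar>s\<bar> * int (ht a) + (1 * (s + int k) * int (ht b) + M)"
      proof -
        have "V - M + \<bar>s\<bar> * int (ht c) - s \<le> int k" using k unfolding k1_def by linarith
        then show ?thesis using ha hb by simp
      qed
      ultimately show ?thesis unfolding ab(1) fst_conv snd_conv by (rule val_ge_mono)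
    qed
    ultimately show ?thesis by (simp only:) (intro val_ge_uminus val_ge_sum)
  qed
  then show ?thesis by blast
qed

text \<open>A finite set containing all families of a long window differs from that window only by
  families reaching far to the right, and the summands of these vanish to high order.\<close>

lemma val_tendsto_families:
  assumes rs: "sorted rs" "rs \<noteq> []" and d: "\<And>t. rank rs ds t \<le> n" and K: "unipotent K"
    and G: "\<And>k. k \<ge> k0 \<Longrightarrow> window (rank rs ds) (rs ! 0) k * twist (rs ! 0 + int k) K = G"
  shows "val_tendsto 1 (\<lambda>A. \<Sum>\<gamma>\<in>A. summand n \<mu> \<gamma>) (kapp G \<mu> c)
    (finite_subsets_at_top (families rs ds (wt c)))"
  unfolding val_tendsto_def
proof
  fix V
  let ?d = "rank rs ds" and ?s = "rs ! 0" and ?w = "\<lambda>(f :: int \<Rightarrow> cvec) t. wt (f t)"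
  obtain k1 where k1: "\<And>k. k \<ge> k1 \<Longrightarrow> val_ge 1 V (kapp (window ?d ?s k) \<mu> c - kapp G \<mu> c)"
    using val_ge_window_limit[of ?d, OF d K G] by meson
  \<comment> \<open>From \<open>k1\<close> on the window is close to \<open>G\<close>; the second
    bound makes every family outside the window negligible.\<close>
  define k where "k = max k1 (nat (V + \<bar>?s\<bar> * int (ht c) - ?s))"
  let ?fam = "?w ` cfam ?d ?s k c"
  have inj: "inj_on ?w S" for S by (auto simp: inj_on_def wt_eq_iff fun_eq_iff)
  have fin: "finite ?fam" using kapp_window[of ?d, OF d] by blast
  have cfam_sub: "f \<in> {f. finite {t. f t \<noteq> 0} \<and> (\<Sum>t | f t \<noteq> 0. f t) = c \<and> (\<forall>t. keys (f t) \<subseteq> {..<?d t})}"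
    if f: "f \<in> cfam ?d ?s k c" for f
  proof -
    have sub: "{t. f t \<noteq> 0} \<subseteq> {?s..<?s + int k}" using f by (auto simp: cfam_def)
    then have "(\<Sum>t | f t \<noteq> 0. f t) = (\<Sum>t\<in>{?s..<?s + int k}. f t)"
      by (intro sum.mono_neutral_left) auto
    then show ?thesis using f finite_subset[OF sub] by (simp add: cfam_def)
  qed
  have "val_ge 1 V ((\<Sum>\<gamma>\<in>A. summand n \<mu> \<gamma>) - kapp G \<mu> c)"
    if A: "finite A" "?fam \<subseteq> A" "A \<subseteq> families rs ds (wt c)" for A
  proof -
    have "(\<Sum>\<gamma>\<in>?fam. summand n \<mu> \<gamma>) = kapp (window ?d ?s k) \<mu> c"
      using kapp_window[of ?d, OF d, of "?s" k c \<mu>] by (simp add: sum.reindex[OF inj] comp_def)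
    then have "(\<Sum>\<gamma>\<in>A. summand n \<mu> \<gamma>) - kapp G \<mu> c
        = (\<Sum>\<gamma>\<in>A - ?fam. summand n \<mu> \<gamma>) + (kapp (window ?d ?s k) \<mu> c - kapp G \<mu> c)"
      using sum.subset_diff[OF A(2,1), of "summand n \<mu>"] by simp
    moreover have "val_ge 1 V (summand n \<mu> \<gamma>)" if \<gamma>: "\<gamma> \<in> A - ?fam" for \<gamma>
    proof -
      obtain f where f: "\<gamma> = ?w f" "finite {t. f t \<noteq> 0}" "(\<Sum>t | f t \<noteq> 0. f t) = c"
        "\<And>t. keys (f t) \<subseteq> {..<?d t}"
        using A(3) \<gamma> unfolding families_eq[OF rs] by blast
      let ?S = "{t. f t \<noteq> 0}"
      have ge: "?s \<le> t" if "t \<in> ?S" for t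
      proof (rule ccontr)
        assume "\<not> ?s \<le> t"
        then have "keys (f t) = {}" using f(4)[of t] by (simp add: rank_def)
        then show False using that keys_nonempty by blast
      qed
      have "\<exists>t0\<in>?S. ?s + int k \<le> t0"
      proof (rule ccontr)
        assume "\<not> (\<exists>t0\<in>?S. ?s + int k \<le> t0)"
        then have sub: "?S \<subseteq> {?s..<?s + int k}" using ge by force
        then have "(\<Sum>t\<in>{?s..<?s + int k}. f t) = c"
          unfolding f(3)[symmetric] by (intro sum.mono_neutral_right) auto
        then have "f \<in> cfam ?d ?s k c" using sub f(4) by (auto simp: cfam_def)
        then show False using \<gamma> f(1) by blast
      qed
      then obtain t0 where t0: "t0 \<in> ?S" "?s + int k \<le> t0" by blast
      have "t0 - \<bar>?s\<bar> * int (ht c) \<le> (\<Sum>t\<in>?S. t * int (ht (f t)))"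
        by (rule weighted_height_ge(2)) (use f ge t0 in auto)
      then have "V \<le> (\<Sum>t\<in>?S. t * int (ht (f t)))" using t0(2) by (simp add: k_def)
      moreover have "val_eq 1 (\<Sum>t\<in>?S. t * int (ht (f t))) (summand n \<mu> \<gamma>)"
        unfolding f(1)
      proof (rule val_eq_summand)
        show "keys (f t) \<subseteq> {..<n}" for t using f(4)[of t] d[of t] by auto
      qed (use f(2) in auto)
      ultimately show ?thesis by (intro val_eq_imp_val_ge)
    qed
    moreover have "val_ge 1 V (kapp (window ?d ?s k) \<mu> c - kapp G \<mu> c)"
      by (rule k1) (simp add: k_def)
    ultimately show ?thesis by (simp only:) (intro val_ge_add val_ge_sum)
  qed
  moreover have "?fam \<subseteq> families rs ds (wt c)"
    unfolding families_eq[OF rs] using cfam_sub by blast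
  ultimately show "\<forall>\<^sub>F A in finite_subsets_at_top (families rs ds (wt c)).
      val_ge 1 V ((\<Sum>\<gamma>\<in>A. summand n \<mu> \<gamma>) - kapp G \<mu> c)"
    unfolding eventually_finite_subsets_at_top using fin by blast
qed

section \<open>Telescoping over the blocks\<close>

lemma Jk_0: "Jk 0 = 1"
proof (rule kern_eqI)
  fix \<mu> and c :: cvec
  have "keys c \<noteq> {}" if "c \<noteq> 0" using keys_nonempty[OF that] .
  then show "kapp (Jk 0) \<mu> c = kapp 1 \<mu> c"
    using supportedD[OF supported_Jk, of c 0 \<mu>] by (auto simp: kapp_simps)
qed

lemma Fk_0: "Fk 0 m = Jk m"
  using Jk_F[of 0 m] by (simp add: Jk_0)

text \<open>At an infinite endpoint the value is the limit of \<open>twist r K\<close> for unipotent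
  \<open>K\<close>, as \<open>kconv_twist\<close> shows.\<close>

primrec gtw :: "int extended \<Rightarrow> kern \<Rightarrow> kern" where
  "gtw (Fin r) K = twist r K"
| "gtw Pinf K = 1"
| "gtw Minf K = 1"

text \<open>The first block has no predecessor; rank 0 takes its place, since
  \<open>Jk 0 = 1\<close>.\<close>

definition block :: "nat list \<Rightarrow> nat \<Rightarrow> kern" where
  "block ds i = Fk (if i = 0 then 0 else ds ! (i - 1)) (ds ! i)"

definition Jprod :: "int extended list \<Rightarrow> nat list \<Rightarrow> kern" where
  "Jprod rs ds = prod_list (map (\<lambda>i. gtw (rs ! i) (block ds i)) [0..<length rs])"

text \<open>By \<open>E_twist_Jk\<close> each factor of the window with rank \<open>m\<close> is
  absorbed by the twisted \<open>Jk m\<close> to its right.\<close>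

lemma window_twist_Jk:
  assumes "s \<le> a" "a \<le> b" and d: "\<And>t. a \<le> t \<Longrightarrow> t < b \<Longrightarrow> d t = m"
  shows "window d s (nat (b - s)) * twist b (Jk m) = window d s (nat (a - s)) * twist a (Jk m)"
  using assms(2) d
proof (induction b rule: int_ge_induct)
  case (step b)
  have "nat (b + 1 - s) = Suc (nat (b - s))" using step assms(1) by simp
  moreover have "s + int (nat (b - s)) = b" using step assms(1) by simp
  moreover have "d b = m" using step by simp
  ultimately have "window d s (nat (b + 1 - s)) * twist (b + 1) (Jk m)
      = window d s (nat (b - s)) * twist b (Ek m * twist 1 (Jk m))"
    by (simp add: twist_mult twist_twist mult.assoc)
  also have "\<dots> = window d s (nat (a - s)) * twist a (Jk m)"
    using step by (simp add: E_twist_Jk)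
  finally show ?case .
qed simp

text \<open>Absorb the last block down to its left endpoint; there \<open>Jk\<close> of the new rank
  is \<open>Jk\<close> of the previous rank times a quotient \<open>Fk\<close>. The quotient stays
  as a factor, and the previous block is treated in the same way.\<close>

lemma window_Jprod:
  assumes rs: "sorted rs" and i: "i < length rs"
    and N: "rs ! i \<le> N" "Suc i < length rs \<Longrightarrow> N \<le> rs ! Suc i"
  shows "window (rank rs ds) (rs ! 0) (nat (N - rs ! 0)) * twist N (Jk (ds ! i))
    = prod_list (map (\<lambda>i. twist (rs ! i) (block ds i)) [0..<Suc i])"
  using i N
proof (induction i arbitrary: N)
  case 0
  have "window (rank rs ds) (rs ! 0) (nat (N - rs ! 0)) * twist N (Jk (ds ! 0))
      = window (rank rs ds) (rs ! 0) (nat (rs ! 0 - rs ! 0)) * twist (rs ! 0) (Jk (ds ! 0))"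
  proof (rule window_twist_Jk)
    show "rs ! 0 \<le> N" using 0(2) .
    show "rank rs ds t = ds ! 0" if "rs ! 0 \<le> t" "t < N" for t
      using rank_block[OF rs 0(1), of t] that 0(3) by fastforce
  qed simp
  then show ?case by (simp add: block_def Fk_0)
next
  case (Suc i)
  let ?d = "rank rs ds" and ?s = "rs ! 0" and ?r = "rs ! Suc i"
  have "?s \<le> ?r" using sorted_nth_mono[OF rs, of 0 "Suc i"] Suc(2) by simp
  then have "window ?d ?s (nat (N - ?s)) * twist N (Jk (ds ! Suc i))
      = window ?d ?s (nat (?r - ?s)) * twist ?r (Jk (ds ! Suc i))"
  proof (rule window_twist_Jk)
    show "?r \<le> N" using Suc(3) .
    show "?d t = ds ! Suc i" if "?r \<le> t" "t < N" for t
      using rank_block[OF rs Suc(2), of t] that Suc(4) by fastforce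
  qed
  also have "\<dots> = (window ?d ?s (nat (?r - ?s)) * twist ?r (Jk (ds ! i))) * twist ?r (block ds (Suc i))"
    by (simp add: block_def mult.assoc Jk_F flip: twist_mult)
  also have "window ?d ?s (nat (?r - ?s)) * twist ?r (Jk (ds ! i))
      = prod_list (map (\<lambda>i. twist (rs ! i) (block ds i)) [0..<Suc i])"
    using sorted_nth_mono[OF rs, of i "Suc i"] Suc(2) by (intro Suc(1)) auto
  finally show ?case by (simp add: mult.assoc)
qed

lemma J_fin_eq:
  assumes rs: "sorted rs" "rs \<noteq> []" and ds: "length ds = length rs" "\<And>d. d \<in> set ds \<Longrightarrow> d \<le> n"
  shows "J_fin n rs ds \<mu> (wt c) = kapp (Jprod (map Fin rs) ds) \<mu> c"
proof -
  let ?l = "length rs - 1"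
  have l: "?l < length rs" using rs by simp
  have "rank rs ds t \<le> n" for t
  proof (cases "t < rs ! 0")
    case False
    then have "rs ! 0 \<le> t" by simp
    then obtain k where k: "k < length rs" "rs ! k \<le> t" "Suc k < length rs \<longrightarrow> t < rs ! Suc k"
      by (rule rank_exists[OF rs])
    have "rank rs ds t = ds ! k" by (rule rank_block[OF rs(1)]) (fact k)+
    moreover have "ds ! k \<in> set ds" using k(1) ds(1) by simp
    ultimately show ?thesis using ds(2) by simp
  qed (simp add: rank_def)
  \<comment> \<open>Beyond the last endpoint the corrected window no longer depends on
    \<open>k\<close>.\<close>
  moreover have "window (rank rs ds) (rs ! 0) k * twist (rs ! 0 + int k) (Jk (ds ! ?l)) = Jprod (map Fin rs) ds"
    if "k \<ge> nat (rs ! ?l - rs ! 0)" for k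
  proof -
    have len: "Suc ?l = length rs" using l by simp
    have "window (rank rs ds) (rs ! 0) (nat (rs ! 0 + int k - rs ! 0)) * twist (rs ! 0 + int k) (Jk (ds ! ?l))
        = prod_list (map (\<lambda>i. twist (rs ! i) (block ds i)) [0..<Suc ?l])"
      by (rule window_Jprod[OF rs(1) l]) (use that len in auto)
    also have "\<dots> = Jprod (map Fin rs) ds"
      unfolding len Jprod_def length_map
      by (intro arg_cong[where f = prod_list] map_cong) auto
    finally show ?thesis by simp
  qed
  ultimately have "val_tendsto 1 (\<lambda>A. \<Sum>\<gamma>\<in>A. summand n \<mu> \<gamma>) (kapp (Jprod (map Fin rs) ds) \<mu> c)
    (finite_subsets_at_top (families rs ds (wt c)))"
    by (intro val_tendsto_families[OF rs]) auto
  then show ?thesis unfolding J_fin_def by (intro val_lim_eqI finite_subsets_at_top_neq_bot)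
qed

subsection \<open>Infinite endpoints\<close>

definition kconv :: "int \<Rightarrow> ('a \<Rightarrow> kern) \<Rightarrow> kern \<Rightarrow> 'a filter \<Rightarrow> bool" where
  "kconv s U K F \<longleftrightarrow> (\<forall>\<mu> c. val_tendsto s (\<lambda>x. kapp (U x) \<mu> c) (kapp K \<mu> c) F)"

lemma kconv_mult:
  assumes "kconv s U K F" "kconv s V L F"
  shows "kconv s (\<lambda>x. U x * V x) (K * L) F"
  using assms unfolding kconv_def kapp_times case_prod_beta
  by (intro allI val_tendsto_sum val_tendsto_mult) auto

lemma kconv_const [simp]: "kconv s (\<lambda>_. K) K F"
  by (simp add: kconv_def)

lemma kconv_prod_list:
  "(\<And>i. i \<in> set is \<Longrightarrow> kconv s (\<lambda>x. U x i) (K i) F) \<Longrightarrow>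
    kconv s (\<lambda>x. prod_list (map (U x) is)) (prod_list (map K is)) F"
  by (induction "is") (auto intro: kconv_mult)

lemma kconv_cong:
  assumes "eventually (\<lambda>x. U x = V x) F" "kconv s U K F"
  shows "kconv s V K F"
  unfolding kconv_def
proof (intro allI)
  fix \<mu> c
  show "val_tendsto s (\<lambda>x. kapp (V x) \<mu> c) (kapp K \<mu> c) F"
  proof (rule val_tendsto_cong)
    show "eventually (\<lambda>x. kapp (U x) \<mu> c = kapp (V x) \<mu> c) F"
      using assms(1) by eventually_elim simp
  qed (use assms(2) in \<open>simp add: kconv_def\<close>)
qed

text \<open>The diagonal is fixed by the twist, while the entry at \<open>c \<noteq> 0\<close> has
  order at least \<open>s * r x * int (ht c)\<close> plus a constant.\<close>

lemma kconv_twist: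
  assumes K: "unipotent K" and r: "\<And>T. eventually (\<lambda>x. T \<le> s * r x) F"
  shows "kconv s (\<lambda>x. twist (r x) K) 1 F"
  unfolding kconv_def val_tendsto_def
proof (intro allI)
  fix \<mu> c V
  obtain M where M: "val_ge s M (kapp K \<mu> c)" using val_ge_exists by blast
  show "eventually (\<lambda>x. val_ge s V (kapp (twist (r x) K) \<mu> c - kapp 1 \<mu> c)) F"
  proof (cases "c = 0")
    case True
    then show ?thesis using K by (simp add: kapp_twist kapp_simps unipotent_def)
  next
    case False
    then have ht: "1 \<le> int (ht c)" using ht_eq_0_iff[of c] by linarith
    show ?thesis using r[of "max 0 (V - M)"]
    proof eventually_elim
      case (elim x)
      have "s * r x \<le> s * r x * int (ht c)" using mult_left_mono[OF ht, of "s * r x"] elim by simp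
      then show ?case
        using val_ge_mono[OF val_ge_twist[where r = "r x", OF M], of V] elim False by (simp add: kapp_simps)
    qed
  qed
qed

lemma eventually_INF_principal:
  assumes "\<And>a b :: 'i. \<exists>x. A x \<subseteq> A a \<inter> A b"
  shows "eventually R (INF T. principal (A T)) \<longleftrightarrow> (\<exists>T. \<forall>x\<in>A T. R x)"
proof -
  have "\<exists>x\<in>UNIV. principal (A x) \<le> inf (principal (A a)) (principal (A b))" for a b
    using assms[of a b] by (simp add: le_infI)
  then show ?thesis by (subst eventually_INF_base) (auto simp: eventually_principal)
qed

lemma INF_principal_neq_bot:
  assumes "\<And>a b :: 'i. \<exists>x. A x \<subseteq> A a \<inter> A b" "\<And>T. A T \<noteq> {}"
  shows "(INF T. principal (A T)) \<noteq> bot"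
  using assms(2) by (subst trivial_limit_def, subst eventually_INF_principal[OF assms(1)]) blast

lemma unipotent_block [simp]: "unipotent (block ds i)"
  by (simp add: block_def)

definition pinf_approx :: "int extended list \<Rightarrow> int \<Rightarrow> int list set" where
  "pinf_approx rs T = {as. sorted as \<and> list_all2 (\<lambda>r a. r = Fin a \<or> r = Pinf \<and> T \<le> a) rs as}"

lemma pinf_approx_directed: "\<exists>x. pinf_approx rs x \<subseteq> pinf_approx rs a \<inter> pinf_approx rs b"
  by (rule exI[of _ "max a b"]) (auto simp: pinf_approx_def elim!: list_all2_mono)

lemma sorted_map_mono:
  assumes "sorted xs" "\<And>x y. x \<in> set xs \<Longrightarrow> y \<in> set xs \<Longrightarrow> x \<le> y \<Longrightarrow> f x \<le> f y"
  shows "sorted (map f xs)"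
  using assms by (auto simp: sorted_map intro: sorted_wrt_mono_rel[rotated])

lemma pinf_approx_nonempty:
  assumes "sorted rs" "Minf \<notin> set rs"
  shows "pinf_approx rs T \<noteq> {}"
proof -
  \<comment> \<open>A common value for all infinite endpoints must be at least \<open>T\<close> and
    must not fall below any finite endpoint.\<close>
  define M where "M = Max (insert T ((\<lambda>r. case r of Fin a \<Rightarrow> a | _ \<Rightarrow> T) ` set rs))"
  define f where "f r = (case r of Fin a \<Rightarrow> a | _ \<Rightarrow> M)" for r
  have M: "T \<le> M" "\<And>a. Fin a \<in> set rs \<Longrightarrow> a \<le> M"
    unfolding M_def by (force intro!: Max_ge)+
  have "sorted (map f rs)"
  proof (rule sorted_map_mono[OF assms(1)])
    fix x y assume xy: "x \<in> set rs" "y \<in> set rs" "x \<le> y"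
    show "f x \<le> f y" by (cases x; cases y) (use xy assms(2) M in \<open>auto simp: f_def\<close>)
  qed
  moreover have "list_all2 (\<lambda>r a. r = Fin a \<or> r = Pinf \<and> T \<le> a) rs (map f rs)"
    unfolding list_all2_map2
  proof (rule list.rel_refl_strong)
    fix r assume r: "r \<in> set rs"
    show "r = Fin (f r) \<or> r = Pinf \<and> T \<le> f r"
      by (cases r) (use r assms(2) M in \<open>auto simp: f_def\<close>)
  qed
  ultimately show ?thesis by (auto simp: pinf_approx_def)
qed

text \<open>Finite endpoints are the same in all approximating lists, and an endpoint tending to
  infinity sends its factor to 1 for small Z. The product of limits is the limit of the
  product.\<close>

lemma J_pinf_eq:
  assumes rs: "sorted rs" "rs \<noteq> []" "Minf \<notin> set rs"
    and ds: "length ds = length rs" "\<And>d. d \<in> set ds \<Longrightarrow> d \<le> n"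
  shows "J_pinf n rs ds \<mu> (wt c) = kapp (Jprod rs ds) \<mu> c"
proof -
  let ?F = "INF T. principal (pinf_approx rs T)"
  note ev = eventually_INF_principal[of "pinf_approx rs", OF pinf_approx_directed]
  have mem: "length as = length rs" "sorted as" "i < length rs \<Longrightarrow> rs ! i = Fin (as ! i) \<or> rs ! i = Pinf \<and> T \<le> as ! i"
    if "as \<in> pinf_approx rs T" for as T i
    using that by (auto simp: pinf_approx_def list_all2_conv_all_nth)
  have "kconv 1 (\<lambda>as. prod_list (map (\<lambda>i. twist (as ! i) (block ds i)) [0..<length rs])) (Jprod rs ds) ?F"
    unfolding Jprod_def
  proof (rule kconv_prod_list)
    fix i assume "i \<in> set [0..<length rs]"
    then have i: "i < length rs" by simp
    show "kconv 1 (\<lambda>as. twist (as ! i) (block ds i)) (gtw (rs ! i) (block ds i)) ?F"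
    proof (cases "rs ! i")
      case (Fin a)
      have "as ! i = a" if "as \<in> pinf_approx rs T" for as T using mem(3)[OF that i] Fin by simp
      then have "eventually (\<lambda>as. twist a (block ds i) = twist (as ! i) (block ds i)) ?F"
        unfolding ev by auto
      from kconv_cong[OF this kconv_const] show ?thesis by (simp add: Fin)
    next
      case Pinf
      have "T \<le> as ! i" if "as \<in> pinf_approx rs T" for as T using mem(3)[OF that i] Pinf by simp
      then have "eventually (\<lambda>as. T \<le> 1 * as ! i) ?F" for T unfolding ev by auto
      then show ?thesis using Pinf by (simp add: kconv_twist)
    next
      case Minf
      then show ?thesis using rs(3) i by (metis nth_mem)
    qed
  qed
  then have "val_tendsto 1 (\<lambda>as. kapp (prod_list (map (\<lambda>i. twist (as ! i) (block ds i)) [0..<length rs])) \<mu> c)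
      (kapp (Jprod rs ds) \<mu> c) ?F" by (simp add: kconv_def)
  moreover have "kapp (prod_list (map (\<lambda>i. twist (as ! i) (block ds i)) [0..<length rs])) \<mu> c
      = J_fin n as ds \<mu> (wt c)" if "as \<in> pinf_approx rs T" for as T
  proof -
    have "as \<noteq> []" using mem(1)[OF that] rs(2) by auto
    then have "J_fin n as ds \<mu> (wt c) = kapp (Jprod (map Fin as) ds) \<mu> c"
      using mem(1,2)[OF that] ds by (intro J_fin_eq) auto
    also have "Jprod (map Fin as) ds = prod_list (map (\<lambda>i. twist (as ! i) (block ds i)) [0..<length rs])"
      unfolding Jprod_def length_map mem(1)[OF that]
      by (intro arg_cong[where f = prod_list] map_cong) (use mem(1)[OF that] in auto)
    finally show ?thesis by simp
  qed
  then have "eventually (\<lambda>as. kapp (prod_list (map (\<lambda>i. twist (as ! i) (block ds i)) [0..<length rs])) \<mu> c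
      = J_fin n as ds \<mu> (wt c)) ?F" unfolding ev by blast
  ultimately have "val_tendsto 1 (\<lambda>as. J_fin n as ds \<mu> (wt c)) (kapp (Jprod rs ds) \<mu> c) ?F"
    by (rule val_tendsto_cong[rotated])
  moreover have "?F \<noteq> bot"
    by (intro INF_principal_neq_bot pinf_approx_directed pinf_approx_nonempty rs)
  ultimately show ?thesis
    unfolding J_pinf_def pinf_approx_def by (intro val_lim_eqI)
qed

definition minf_approx :: "int extended list \<Rightarrow> int \<Rightarrow> int extended list set" where
  "minf_approx rs T = {as. sorted as \<and>
     list_all2 (\<lambda>r a. if r = Minf then \<exists>b\<le>T. a = Fin b else a = r) rs as}"

lemma minf_approx_directed: "\<exists>x. minf_approx rs x \<subseteq> minf_approx rs a \<inter> minf_approx rs b"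
proof (intro exI subsetI)
  fix as assume as: "as \<in> minf_approx rs (min a b)"
  have "as \<in> minf_approx rs T" if "min a b \<le> T" for T
    using as that by (force simp: minf_approx_def elim!: list_all2_mono split: if_splits)
  then show "as \<in> minf_approx rs a \<inter> minf_approx rs b" by simp
qed

lemma minf_approx_nonempty:
  assumes "sorted rs"
  shows "minf_approx rs T \<noteq> {}"
proof -
  \<comment> \<open>The replacement for \<open>Minf\<close> must be at most \<open>T\<close> and
    must not exceed any finite endpoint.\<close>
  define M where "M = Min (insert T ((\<lambda>r. case r of Fin a \<Rightarrow> a | _ \<Rightarrow> T) ` set rs))"
  define f where "f r = (if r = Minf then Fin M else r)" for r
  have M: "M \<le> T" "\<And>a. Fin a \<in> set rs \<Longrightarrow> M \<le> a"
    unfolding M_def by (force intro!: Min_le)+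
  have "sorted (map f rs)"
  proof (rule sorted_map_mono[OF assms])
    fix x y assume xy: "x \<in> set rs" "y \<in> set rs" "x \<le> y"
    show "f x \<le> f y" by (cases x; cases y) (use xy M in \<open>auto simp: f_def\<close>)
  qed
  moreover have "list_all2 (\<lambda>r a. if r = Minf then \<exists>b\<le>T. a = Fin b else a = r) rs (map f rs)"
    unfolding list_all2_map2 by (rule list.rel_refl_strong) (use M in \<open>auto simp: f_def\<close>)
  ultimately have "map f rs \<in> minf_approx rs T" by (simp only: minf_approx_def mem_Collect_eq)
  then show ?thesis by blast
qed

text \<open>An endpoint tending to minus infinity sends its factor to 1 for large Z, where negative
  powers of the Z are small; all other factors stay constant.\<close>

lemma J_eq:
  assumes rs: "sorted rs" "rs \<noteq> []"
    and ds: "length ds = length rs" "\<And>d. d \<in> set ds \<Longrightarrow> d \<le> n"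
  shows "J n rs ds \<mu> (wt c) = kapp (Jprod rs ds) \<mu> c"
proof -
  let ?F = "INF T. principal (minf_approx rs T)"
  note ev = eventually_INF_principal[of "minf_approx rs", OF minf_approx_directed]
  have mem: "length as = length rs" "sorted as"
    "i < length rs \<Longrightarrow> if rs ! i = Minf then \<exists>b\<le>T. as ! i = Fin b else as ! i = rs ! i"
    if "as \<in> minf_approx rs T" for as T i
    using that by (auto simp: minf_approx_def list_all2_conv_all_nth)
  have "kconv (- 1) (\<lambda>as. prod_list (map (\<lambda>i. gtw (as ! i) (block ds i)) [0..<length rs])) (Jprod rs ds) ?F"
    unfolding Jprod_def
  proof (rule kconv_prod_list)
    fix i assume "i \<in> set [0..<length rs]"
    then have i: "i < length rs" by simp
    show "kconv (- 1) (\<lambda>as. gtw (as ! i) (block ds i)) (gtw (rs ! i) (block ds i)) ?F"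
    proof (cases "rs ! i = Minf")
      case False
      have "as ! i = rs ! i" if "as \<in> minf_approx rs T" for as T using mem(3)[OF that i] False by simp
      then have "eventually (\<lambda>as. gtw (rs ! i) (block ds i) = gtw (as ! i) (block ds i)) ?F"
        unfolding ev by auto
      from kconv_cong[OF this kconv_const] show ?thesis .
    next
      case True
      \<comment> \<open>Approximations to \<open>Minf\<close> are always finite, so the default 0 is
        never met.\<close>
      define b where "b as = (case as ! i of Fin b \<Rightarrow> b | _ \<Rightarrow> 0)" for as :: "int extended list"
      have b: "as ! i = Fin (b as)" "b as \<le> T" if "as \<in> minf_approx rs T" for as T
        using mem(3)[OF that i] True by (auto simp: b_def)
      have "T \<le> - 1 * b as" if "as \<in> minf_approx rs (- T)" for as T
        using b(2)[OF that] by simp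
      then have "eventually (\<lambda>as. T \<le> - 1 * b as) ?F" for T unfolding ev by blast
      then have "kconv (- 1) (\<lambda>as. twist (b as) (block ds i)) 1 ?F" by (intro kconv_twist) auto
      moreover have "eventually (\<lambda>as. twist (b as) (block ds i) = gtw (as ! i) (block ds i)) ?F"
        unfolding ev using b(1) by (metis gtw.simps(1))
      ultimately show ?thesis using True by (auto intro: kconv_cong)
    qed
  qed
  then have "val_tendsto (- 1) (\<lambda>as. kapp (prod_list (map (\<lambda>i. gtw (as ! i) (block ds i)) [0..<length rs])) \<mu> c)
      (kapp (Jprod rs ds) \<mu> c) ?F" by (simp add: kconv_def)
  moreover have "kapp (prod_list (map (\<lambda>i. gtw (as ! i) (block ds i)) [0..<length rs])) \<mu> c
      = J_pinf n as ds \<mu> (wt c)" if as: "as \<in> minf_approx rs T" for as T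
  proof -
    have "as \<noteq> []" using mem(1)[OF as] rs(2) by auto
    moreover have "Minf \<notin> set as"
    proof
      assume "Minf \<in> set as"
      then obtain i where "i < length as" "as ! i = Minf" by (auto simp: in_set_conv_nth)
      then show False using mem(3)[OF as, of i] mem(1)[OF as] by (auto split: if_splits)
    qed
    ultimately have "J_pinf n as ds \<mu> (wt c) = kapp (Jprod as ds) \<mu> c"
      using mem(1,2)[OF as] ds by (intro J_pinf_eq) auto
    then show ?thesis unfolding Jprod_def mem(1)[OF as] by simp
  qed
  then have "eventually (\<lambda>as. kapp (prod_list (map (\<lambda>i. gtw (as ! i) (block ds i)) [0..<length rs])) \<mu> c
      = J_pinf n as ds \<mu> (wt c)) ?F" unfolding ev by blast
  ultimately have "val_tendsto (- 1) (\<lambda>as. J_pinf n as ds \<mu> (wt c)) (kapp (Jprod rs ds) \<mu> c) ?F"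
    by (rule val_tendsto_cong[rotated])
  moreover have "?F \<noteq> bot"
    by (intro INF_principal_neq_bot minf_approx_directed minf_approx_nonempty rs)
  ultimately show ?thesis
    unfolding J_def minf_approx_def by (intro val_lim_eqI)
qed

subsection \<open>The decomposition\<close>

definition tuples :: "nat \<Rightarrow> cvec \<Rightarrow> (nat \<Rightarrow> cvec) set" where
  "tuples m c = {h \<in> (\<Pi>\<^sub>E i\<in>{1..m}. UNIV). (\<Sum>i=1..m. h i) = c}"

text \<open>Factors further to the right act earlier, so the factor with index \<open>i\<close>
  starts from \<open>\<mu>\<close> lowered by all later components. This matches the descending
  definition of the weights \<open>lam_at\<close>.\<close>

lemma kapp_prod_list:
  "finite (tuples m c) \<and> kapp (prod_list (map K [1..<Suc m])) \<mu> c =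
    (\<Sum>h\<in>tuples m c. \<Prod>i=1..m. kapp (K i) (\<mu> - (\<Sum>j\<in>{i<..m}. wt (h j))) (h i))"
proof (induction m arbitrary: c \<mu>)
  case 0
  have "tuples 0 c = (if c = 0 then {\<lambda>_. undefined} else {})" by (auto simp: tuples_def)
  then show ?case by (simp add: kapp_simps)
next
  case (Suc m)
  let ?N = "Suc m"
  let ?T = "SIGMA p:splits c. tuples m (fst p)"
  \<comment> \<open>Resetting the last component to \<open>undefined\<close> keeps the shortened
    tuple extensional on \<open>{1..m}\<close>.\<close>
  let ?i = "\<lambda>(p, h). h(?N := snd p)" and ?j = "\<lambda>g. ((c - g ?N, g ?N), g(?N := undefined))"
  let ?t = "\<lambda>m \<mu> h. \<Prod>i=1..m. kapp (K i) (\<mu> - (\<Sum>j\<in>{i<..m}. wt (h j))) (h i)"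
  have fin: "finite ?T" using Suc by (intro finite_SigmaI) auto
  have ivl: "{1..Suc m} = insert ?N {1..m}" by auto
  have i: "?i x \<in> tuples (Suc m) c" "?j (?i x) = x" if "x \<in> ?T" for x
  proof -
    obtain a b h where x: "x = ((a, b), h)" by (metis prod.exhaust)
    then have ab: "a + b = c" and h: "h \<in> tuples m a" using that by auto
    have "(\<Sum>i\<in>{1..m}. (h(?N := b)) i) = (\<Sum>i\<in>{1..m}. h i)" by (rule sum.cong) auto
    then have "(\<Sum>i\<in>{1..Suc m}. (h(?N := b)) i) = b + a"
      using h unfolding ivl by (simp add: tuples_def)
    then have sum: "(\<Sum>i\<in>{1..Suc m}. (h(?N := b)) i) = c"
      using ab(1) by (simp only: add.commute)
    have "h(?N := b) \<in> tuples (Suc m) c"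
      unfolding tuples_def mem_Collect_eq sum using h unfolding ivl
      by (auto simp: tuples_def PiE_def extensional_def)
    then show "?i x \<in> tuples (Suc m) c" using x by simp
    have "h ?N = undefined" using h by (auto simp: tuples_def PiE_def extensional_def)
    then have "h(?N := undefined) = h" by auto
    then show "?j (?i x) = x" using x ab(1) by auto
  qed
  have j: "?j g \<in> ?T" "?i (?j g) = g" if "g \<in> tuples (Suc m) c" for g
  proof -
    have sum: "g ?N + (\<Sum>i\<in>{1..m}. g i) = c" and ext: "g \<in> extensional {1..Suc m}"
      using that unfolding tuples_def ivl by (auto simp: PiE_def)
    have "(\<Sum>i\<in>{1..m}. (g(?N := undefined)) i) = (\<Sum>i\<in>{1..m}. g i)" by (rule sum.cong) auto
    moreover have "(\<Sum>i\<in>{1..m}. g i) = c - g ?N" using sum by (metis add_diff_cancel_left')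
    ultimately have "g(?N := undefined) \<in> tuples m (c - g ?N)"
      using ext by (auto simp: tuples_def PiE_def extensional_def)
    moreover have "c - g ?N + g ?N = c" using sum by (metis add.commute add_diff_cancel_left')
    ultimately show "?j g \<in> ?T" by auto
    show "?i (?j g) = g" by simp
  qed
  have "tuples (Suc m) c \<subseteq> ?i ` ?T"
  proof
    fix g assume "g \<in> tuples (Suc m) c"
    then have "?i (?j g) = g" "?j g \<in> ?T" using j by blast+
    then show "g \<in> ?i ` ?T" by (metis (no_types, lifting) imageI)
  qed
  then have fin': "finite (tuples (Suc m) c)" using fin finite_surj by blast
  have "prod_list (map K [1..<Suc (Suc m)]) = prod_list (map K [1..<Suc m]) * K ?N"
    by simp
  then have "kapp (prod_list (map K [1..<Suc (Suc m)])) \<mu> c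
      = (\<Sum>p\<in>splits c. kapp (prod_list (map K [1..<Suc m])) (\<mu> - wt (snd p)) (fst p) * kapp (K ?N) \<mu> (snd p))"
    by (simp add: kapp_times case_prod_beta del: upt_Suc)
  also have "\<dots> = (\<Sum>p\<in>splits c. \<Sum>h\<in>tuples m (fst p). ?t m (\<mu> - wt (snd p)) h * kapp (K ?N) \<mu> (snd p))"
    by (simp only: Suc[THEN conjunct2] sum_distrib_right)
  also have "\<dots> = (\<Sum>(p, h)\<in>?T. ?t m (\<mu> - wt (snd p)) h * kapp (K ?N) \<mu> (snd p))"
    using Suc by (subst sum.Sigma) auto
  also have "\<dots> = (\<Sum>g\<in>tuples (Suc m) c. ?t (Suc m) \<mu> g)"
  proof (rule sum.reindex_bij_witness[of _ ?j ?i])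
    fix x assume "x \<in> ?T"
    obtain a b h where x: "x = ((a, b), h)" by (metis prod.exhaust)
    have "kapp (K i) (\<mu> - (\<Sum>j\<in>{i<..Suc m}. wt ((h(?N := b)) j))) ((h(?N := b)) i)
        = kapp (K i) (\<mu> - wt b - (\<Sum>j\<in>{i<..m}. wt (h j))) (h i)" if "i \<in> {1..m}" for i
    proof -
      have "{i<..Suc m} = insert ?N {i<..m}" using that by auto
      moreover have "(\<Sum>j\<in>{i<..m}. wt ((h(?N := b)) j)) = (\<Sum>j\<in>{i<..m}. wt (h j))"
        by (rule sum.cong) auto
      ultimately have "(\<Sum>j\<in>{i<..Suc m}. wt ((h(?N := b)) j)) = wt b + (\<Sum>j\<in>{i<..m}. wt (h j))" by simp
      then show ?thesis using that by (simp add: diff_diff_eq)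
    qed
    then have "(\<Prod>i\<in>{1..m}. kapp (K i) (\<mu> - (\<Sum>j\<in>{i<..Suc m}. wt ((h(?N := b)) j))) ((h(?N := b)) i))
        = ?t m (\<mu> - wt b) h" by (rule prod.cong[OF refl])
    then have "?t (Suc m) \<mu> (h(?N := b)) = ?t m (\<mu> - wt b) h * kapp (K ?N) \<mu> b"
      unfolding ivl by (subst prod.insert) (auto simp: mult.commute)
    then show "?t (Suc m) \<mu> (?i x) = (case x of (p, h) \<Rightarrow> ?t m (\<mu> - wt (snd p)) h * kapp (K ?N) \<mu> (snd p))"
      using x by simp
  qed (use i j in blast)+
  finally show ?case using fin' by blast
qed

section \<open>Projected weights and the support condition\<close>

lemma lookup_proj_P: "l \<le> i \<Longrightarrow> lookup (proj_P i x) l = lookup x l"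
proof -
  assume "l \<le> i"
  have "lookup (proj_P i x) l = (\<Sum>k\<le>i. if l = k then lookup x k else 0)"
    unfolding proj_P_def lookup_sum by (rule sum.cong) (auto simp: lookup_single when_def)
  then show ?thesis using \<open>l \<le> i\<close> by simp
qed

text \<open>Each projection discards only coordinates beyond those still compared, so up to
  \<open>n - k\<close> the iterated projections have no effect.\<close>

lemma agree_lam_down:
  "k \<le> n \<Longrightarrow> agree (n - k) (lam_down n \<Lambda> g k) (\<Lambda> - (\<Sum>j\<in>{n - k<..n}. g j))"
proof (induction k)
  case (Suc k)
  have "{n - Suc k<..n} = insert (n - k) {n - k<..n}" using Suc(2) by auto
  then have "(\<Sum>j\<in>{n - Suc k<..n}. g j) = g (n - k) + (\<Sum>j\<in>{n - k<..n}. g j)" by simp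
  then show ?case using Suc by (simp add: agree_def lookup_proj_P lookup_minus lookup_add)
qed (simp add: agree_def)

lemma agree_lam_at:
  assumes "i \<le> n"
  shows "agree i (lam_at n \<Lambda> g i) (\<Lambda> - (\<Sum>j\<in>{i<..n}. g j))"
  using agree_lam_down[of "n - i" n \<Lambda> g] assms by (simp add: lam_at_def)

lemma local_gtw: "local m K \<Longrightarrow> local m (gtw r K)"
  by (cases r) (simp_all add: local_twist)

text \<open>A twist only rescales entries, and the identity is supported at 0, which belongs to
  \<open>Rplus\<close>.\<close>

lemma gtw_support:
  assumes "kapp (gtw r (Fk m (Suc m))) \<mu> c \<noteq> 0"
  shows "wt c \<in> Rplus (Suc m)"
  using assms F_support[of m \<mu> c] by (cases r) (auto simp: kapp_twist kapp_simps Rplus_0 split: if_splits)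

lemma Rplus_subset_range_wt: "Rplus i \<subseteq> range wt"
proof
  fix x assume "x \<in> Rplus i"
  then obtain m :: "nat \<Rightarrow> nat" where x: "x = (\<Sum>k=1..i. frag_cmul (int (m k)) (\<Sum>j=k..i. alpha j))"
    unfolding Rplus_def by blast
  have sum: "(\<Sum>k\<in>A. f k) \<in> range wt" if "\<And>k. k \<in> A \<Longrightarrow> f k \<in> range wt" for A and f :: "nat \<Rightarrow> wt"
    using that
  proof (induction A rule: infinite_finite_induct)
    case (insert k A)
    then obtain a b where "f k = wt a" "sum f A = wt b" by blast
    then show ?case using insert by (simp add: wt_add[symmetric])
  qed (use wt_zero in \<open>metis rangeI sum.infinite sum.empty\<close>)+
  have cmul: "frag_cmul (int k) y \<in> range wt" if "y \<in> range wt" for k y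
  proof -
    have "frag_cmul (int k) y = (\<Sum>_<k. y)" by (induction k) (simp_all add: frag_cmul_distrib del: sum_constant)
    then show ?thesis using sum[of "{..<k}" "\<lambda>_. y"] that by simp
  qed
  have "alpha j \<in> range wt" if "1 \<le> j" for j
    using wt_single[of "j - 1"] that by (metis Suc_diff_1 less_eq_Suc_le rangeI One_nat_def)
  then show "x \<in> range wt" unfolding x by (intro sum cmul) auto
qed

theorem theorem4p4:
  fixes n :: nat and r :: "nat \<Rightarrow> int extended" and \<Lambda> \<beta> :: wt
  assumes "n \<ge> 1"
    and "mono_on {1..n} r"
    and "\<Lambda> \<in> P n"
    and "\<beta> \<in> Qplus n"
  shows "J n (map r [1..<Suc n]) [1..<Suc n] \<Lambda> \<beta> =
    (\<Sum>g \<in> {g \<in> (\<Pi>\<^sub>E i\<in>{1..n}. Rplus i). (\<Sum>i=1..n. g i) = \<beta>}.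
       J n [r 1] [1] (lam_at n \<Lambda> g 1) (g 1) *
       (\<Prod>i=2..n. J n [Minf, r i] [i - 1, i] (lam_at n \<Lambda> g i) (g i)))"
proof -
  obtain c where c: "\<beta> = wt c" using assms(4) unfolding Qplus_eq by blast
  define K where "K i = gtw (r i) (Fk (i - 1) i)" for i
  have local: "local i (K i)" for i
    unfolding K_def by (intro local_gtw local_F) simp
  have support: "wt c \<in> Rplus i" if "kapp (K i) \<mu> c \<noteq> 0" "i \<ge> 1" for i \<mu> c
    using gtw_support[of "r i" "i - 1" \<mu> c] that by (simp add: K_def)
  define trm where "trm h = (\<Prod>i=1..n. kapp (K i) (\<Lambda> - (\<Sum>j\<in>{i<..n}. wt (h j))) (h i))" for h
  \<comment> \<open>The products of kernels are indexed by coefficient vectors, the theorem by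
    weights; \<open>\<Phi>\<close> translates between the two.\<close>
  define S where "S = {h \<in> tuples n c. \<forall>i\<in>{1..n}. wt (h i) \<in> Rplus i}"
  define \<Phi> where "\<Phi> h = restrict (\<lambda>i. wt (h i)) {1..n}" for h :: "nat \<Rightarrow> cvec"
  have "sorted (map r [1..<Suc n])"
    unfolding sorted_map
    by (rule sorted_wrt_mono_rel[of _ "(\<le>)"]) (use assms(2) in \<open>auto simp: mono_on_def simp del: upt_Suc\<close>)
  then have "J n (map r [1..<Suc n]) [1..<Suc n] \<Lambda> \<beta> = kapp (Jprod (map r [1..<Suc n]) [1..<Suc n]) \<Lambda> c"
    unfolding c using assms(1) by (intro J_eq) auto
  also have "Jprod (map r [1..<Suc n]) [1..<Suc n] = prod_list (map K [1..<Suc n])"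
  proof -
    have "map K [1..<Suc n] = map (\<lambda>i. K (Suc i)) [0..<n]"
      by (simp add: map_Suc_upt[symmetric] comp_def del: upt_Suc)
    moreover
    have "gtw (map r [1..<Suc n] ! i) (block [1..<Suc n] i) = K (Suc i)" if "i < n" for i
      using that by (auto simp: block_def K_def nth_append simp del: upt_Suc)
    then have "map (\<lambda>i. gtw (map r [1..<Suc n] ! i) (block [1..<Suc n] i)) [0..<n]
        = map (\<lambda>i. K (Suc i)) [0..<n]" by (intro map_cong) auto
    ultimately show ?thesis by (simp only: Jprod_def length_map length_upt diff_Suc_1)
  qed
  also have "kapp (prod_list (map K [1..<Suc n])) \<Lambda> c = (\<Sum>h\<in>tuples n c. trm h)"
    unfolding trm_def using kapp_prod_list by blast
  \<comment> \<open>If some component lies outside \<open>Rplus i\<close>, the factor with index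
    \<open>i\<close> is zero and the whole term drops out.\<close>
  also have "\<dots> = (\<Sum>h\<in>S. trm h)"
  proof (rule sum.mono_neutral_right)
    show "finite (tuples n c)" using kapp_prod_list by blast
    show "\<forall>h\<in>tuples n c - S. trm h = 0"
    proof
      fix h assume "h \<in> tuples n c - S"
      then obtain i where "i \<in> {1..n}" "wt (h i) \<notin> Rplus i" by (auto simp: S_def)
      then have "kapp (K i) (\<Lambda> - (\<Sum>j\<in>{i<..n}. wt (h j))) (h i) = 0" using support by force
      then show "trm h = 0" unfolding trm_def using \<open>i \<in> {1..n}\<close> by (intro prod_zero) auto
    qed
  qed (auto simp: S_def)
  also have "\<dots> = (\<Sum>h\<in>S. J n [r 1] [1] (lam_at n \<Lambda> (\<Phi> h) 1) (\<Phi> h 1) *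
       (\<Prod>i=2..n. J n [Minf, r i] [i - 1, i] (lam_at n \<Lambda> (\<Phi> h) i) (\<Phi> h i)))"
  proof (rule sum.cong[OF refl])
    fix h
    \<comment> \<open>\<open>lam_at\<close> agrees with the lowered weight in the coordinates up to
      \<open>i\<close>, and \<open>K i\<close> depends on no others.\<close>
    have factor: "kapp (K i) (\<Lambda> - (\<Sum>j\<in>{i<..n}. wt (h j))) (h i) = kapp (K i) (lam_at n \<Lambda> (\<Phi> h) i) (h i)"
      if "i \<in> {1..n}" for i
    proof -
      have "(\<Sum>j\<in>{i<..n}. wt (h j)) = (\<Sum>j\<in>{i<..n}. \<Phi> h j)"
        by (rule sum.cong) (use that in \<open>auto simp: \<Phi>_def\<close>)
      then show ?thesis using localD[OF local agree_lam_at[of i n \<Lambda> "\<Phi> h"]] that by simp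
    qed
    have "J n [r 1] [1] \<mu> (\<Phi> h 1) = kapp (K 1) \<mu> (h 1)" for \<mu>
      using assms(1) J_eq[of "[r 1]" "[1]" n \<mu> "h 1"] by (simp add: \<Phi>_def Jprod_def block_def K_def)
    \<comment> \<open>The block starting at \<open>Minf\<close> contributes the identity, so only
      the factor at \<open>r i\<close> is left.\<close>
    moreover have "J n [Minf, r i] [i - 1, i] \<mu> (\<Phi> h i) = kapp (K i) \<mu> (h i)" if "i \<in> {2..n}" for \<mu> i
    proof -
      have "J n [Minf, r i] [i - 1, i] \<mu> (wt (h i)) = kapp (Jprod [Minf, r i] [i - 1, i]) \<mu> (h i)"
        by (rule J_eq) (use that in auto)
      then show ?thesis using that by (simp add: \<Phi>_def Jprod_def block_def K_def)
    qed
    moreover have "{1..n} = insert 1 {2..n}" using assms(1) by auto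
    ultimately show "trm h = J n [r 1] [1] (lam_at n \<Lambda> (\<Phi> h) 1) (\<Phi> h 1) *
       (\<Prod>i=2..n. J n [Minf, r i] [i - 1, i] (lam_at n \<Lambda> (\<Phi> h) i) (\<Phi> h i))"
      unfolding trm_def by (simp add: factor)
  qed
  also have "\<dots> = (\<Sum>g\<in>\<Phi> ` S. J n [r 1] [1] (lam_at n \<Lambda> g 1) (g 1) *
       (\<Prod>i=2..n. J n [Minf, r i] [i - 1, i] (lam_at n \<Lambda> g i) (g i)))"
  proof (rule sum.reindex[symmetric, unfolded comp_def])
    show "inj_on \<Phi> S"
    proof (rule inj_onI)
      fix h h' assume h: "h \<in> S" "h' \<in> S" and eq: "\<Phi> h = \<Phi> h'"
      have "h i = h' i" if "i \<in> {1..n}" for i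
        using fun_cong[OF eq, of i] that by (simp add: \<Phi>_def wt_eq_iff)
      then show "h = h'" using h by (intro extensionalityI[of _ "{1..n}"]) (auto simp: S_def tuples_def PiE_def)
    qed
  qed
  \<comment> \<open>Elements of \<open>Rplus i\<close> are nonnegative combinations of simple roots,
    so every admissible tuple of weights comes from coefficient vectors.\<close>
  also have "\<Phi> ` S = {g \<in> (\<Pi>\<^sub>E i\<in>{1..n}. Rplus i). (\<Sum>i=1..n. g i) = \<beta>}"
  proof (intro equalityI subsetI)
    fix g assume "g \<in> \<Phi> ` S"
    then obtain h where "h \<in> S" "g = \<Phi> h" by blast
    then show "g \<in> {g \<in> (\<Pi>\<^sub>E i\<in>{1..n}. Rplus i). (\<Sum>i=1..n. g i) = \<beta>}"
      by (auto simp: S_def \<Phi>_def tuples_def c wt_sum[symmetric])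
  next
    fix g assume g: "g \<in> {g \<in> (\<Pi>\<^sub>E i\<in>{1..n}. Rplus i). (\<Sum>i=1..n. g i) = \<beta>}"
    then have "\<forall>i\<in>{1..n}. \<exists>a. g i = wt a" using Rplus_subset_range_wt by (fastforce simp: PiE_def)
    then obtain h where h: "\<And>i. i \<in> {1..n} \<Longrightarrow> g i = wt (h i)" by metis
    have "wt (\<Sum>i=1..n. h i) = wt c" using g h by (simp add: wt_sum c)
    then have "restrict h {1..n} \<in> S" using g h by (auto simp: S_def tuples_def wt_eq_iff PiE_def Pi_def)
    moreover have "g = \<Phi> (restrict h {1..n})"
      by (rule extensionalityI[of _ "{1..n}"]) (use g h in \<open>auto simp: \<Phi>_def PiE_def\<close>)
    ultimately show "g \<in> \<Phi> ` S" by blast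
  qed
  finally show ?thesis .
qed

end
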